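(* Let $\mathcal C$ be a strict monoidal category with coequalizers, let $A$ be a left coflat algebra in $\mathcal C$, and let $(A,X,\psi)$ be a cowreath in $\mathcal C$ with $X$ left coflat in $\mathcal C$. Then $(X,\psi)$ is a Frobenius coalgebra in $\mathcal T_A^\#$ if and only if $AX$ is a Frobenius $A$-coring, i.e. a Frobenius coalgebra in the monoidal category ${}_A^{\,!}\mathcal C_A$.
   Context: Conventions: $\mathcal C$ is a strict monoidal category with unit object $\underline 1$; the tensor product is written by juxtaposition, and the identity morphism of $X$ is written $X$ (so $fA=f\otimes \mathrm{Id}_A$). $(A,m,\eta)$ is an algebra in $\mathcal C$. Right (left) actions are denoted $\mu$ ($\nu$). Transfer morphisms: $\mathcal T_A^\#$ has as objects the pairs $(X,\psi)$, $\psi:XA\to AX$ with $\psi\circ Xm=mX\circ A\psi\circ\psi A$ and $\psi\circ X\eta=\eta X$. A morphism $(X,\psi_X)\to(Y,\psi_Y)$ is $f:X\to AY$ in $\mathcal C$ with $mY\circ Af\circ\psi_X=mY\circ A\psi_Y\circ fA$; composition $g\bullet f=mZ\circ Ag\circ f$, identity $\eta X$; tensor product of objects $(XY,\psi_XY\circ X\psi_Y)$, of morphisms $f:X\to AX'$, $g:Y\to AY'$: $mX'Y'\circ A\psi_{X'}Y'\circ fg$; unit object $(\underline 1,A)$. Cowreath: $(A,X,\psi)$ with $(X,\psi)$ a coalgebra in $\mathcal T_A^\#$; explicitly there are $\delta:X\to AXX$, $\epsilon:X\to A$ with $mXX\circ A\psi X\circ AX\psi\circ\delta A=mXX\circ A\delta\circ\psi$;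 $mXXX\circ A\delta X\circ\delta=mXXX\circ A\psi XX\circ AX\delta\circ\delta$; $m\circ A\epsilon\circ\psi=m\circ\epsilon A$; $mX\circ A\epsilon X\circ\delta=\eta X=mX\circ A\psi\circ AX\epsilon\circ\delta$. Frobenius coalgebra: a coalgebra $(C,\Delta,\varepsilon)$ in a monoidal category (with tensor product written by juxtaposition and unit $\underline 1$) is Frobenius if there are morphisms $t:\underline 1\to C$, $B:CC\to\underline 1$ with $CB\circ\Delta C=BC\circ C\Delta$ and $B\circ tC=\varepsilon=B\circ Ct$. Bimodules: $X\in\mathcal C$ is left coflat if $-\otimes X:\mathcal C\to\mathcal C$ preserves coequalizers. For $X\in\mathcal C_A$, $Y\in{}_A\mathcal C$, $q:XY\to X\otimes_AY$ is the coequalizer of $\mu Y,X\nu:XAY\to XY$. $Y\in{}_A\mathcal C$ is robust if for all $M\in\mathcal C$, $X\in\mathcal C_A$, $Mq:MXY\to M(X\otimes_AY)$ is the coequalizer of $M\mu Y$ and $MX\nu$. For $A$ left coflat, ${}_A^{\,!}\mathcal C_A$ is the full subcategory of ${}_A\mathcal C_A$ of the bimodules that are left coflat in $\mathcal C$ and robust as left $A$-modules; it is monoidal with tensor product $\otimes_A$ and unit $A$ (constraints induced by the universal property of coequalizers). An $A$-coring is a coalgebra in ${}_A^{\,!}\mathcal C_A$. The coring $AX$: $AX\in{}_A^{\,!}\mathcal C_A$ with left action $mX$ and right action $\mu_{AX}=mX\circ A\psi$. One identifies $AX\otimes_AAX=AXX$, with coequalizer map $\mu_{AX}X:AXAX\to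 AXX$. The coalgebra structure of $(X,\psi)$ makes $AX$ an $A$-coring with comultiplication $mXX\circ A\delta:AX\to AXX$ and counit $m\circ A\epsilon:AX\to A$. *)

theory Defs
  imports Main
begin

text \<open>
  A category is given by its set of objects and its set of arrows, every arrow carrying its
  domain and codomain; composition is written in the usual (right-to-left) order.
  The record \<open>tensor_cat\<close> carries the data of a strict monoidal category, and
  \<open>mon_cat\<close> adds the associativity and unit constraints
  \<open>(XY)Z \<rightarrow> X(YZ)\<close>, \<open>1X \<rightarrow> X\<close>, \<open>X1 \<rightarrow> X\<close> of a monoidal category that need not be strict.
\<close>

record ('o, 'a) tensor_cat =
  Obj :: "'o set"
  Arr :: "'a set"
  Dom :: "'a \<Rightarrow> 'o"
  Cod :: "'a \<Rightarrow> 'o"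
  Ide :: "'o \<Rightarrow> 'a"
  Comp :: "'a \<Rightarrow> 'a \<Rightarrow> 'a" (infixr "\<cdot>\<index>" 60)
  TObj :: "'o \<Rightarrow> 'o \<Rightarrow> 'o" (infixr "\<boxtimes>\<index>" 80)
  TArr :: "'a \<Rightarrow> 'a \<Rightarrow> 'a" (infixr "\<otimes>\<index>" 70)
  Unit :: "'o" ("\<one>\<index>")

record ('o, 'a) mon_cat = "('o, 'a) tensor_cat" +
  Assoc :: "'o \<Rightarrow> 'o \<Rightarrow> 'o \<Rightarrow> 'a"
  LUnit :: "'o \<Rightarrow> 'a"
  RUnit :: "'o \<Rightarrow> 'a"

text \<open>Tensoring with an identity: \<open>X \<triangleleft> f\<close> is written $Xf$ and \<open>f \<triangleright> X\<close> is written $fX$ on paper.\<close>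

abbreviation lwhisk :: "('o, 'a, 'z) tensor_cat_scheme \<Rightarrow> 'o \<Rightarrow> 'a \<Rightarrow> 'a"
    ("(_ \<triangleleft>\<index> _)" [71, 70] 70) where
  "X \<triangleleft>\<^bsub>C\<^esub> f \<equiv> Ide C X \<otimes>\<^bsub>C\<^esub> f"

abbreviation rwhisk :: "('o, 'a, 'z) tensor_cat_scheme \<Rightarrow> 'a \<Rightarrow> 'o \<Rightarrow> 'a"
    ("(_ \<triangleright>\<index> _)" [71, 71] 70) where
  "f \<triangleright>\<^bsub>C\<^esub> X \<equiv> f \<otimes>\<^bsub>C\<^esub> Ide C X"

definition hom :: "('o, 'a, 'z) tensor_cat_scheme \<Rightarrow> 'o \<Rightarrow> 'o \<Rightarrow> 'a set" where
  "hom C X Y = {f \<in> Arr C. Dom C f = X \<and> Cod C f = Y}"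

locale category =
  fixes C :: "('o, 'a, 'z) tensor_cat_scheme" (structure)
  assumes dom_cod_obj: "f \<in> Arr C \<Longrightarrow> Dom C f \<in> Obj C \<and> Cod C f \<in> Obj C"
    and ide_hom: "X \<in> Obj C \<Longrightarrow> Ide C X \<in> hom C X X"
    and comp_hom: "\<lbrakk>f \<in> hom C X Y; g \<in> hom C Y Z\<rbrakk> \<Longrightarrow> g \<cdot> f \<in> hom C X Z"
    and comp_ide_right: "f \<in> hom C X Y \<Longrightarrow> f \<cdot> Ide C X = f"
    and comp_ide_left: "f \<in> hom C X Y \<Longrightarrow> Ide C Y \<cdot> f = f"
    and comp_assoc: "\<lbrakk>f \<in> hom C W X; g \<in> hom C X Y; h \<in> hom C Y Z\<rbrakk> \<Longrightarrow>
                       (h \<cdot> g) \<cdot> f = h \<cdot> (g \<cdot> f)"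

locale strict_monoidal_category = category +
  assumes unit_obj: "\<one> \<in> Obj C"
    and tens_obj: "\<lbrakk>X \<in> Obj C; Y \<in> Obj C\<rbrakk> \<Longrightarrow> X \<boxtimes> Y \<in> Obj C"
    and tens_hom: "\<lbrakk>f \<in> hom C X X'; g \<in> hom C Y Y'\<rbrakk> \<Longrightarrow> f \<otimes> g \<in> hom C (X \<boxtimes> Y) (X' \<boxtimes> Y')"
    and tens_ide: "\<lbrakk>X \<in> Obj C; Y \<in> Obj C\<rbrakk> \<Longrightarrow> Ide C X \<otimes> Ide C Y = Ide C (X \<boxtimes> Y)"
    and interchange: "\<lbrakk>f \<in> hom C X X'; f' \<in> hom C X' X''; g \<in> hom C Y Y'; g' \<in> hom C Y' Y''\<rbrakk> \<Longrightarrow>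
                        (f' \<cdot> f) \<otimes> (g' \<cdot> g) = (f' \<otimes> g') \<cdot> (f \<otimes> g)"
    and tens_obj_assoc: "\<lbrakk>X \<in> Obj C; Y \<in> Obj C; Z \<in> Obj C\<rbrakk> \<Longrightarrow> (X \<boxtimes> Y) \<boxtimes> Z = X \<boxtimes> (Y \<boxtimes> Z)"
    and tens_arr_assoc: "\<lbrakk>f \<in> Arr C; g \<in> Arr C; h \<in> Arr C\<rbrakk> \<Longrightarrow> (f \<otimes> g) \<otimes> h = f \<otimes> (g \<otimes> h)"
    and unit_tens_obj: "X \<in> Obj C \<Longrightarrow> \<one> \<boxtimes> X = X"
    and tens_unit_obj: "X \<in> Obj C \<Longrightarrow> X \<boxtimes> \<one> = X"
    and unit_tens_arr: "f \<in> Arr C \<Longrightarrow> Ide C \<one> \<otimes> f = f"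
    and tens_unit_arr: "f \<in> Arr C \<Longrightarrow> f \<otimes> Ide C \<one> = f"

definition inverse_arr :: "('o, 'a, 'z) tensor_cat_scheme \<Rightarrow> 'a \<Rightarrow> 'a" where
  "inverse_arr C f = (THE g. g \<in> hom C (Cod C f) (Dom C f) \<and>
     g \<cdot>\<^bsub>C\<^esub> f = Ide C (Dom C f) \<and> f \<cdot>\<^bsub>C\<^esub> g = Ide C (Cod C f))"

context
  fixes M :: "('o, 'a, 'z) mon_cat_scheme" (structure)
begin

definition coalgebra :: "'o \<Rightarrow> 'a \<Rightarrow> 'a \<Rightarrow> bool" where
  "coalgebra X \<Delta> \<epsilon> \<longleftrightarrow>
     X \<in> Obj M \<and> \<Delta> \<in> hom M X (X \<boxtimes> X) \<and> \<epsilon> \<in> hom M X \<one> \<and>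
     Assoc M X X X \<cdot> (\<Delta> \<triangleright> X) \<cdot> \<Delta> = (X \<triangleleft> \<Delta>) \<cdot> \<Delta> \<and>
     LUnit M X \<cdot> (\<epsilon> \<triangleright> X) \<cdot> \<Delta> = Ide M X \<and>
     RUnit M X \<cdot> (X \<triangleleft> \<epsilon>) \<cdot> \<Delta> = Ide M X"

text \<open>
  The strict conditions $CB\circ\Delta C = BC\circ C\Delta$ and
  $B\circ tC = \varepsilon = B\circ Ct$, with the constraints put back in.
\<close>

definition frobenius_coalgebra :: "'o \<Rightarrow> 'a \<Rightarrow> 'a \<Rightarrow> bool" where
  "frobenius_coalgebra X \<Delta> \<epsilon> \<longleftrightarrow>
     coalgebra X \<Delta> \<epsilon> \<and>
     (\<exists>t \<in> hom M \<one> X. \<exists>B \<in> hom M (X \<boxtimes> X) \<one>.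
        RUnit M X \<cdot> (X \<triangleleft> B) \<cdot> Assoc M X X X \<cdot> (\<Delta> \<triangleright> X) =
        LUnit M X \<cdot> (B \<triangleright> X) \<cdot> inverse_arr M (Assoc M X X X) \<cdot> (X \<triangleleft> \<Delta>) \<and>
        B \<cdot> (t \<triangleright> X) \<cdot> inverse_arr M (LUnit M X) = \<epsilon> \<and>
        B \<cdot> (X \<triangleleft> t) \<cdot> inverse_arr M (RUnit M X) = \<epsilon>)"

end

context
  fixes C :: "('o, 'a, 'z) tensor_cat_scheme" (structure)
begin

definition parallel_pair :: "'a \<Rightarrow> 'a \<Rightarrow> bool" where
  "parallel_pair f g \<longleftrightarrow> f \<in> Arr C \<and> g \<in> Arr C \<and> Dom C f = Dom C g \<and> Cod C f = Cod C g"

definition is_coequalizer :: "'a \<Rightarrow> 'a \<Rightarrow> 'a \<Rightarrow> bool" where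
  "is_coequalizer f g e \<longleftrightarrow>
     parallel_pair f g \<and> e \<in> Arr C \<and> Dom C e = Cod C f \<and> e \<cdot> f = e \<cdot> g \<and>
     (\<forall>h \<in> Arr C. Dom C h = Cod C f \<and> h \<cdot> f = h \<cdot> g \<longrightarrow>
        (\<exists>!k. k \<in> hom C (Cod C e) (Cod C h) \<and> k \<cdot> e = h))"

text \<open>
  ``\<open>C\<close> has coequalizers'': \<open>Q\<close> is an arbitrary choice of coequalizers. It is kept
  as a parameter because the tensor product over \<open>A\<close> below depends on such a choice.
\<close>

definition has_coequalizers :: "('a \<Rightarrow> 'a \<Rightarrow> 'a) \<Rightarrow> bool" where
  "has_coequalizers Q \<longleftrightarrow> (\<forall>f g. parallel_pair f g \<longrightarrow> is_coequalizer f g (Q f g))"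

definition left_coflat :: "'o \<Rightarrow> bool" where
  "left_coflat X \<longleftrightarrow> X \<in> Obj C \<and>
     (\<forall>f g e. is_coequalizer f g e \<longrightarrow> is_coequalizer (f \<triangleright> X) (g \<triangleright> X) (e \<triangleright> X))"

definition factor :: "'a \<Rightarrow> 'a \<Rightarrow> 'a" where
  "factor h e = (THE k. k \<in> hom C (Cod C e) (Cod C h) \<and> k \<cdot> e = h)"

definition algebra :: "'o \<Rightarrow> 'a \<Rightarrow> 'a \<Rightarrow> bool" where
  "algebra A m \<eta> \<longleftrightarrow>
     A \<in> Obj C \<and> m \<in> hom C (A \<boxtimes> A) A \<and> \<eta> \<in> hom C \<one> A \<and>
     m \<cdot> (m \<triangleright> A) = m \<cdot> (A \<triangleleft> m) \<and>
     m \<cdot> (\<eta> \<triangleright> A) = Ide C A \<and> m \<cdot> (A \<triangleleft> \<eta>) = Ide C A"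

end

text \<open>
  Arrows of $\mathcal T_A^\#$ are triples (source, underlying morphism, target). The category is
  strict, so its constraints are identities.
\<close>

type_synonym ('o, 'a) tr_obj = "'o \<times> 'a"
type_synonym ('o, 'a) tr_arr = "('o, 'a) tr_obj \<times> 'a \<times> ('o, 'a) tr_obj"

context
  fixes C :: "('o, 'a, 'z) tensor_cat_scheme" (structure)
    and A :: 'o and m \<eta> :: 'a
begin

definition transfer_objs :: "('o, 'a) tr_obj set" where
  "transfer_objs = {(X, \<psi>). X \<in> Obj C \<and> \<psi> \<in> hom C (X \<boxtimes> A) (A \<boxtimes> X) \<and>
     \<psi> \<cdot> (X \<triangleleft> m) = (m \<triangleright> X) \<cdot> (A \<triangleleft> \<psi>) \<cdot> (\<psi> \<triangleright> A) \<and>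
     \<psi> \<cdot> (X \<triangleleft> \<eta>) = \<eta> \<triangleright> X}"

definition transfer_arrs :: "('o, 'a) tr_arr set" where
  "transfer_arrs = {((X, \<psi>), f, (Y, \<phi>)).
     (X, \<psi>) \<in> transfer_objs \<and> (Y, \<phi>) \<in> transfer_objs \<and> f \<in> hom C X (A \<boxtimes> Y) \<and>
     (m \<triangleright> Y) \<cdot> (A \<triangleleft> f) \<cdot> \<psi> = (m \<triangleright> Y) \<cdot> (A \<triangleleft> \<phi>) \<cdot> (f \<triangleright> A)}"

fun transfer_ide :: "('o, 'a) tr_obj \<Rightarrow> ('o, 'a) tr_arr" where
  "transfer_ide (X, \<psi>) = ((X, \<psi>), \<eta> \<triangleright> X, (X, \<psi>))"

fun transfer_comp :: "('o, 'a) tr_arr \<Rightarrow> ('o, 'a) tr_arr \<Rightarrow> ('o, 'a) tr_arr" where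
  "transfer_comp (y, g, (Z, \<omega>)) (x, f, y') = (x, (m \<triangleright> Z) \<cdot> (A \<triangleleft> g) \<cdot> f, (Z, \<omega>))"

fun transfer_tobj :: "('o, 'a) tr_obj \<Rightarrow> ('o, 'a) tr_obj \<Rightarrow> ('o, 'a) tr_obj" where
  "transfer_tobj (X, \<psi>) (Y, \<phi>) = (X \<boxtimes> Y, (\<psi> \<triangleright> Y) \<cdot> (X \<triangleleft> \<phi>))"

fun transfer_tarr :: "('o, 'a) tr_arr \<Rightarrow> ('o, 'a) tr_arr \<Rightarrow> ('o, 'a) tr_arr" where
  "transfer_tarr (x, f, (X', \<psi>')) (y, g, (Y', \<phi>')) =
     (transfer_tobj x y,
      (m \<triangleright> (X' \<boxtimes> Y')) \<cdot> (A \<triangleleft> (\<psi>' \<triangleright> Y')) \<cdot> (f \<otimes> g),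
      transfer_tobj (X', \<psi>') (Y', \<phi>'))"

definition transfer_unit :: "('o, 'a) tr_obj" where
  "transfer_unit = (\<one>, Ide C A)"

definition transfer_cat :: "(('o, 'a) tr_obj, ('o, 'a) tr_arr) mon_cat" where
  "transfer_cat = \<lparr>
     Obj = transfer_objs,
     Arr = transfer_arrs,
     Dom = (\<lambda>(x, f, y). x),
     Cod = (\<lambda>(x, f, y). y),
     Ide = transfer_ide,
     Comp = transfer_comp,
     TObj = transfer_tobj,
     TArr = transfer_tarr,
     Unit = transfer_unit,
     Assoc = (\<lambda>x y z. transfer_ide (transfer_tobj (transfer_tobj x y) z)),
     LUnit = transfer_ide,
     RUnit = transfer_ide\<rparr>"

definition transfer_comult :: "'o \<Rightarrow> 'a \<Rightarrow> 'a \<Rightarrow> ('o, 'a) tr_arr" where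
  "transfer_comult X \<psi> \<delta> = ((X, \<psi>), \<delta>, transfer_tobj (X, \<psi>) (X, \<psi>))"

definition transfer_counit :: "'o \<Rightarrow> 'a \<Rightarrow> 'a \<Rightarrow> ('o, 'a) tr_arr" where
  "transfer_counit X \<psi> \<epsilon> = ((X, \<psi>), \<epsilon>, transfer_unit)"

definition cowreath :: "'o \<Rightarrow> 'a \<Rightarrow> 'a \<Rightarrow> 'a \<Rightarrow> bool" where
  "cowreath X \<psi> \<delta> \<epsilon> \<longleftrightarrow>
     coalgebra transfer_cat (X, \<psi>) (transfer_comult X \<psi> \<delta>) (transfer_counit X \<psi> \<epsilon>)"

end

datatype ('o, 'a) bimod = Bimod (und: 'o) (lact: 'a) (ract: 'a)

text \<open>Arrows are again triples (source, underlying morphism, target).\<close>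

type_synonym ('o, 'a) bim_arr = "('o, 'a) bimod \<times> 'a \<times> ('o, 'a) bimod"

context
  fixes C :: "('o, 'a, 'z) tensor_cat_scheme" (structure)
    and Q :: "'a \<Rightarrow> 'a \<Rightarrow> 'a"
    and A :: 'o and m \<eta> :: 'a
begin

definition left_module :: "'o \<Rightarrow> 'a \<Rightarrow> bool" where
  "left_module Y \<nu> \<longleftrightarrow> Y \<in> Obj C \<and> \<nu> \<in> hom C (A \<boxtimes> Y) Y \<and>
     \<nu> \<cdot> (m \<triangleright> Y) = \<nu> \<cdot> (A \<triangleleft> \<nu>) \<and> \<nu> \<cdot> (\<eta> \<triangleright> Y) = Ide C Y"

definition right_module :: "'o \<Rightarrow> 'a \<Rightarrow> bool" where
  "right_module X \<mu> \<longleftrightarrow> X \<in> Obj C \<and> \<mu> \<in> hom C (X \<boxtimes> A) X \<and>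
     \<mu> \<cdot> (X \<triangleleft> m) = \<mu> \<cdot> (\<mu> \<triangleright> A) \<and> \<mu> \<cdot> (X \<triangleleft> \<eta>) = Ide C X"

definition bimodule :: "('o, 'a) bimod \<Rightarrow> bool" where
  "bimodule M \<longleftrightarrow> left_module (und M) (lact M) \<and> right_module (und M) (ract M) \<and>
     lact M \<cdot> (A \<triangleleft> ract M) = ract M \<cdot> (lact M \<triangleright> A)"

text \<open>The coequalizer map $q : XY \to X\otimes_A Y$; the object $X\otimes_A Y$ is its codomain.\<close>

definition tens_map :: "'o \<Rightarrow> 'a \<Rightarrow> 'o \<Rightarrow> 'a \<Rightarrow> 'a" where
  "tens_map X \<mu> Y \<nu> = Q (\<mu> \<triangleright> Y) (X \<triangleleft> \<nu>)"

definition robust :: "'o \<Rightarrow> 'a \<Rightarrow> bool" where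
  "robust Y \<nu> \<longleftrightarrow> left_module Y \<nu> \<and>
     (\<forall>W X \<mu>. W \<in> Obj C \<and> right_module X \<mu> \<longrightarrow>
        is_coequalizer C (W \<triangleleft> (\<mu> \<triangleright> Y)) (W \<triangleleft> (X \<triangleleft> \<nu>)) (W \<triangleleft> tens_map X \<mu> Y \<nu>))"

definition bimod_objs :: "('o, 'a) bimod set" where
  "bimod_objs = {M. bimodule M \<and> left_coflat C (und M) \<and> robust (und M) (lact M)}"

definition bimod_arrs :: "('o, 'a) bim_arr set" where
  "bimod_arrs = {(M, f, N). M \<in> bimod_objs \<and> N \<in> bimod_objs \<and> f \<in> hom C (und M) (und N) \<and>
     f \<cdot> lact M = lact N \<cdot> (A \<triangleleft> f) \<and> f \<cdot> ract M = ract N \<cdot> (f \<triangleright> A)}"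

definition bimod_q :: "('o, 'a) bimod \<Rightarrow> ('o, 'a) bimod \<Rightarrow> 'a" where
  "bimod_q M N = tens_map (und M) (ract M) (und N) (lact N)"

text \<open>
  All structure on $M\otimes_A N$ is induced by universal properties: the actions are
  determined by \<open>\<nu> \<cdot> (A \<triangleleft> q) = q \<cdot> (lact M \<triangleright> und N)\<close> and \<open>\<mu> \<cdot> (q \<triangleright> A) = q \<cdot> (und M \<triangleleft> ract N)\<close>,
  and \<^const>\<open>factor\<close> picks the unique arrow with such a property.
\<close>

definition bimod_tobj :: "('o, 'a) bimod \<Rightarrow> ('o, 'a) bimod \<Rightarrow> ('o, 'a) bimod" where
  "bimod_tobj M N = Bimod (Cod C (bimod_q M N))
     (factor C (bimod_q M N \<cdot> (lact M \<triangleright> und N)) (A \<triangleleft> bimod_q M N))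
     (factor C (bimod_q M N \<cdot> (und M \<triangleleft> ract N)) (bimod_q M N \<triangleright> A))"

fun bimod_tarr :: "('o, 'a) bim_arr \<Rightarrow> ('o, 'a) bim_arr \<Rightarrow> ('o, 'a) bim_arr" where
  "bimod_tarr (M, f, M') (N, g, N') =
     (bimod_tobj M N, factor C (bimod_q M' N' \<cdot> (f \<otimes> g)) (bimod_q M N), bimod_tobj M' N')"

definition bimod_unit :: "('o, 'a) bimod" where
  "bimod_unit = Bimod A m m"

definition bimod_assoc ::
    "('o, 'a) bimod \<Rightarrow> ('o, 'a) bimod \<Rightarrow> ('o, 'a) bimod \<Rightarrow> ('o, 'a) bim_arr" where
  "bimod_assoc M N P =
     (bimod_tobj (bimod_tobj M N) P,
      factor C (bimod_q M (bimod_tobj N P) \<cdot> (und M \<triangleleft> bimod_q N P))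
               (bimod_q (bimod_tobj M N) P \<cdot> (bimod_q M N \<triangleright> und P)),
      bimod_tobj M (bimod_tobj N P))"

definition bimod_cat :: "(('o, 'a) bimod, ('o, 'a) bim_arr) mon_cat" where
  "bimod_cat = \<lparr>
     Obj = bimod_objs,
     Arr = bimod_arrs,
     Dom = (\<lambda>(M, f, N). M),
     Cod = (\<lambda>(M, f, N). N),
     Ide = (\<lambda>M. (M, Ide C (und M), M)),
     Comp = (\<lambda>(N, g, P) (M, f, N'). (M, g \<cdot> f, P)),
     TObj = bimod_tobj,
     TArr = bimod_tarr,
     Unit = bimod_unit,
     Assoc = bimod_assoc,
     LUnit = (\<lambda>M. (bimod_tobj bimod_unit M, factor C (lact M) (bimod_q bimod_unit M), M)),
     RUnit = (\<lambda>M. (bimod_tobj M bimod_unit, factor C (ract M) (bimod_q M bimod_unit), M))\<rparr>"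

definition coring_obj :: "'o \<Rightarrow> 'a \<Rightarrow> ('o, 'a) bimod" where
  "coring_obj X \<psi> = Bimod (A \<boxtimes> X) (m \<triangleright> X) ((m \<triangleright> X) \<cdot> (A \<triangleleft> \<psi>))"

text \<open>
  The identification of $AXX$ with $AX\otimes_A AX$, under which the coequalizer map becomes
  $\mu_{AX}X$: the arrow \<open>\<iota> : AXX \<rightarrow> AX \<otimes>\<^sub>A AX\<close> with \<open>\<iota> \<cdot> (\<mu>\<^sub>A\<^sub>X \<triangleright> X) = q\<close>.
\<close>

definition coring_ident :: "'o \<Rightarrow> 'a \<Rightarrow> 'a" where
  "coring_ident X \<psi> =
     factor C (bimod_q (coring_obj X \<psi>) (coring_obj X \<psi>)) (ract (coring_obj X \<psi>) \<triangleright> X)"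

definition coring_comult :: "'o \<Rightarrow> 'a \<Rightarrow> 'a \<Rightarrow> ('o, 'a) bim_arr" where
  "coring_comult X \<psi> \<delta> =
     (coring_obj X \<psi>,
      coring_ident X \<psi> \<cdot> (m \<triangleright> (X \<boxtimes> X)) \<cdot> (A \<triangleleft> \<delta>),
      bimod_tobj (coring_obj X \<psi>) (coring_obj X \<psi>))"

definition coring_counit :: "'o \<Rightarrow> 'a \<Rightarrow> 'a \<Rightarrow> ('o, 'a) bim_arr" where
  "coring_counit X \<psi> \<epsilon> = (coring_obj X \<psi>, m \<cdot> (A \<triangleleft> \<epsilon>), bimod_unit)"

end

end

theory Submission
  imports Defs
begin

text \<open>
  The assignment $(Y,\phi) \mapsto AY$, $f \mapsto mZ\circ Af$ embeds the left coflat transfer objects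
  fully faithfully into the bimodules: left linear maps $AY \to AZ$ correspond to maps $Y \to AZ$, and
  right linearity is the condition defining a transfer morphism. It is strong monoidal, because
  $\mu_{AY}Z : AYAZ \to AYZ$ is a split coequalizer of the pair defining $AY\otimes_A AZ$, and the
  tensor product of transfer morphisms $f$, $g$ is by definition $\mu_{AY'}Z'\circ fg$. The coring $AX$
  is the image of the coalgebra $(X,\psi)$, and such an embedding preserves and reflects the Frobenius
  property.
\<close>

section \<open>Coequalizers in strict monoidal categories\<close>

text \<open>The product of AX with itself over A depends on the arbitrary choice \<open>Q\<close>:
  it is isomorphic, not equal, to AXX, iterated products are further still from the form AY, and
  associators and unitors are bare \<open>factor\<close> terms. A proof that all bimodules in
  question form a monoidal category is avoided by working with those isomorphic to some AY with Y
  left coflat, where tensor products and constraints can be computed. The transfer equations are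
  rewritten in terms of the right action \<open>act y\<close> on AY: transfer objects are right
  actions on AY that commute with multiplication from the left, transfer morphisms are bilinear
  maps. An equation about a tensor product is checked after precomposition with an epi built from
  \<open>bal y z\<close> or \<open>q M N\<close>, where it becomes an identity between actions. The
  data t and B run between the objects 1, X and XX, so full faithfulness on left coflat objects is
  enough to move them in both directions. Coflatness of A lets right actions descend to tensor
  products; coflatness of X makes AX an object of the bimodule category.\<close>

definition epi :: "('o, 'a, 'z) tensor_cat_scheme \<Rightarrow> 'a \<Rightarrow> bool" where
  "epi C e \<longleftrightarrow> e \<in> Arr C \<and>
     (\<forall>f \<in> Arr C. \<forall>g \<in> Arr C. Dom C f = Cod C e \<and> Dom C g = Cod C e \<and>
        f \<cdot>\<^bsub>C\<^esub> e = g \<cdot>\<^bsub>C\<^esub> e \<longrightarrow> f = g)"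

context category
begin

lemma arr_dom_cod [simp]: "f \<in> Arr C \<Longrightarrow> Dom C f \<in> Obj C" "f \<in> Arr C \<Longrightarrow> Cod C f \<in> Obj C"
  using dom_cod_obj by auto

lemma ide_arr [simp]:
  "X \<in> Obj C \<Longrightarrow> Ide C X \<in> Arr C" "X \<in> Obj C \<Longrightarrow> Dom C (Ide C X) = X"
  "X \<in> Obj C \<Longrightarrow> Cod C (Ide C X) = X"
  using ide_hom by (auto simp: hom_def)

lemma comp_arr [simp]:
  assumes "f \<in> Arr C" "g \<in> Arr C" "Dom C g = Cod C f"
  shows "g \<cdot> f \<in> Arr C" "Dom C (g \<cdot> f) = Dom C f" "Cod C (g \<cdot> f) = Cod C g"
  using comp_hom[of f "Dom C f" "Cod C f" g "Cod C g"] assms by (auto simp: hom_def)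

lemma comp_ide [simp]:
  "\<lbrakk>f \<in> Arr C; Dom C f = X\<rbrakk> \<Longrightarrow> f \<cdot> Ide C X = f"
  "\<lbrakk>f \<in> Arr C; Cod C f = X\<rbrakk> \<Longrightarrow> Ide C X \<cdot> f = f"
  using comp_ide_right comp_ide_left by (auto simp: hom_def)

lemma comp_assoc' [simp]:
  "\<lbrakk>f \<in> Arr C; g \<in> Arr C; h \<in> Arr C; Dom C g = Cod C f; Dom C h = Cod C g\<rbrakk> \<Longrightarrow>
     (h \<cdot> g) \<cdot> f = h \<cdot> (g \<cdot> f)"
  using comp_assoc by (auto simp: hom_def)

lemma epi_arr: "epi C e \<Longrightarrow> e \<in> Arr C"
  by (simp add: epi_def)

lemma epiD:
  "\<lbrakk>epi C e; f \<cdot> e = g \<cdot> e; f \<in> Arr C; g \<in> Arr C; Dom C f = Cod C e; Dom C g = Cod C e\<rbrakk> \<Longrightarrow> f = g"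
  by (auto simp: epi_def)

lemma epi_comp:
  assumes "epi C e" "epi C e'" "Dom C e' = Cod C e"
  shows "epi C (e' \<cdot> e)"
  unfolding epi_def
proof (intro conjI ballI impI)
  note [simp] = assms(3) epi_arr[OF assms(1)] epi_arr[OF assms(2)]
  show "e' \<cdot> e \<in> Arr C" by simp
  fix f g assume [simp]: "f \<in> Arr C" "g \<in> Arr C"
    and a: "Dom C f = Cod C (e' \<cdot> e) \<and> Dom C g = Cod C (e' \<cdot> e) \<and> f \<cdot> e' \<cdot> e = g \<cdot> e' \<cdot> e"
  then have [simp]: "Dom C f = Cod C e'" "Dom C g = Cod C e'" by auto
  have "f \<cdot> e' = g \<cdot> e'" by (rule epiD[OF assms(1)]) (use a in auto)
  then show "f = g" by (rule epiD[OF assms(2)]) auto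
qed

lemma split_epi:
  assumes "e \<in> hom C R T" "s \<in> hom C T R" "e \<cdot> s = Ide C T"
  shows "epi C e"
  unfolding epi_def
proof (intro conjI ballI impI)
  note [simp] = assms[unfolded hom_def, simplified]
  show "e \<in> Arr C" by simp
  fix f g assume [simp]: "f \<in> Arr C" "g \<in> Arr C"
    and a: "Dom C f = Cod C e \<and> Dom C g = Cod C e \<and> f \<cdot> e = g \<cdot> e"
  then have [simp]: "Dom C f = T" "Dom C g = T" and eq: "f \<cdot> e = g \<cdot> e" by auto
  have "f = (f \<cdot> e) \<cdot> s" by (simp add: assms(3))
  also have "\<dots> = g" unfolding eq by (simp add: assms(3))
  finally show "f = g" .
qed

lemma coequalizer_epi:
  assumes "is_coequalizer C f g e"
  shows "epi C e"
  unfolding epi_def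
proof (intro conjI ballI impI)
  have [simp]: "f \<in> Arr C" "g \<in> Arr C" "Dom C g = Dom C f" "Cod C g = Cod C f" "e \<in> Arr C"
    "Dom C e = Cod C f" and eq: "e \<cdot> f = e \<cdot> g"
    and u: "\<And>h. \<lbrakk>h \<in> Arr C; Dom C h = Cod C f; h \<cdot> f = h \<cdot> g\<rbrakk> \<Longrightarrow>
      \<exists>!k. k \<in> hom C (Cod C e) (Cod C h) \<and> k \<cdot> e = h"
    using assms by (auto simp: is_coequalizer_def parallel_pair_def)
  show "e \<in> Arr C" by simp
  fix h k assume [simp]: "h \<in> Arr C" "k \<in> Arr C"
    and "Dom C h = Cod C e \<and> Dom C k = Cod C e \<and> h \<cdot> e = k \<cdot> e"
  then have [simp]: "Dom C h = Cod C e" "Dom C k = Cod C e" and hk: "h \<cdot> e = k \<cdot> e" by auto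
  \<comment> \<open>\<open>epi\<close> does not ask \<open>h\<close> and \<open>k\<close> to have
    the same codomain; the equality of the composites forces it, and only then does the uniqueness
    clause speak about both.\<close>
  have "Cod C (h \<cdot> e) = Cod C (k \<cdot> e)" by (simp only: hk)
  then have [simp]: "Cod C h = Cod C k" by simp
  have "\<exists>!l. l \<in> hom C (Cod C e) (Cod C (h \<cdot> e)) \<and> l \<cdot> e = h \<cdot> e"
    by (rule u) (simp_all add: eq)
  moreover have "h \<in> hom C (Cod C e) (Cod C (h \<cdot> e))" "k \<in> hom C (Cod C e) (Cod C (h \<cdot> e))"
    by (simp_all add: hom_def)
  ultimately show "h = k" using hk by metis
qed

lemma coequalizer_factor:
  assumes "is_coequalizer C f g e" "h \<in> Arr C" "Dom C h = Dom C e" "h \<cdot> f = h \<cdot> g"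
  shows "factor C h e \<in> hom C (Cod C e) (Cod C h)" "factor C h e \<cdot> e = h"
proof -
  have "\<exists>!k. k \<in> hom C (Cod C e) (Cod C h) \<and> k \<cdot> e = h"
    using assms by (auto simp: is_coequalizer_def)
  from theI'[OF this] show "factor C h e \<in> hom C (Cod C e) (Cod C h)" "factor C h e \<cdot> e = h"
    by (auto simp: factor_def)
qed

text \<open>The way in which \<open>factor\<close> is evaluated below: \<open>k\<close> witnesses
  existence and \<open>e\<close> being epi gives uniqueness, so it applies also where
  \<open>e\<close> is a composite known only to be epi.\<close>

lemma factor_eqI:
  assumes "epi C e" "k \<in> Arr C" "Dom C k = Cod C e" "k \<cdot> e = h"
  shows "factor C h e = k"
proof -
  note [simp] = epi_arr[OF assms(1)]
  have [simp]: "Cod C h = Cod C k" using assms by auto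
  show ?thesis unfolding factor_def
  proof (rule the_equality)
    show "k \<in> hom C (Cod C e) (Cod C h) \<and> k \<cdot> e = h" using assms by (auto simp: hom_def)
    fix l assume "l \<in> hom C (Cod C e) (Cod C h) \<and> l \<cdot> e = h"
    then show "l = k" by - (rule epiD[OF assms(1)], use assms in \<open>auto simp: hom_def\<close>)
  qed
qed

text \<open>The factorization of \<open>h\<close> through \<open>e\<close> is \<open>h s\<close>,
  because \<open>h s e = h f t = h g t = h\<close>. In the application \<open>g\<close> comes from a
  left action, and its section \<open>t\<close> inserts the unit of A.\<close>

lemma split_coequalizer:
  assumes "f \<in> hom C P R" "g \<in> hom C P R" "e \<in> hom C R T" "s \<in> hom C T R" "t \<in> hom C R P"
    and "e \<cdot> f = e \<cdot> g" "e \<cdot> s = Ide C T" "g \<cdot> t = Ide C R" "f \<cdot> t = s \<cdot> e"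
  shows "is_coequalizer C f g e"
proof -
  note [simp] = assms(1-5)[unfolded hom_def, simplified]
  have "\<exists>!k. k \<in> hom C (Cod C e) (Cod C h) \<and> k \<cdot> e = h"
    if [simp]: "h \<in> Arr C" "Dom C h = R" and h: "h \<cdot> f = h \<cdot> g" for h
  proof -
    have "(h \<cdot> s) \<cdot> e = (h \<cdot> f) \<cdot> t" by (simp add: assms(9))
    also have "\<dots> = h" by (simp add: h assms(8))
    finally have "(h \<cdot> s) \<cdot> e = h" .
    moreover have "k = h \<cdot> s" if "k \<in> hom C (Cod C e) (Cod C h)" "k \<cdot> e = h" for k
    proof -
      have [simp]: "k \<in> Arr C" "Dom C k = T" using that(1) by (simp_all add: hom_def)
      have "h \<cdot> s = k \<cdot> (e \<cdot> s)" by (simp flip: that(2))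
      then show ?thesis by (simp add: assms(7))
    qed
    moreover have "h \<cdot> s \<in> hom C (Cod C e) (Cod C h)" by (simp add: hom_def)
    ultimately show ?thesis by blast
  qed
  then show ?thesis using assms(6) unfolding is_coequalizer_def parallel_pair_def by simp
qed

lemma coequalizer_iso_comp:
  assumes "is_coequalizer C f g e" "k \<in> hom C (Cod C e) T" "l \<in> hom C T (Cod C e)"
    and kl: "k \<cdot> l = Ide C T" "l \<cdot> k = Ide C (Cod C e)"
  shows "is_coequalizer C f g (k \<cdot> e)"
proof -
  note [simp] = assms(2,3)[unfolded hom_def, simplified]
  have [simp]: "f \<in> Arr C" "g \<in> Arr C" "Dom C g = Dom C f" "Cod C g = Cod C f" "e \<in> Arr C"
    "Dom C e = Cod C f" and eq: "e \<cdot> f = e \<cdot> g"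
    using assms(1) by (auto simp: is_coequalizer_def parallel_pair_def)
  have ep: "epi C (k \<cdot> e)"
    by (rule epi_comp[OF coequalizer_epi[OF assms(1)] split_epi[OF assms(2,3,4)]]) simp
  have "\<exists>!j. j \<in> hom C (Cod C (k \<cdot> e)) (Cod C h) \<and> j \<cdot> (k \<cdot> e) = h"
    if [simp]: "h \<in> Arr C" "Dom C h = Cod C f" and h: "h \<cdot> f = h \<cdot> g" for h
  proof -
    note fa = coequalizer_factor[OF assms(1), of h, simplified, OF h]
    have [simp]: "factor C h e \<in> Arr C" "Dom C (factor C h e) = Cod C e" "Cod C (factor C h e) = Cod C h"
      using fa(1) by (auto simp: hom_def)
    define j where "j = factor C h e \<cdot> l"
    have "j \<cdot> (k \<cdot> e) = factor C h e \<cdot> (l \<cdot> k) \<cdot> e" by (simp add: j_def)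
    also have "\<dots> = h" by (simp only: kl) (simp add: fa)
    finally have j: "j \<cdot> (k \<cdot> e) = h" .
    moreover have "j \<in> hom C (Cod C (k \<cdot> e)) (Cod C h)" by (simp add: j_def hom_def)
    ultimately show ?thesis
      by - (rule ex1I[of _ j], simp, rule epiD[OF ep], simp_all add: hom_def)
  qed
  moreover have "(k \<cdot> e) \<cdot> f = (k \<cdot> e) \<cdot> g" by (simp add: eq)
  ultimately show ?thesis unfolding is_coequalizer_def parallel_pair_def by simp
qed

lemma inverse_arr_eqI:
  assumes "f \<in> hom C X Y" "g \<in> hom C Y X" "g \<cdot> f = Ide C X" "f \<cdot> g = Ide C Y"
  shows "inverse_arr C f = g"
  unfolding inverse_arr_def
proof (rule the_equality)
  note [simp] = assms(1,2)[unfolded hom_def, simplified]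
  show "g \<in> hom C (Cod C f) (Dom C f) \<and> g \<cdot> f = Ide C (Dom C f) \<and> f \<cdot> g = Ide C (Cod C f)"
    using assms by (simp add: hom_def)
  fix h assume h: "h \<in> hom C (Cod C f) (Dom C f) \<and> h \<cdot> f = Ide C (Dom C f) \<and> f \<cdot> h = Ide C (Cod C f)"
  then have [simp]: "h \<in> Arr C" "Dom C h = Y" "Cod C h = X" by (auto simp: hom_def)
  have "h = h \<cdot> (f \<cdot> g)" by (simp add: assms(4))
  also have "\<dots> = (h \<cdot> f) \<cdot> g" by simp
  also have "\<dots> = g" using h by simp
  finally show "h = g" .
qed

lemma coequalizer_eqs:
  assumes "is_coequalizer C f g e"
  shows "f \<in> Arr C" "g \<in> Arr C" "e \<in> Arr C" "Dom C g = Dom C f" "Cod C g = Cod C f"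
    "Dom C e = Cod C f" "e \<cdot> f = e \<cdot> g"
  using assms by (auto simp: is_coequalizer_def parallel_pair_def)

text \<open>The last equation with \<open>e\<close> and \<open>e'\<close> exchanged is the other
  half of invertibility, so two instances of the lemma give an isomorphism.\<close>

lemma coequalizer_unique:
  assumes e: "is_coequalizer C f g e" and e': "is_coequalizer C f g e'"
  shows "factor C e' e \<in> hom C (Cod C e) (Cod C e')" "factor C e' e \<cdot> e = e'"
    and "factor C e e' \<cdot> factor C e' e = Ide C (Cod C e)"
proof -
  note [simp] = coequalizer_eqs(1-6)[OF e] coequalizer_eqs(1-6)[OF e']
  note 1 = coequalizer_factor[OF e, of e', simplified, OF coequalizer_eqs(7)[OF e']]
  note 2 = coequalizer_factor[OF e', of e, simplified, OF coequalizer_eqs(7)[OF e]]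
  show "factor C e' e \<in> hom C (Cod C e) (Cod C e')" "factor C e' e \<cdot> e = e'" by (fact 1)+
  note [simp] = 1(1)[unfolded hom_def, simplified] 2(1)[unfolded hom_def, simplified]
  show "factor C e e' \<cdot> factor C e' e = Ide C (Cod C e)"
    by (rule epiD[OF coequalizer_epi[OF e]]) (simp_all add: 1(2) 2(2))
qed

text \<open>A map of forks with \<open>a\<close> and \<open>b\<close> split epi and \<open>t\<close>
  invertible. Cancelling \<open>a\<close> gives the fork equation, the section of \<open>b\<close>
  gives \<open>e' = t e b'\<close>, and a factorization \<open>l\<close> of \<open>h b\<close>
  through \<open>e\<close> yields the factorization \<open>l t'\<close> of \<open>h\<close> through
  \<open>e'\<close>.\<close>

lemma coequalizer_transport:
  assumes c: "is_coequalizer C f g e"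
    and f': "f' \<in> hom C P R" and g': "g' \<in> hom C P R" and e': "e' \<in> hom C R T"
    and a: "a \<in> hom C (Dom C f) P" and a': "a' \<in> hom C P (Dom C f)" "a \<cdot> a' = Ide C P"
    and b: "b \<in> hom C (Cod C f) R" and b': "b' \<in> hom C R (Cod C f)" "b \<cdot> b' = Ide C R"
    and t: "t \<in> hom C (Cod C e) T" and t': "t' \<in> hom C T (Cod C e)"
      "t' \<cdot> t = Ide C (Cod C e)" "t \<cdot> t' = Ide C T"
    and sq: "f' \<cdot> a = b \<cdot> f" "g' \<cdot> a = b \<cdot> g" "e' \<cdot> b = t \<cdot> e"
  shows "is_coequalizer C f' g' e'"
proof -
  note [simp] = coequalizer_eqs(1-6)[OF c] assms(2-6)[unfolded hom_def, simplified]
    b[unfolded hom_def, simplified] b'(1)[unfolded hom_def, simplified]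
    t[unfolded hom_def, simplified] t'(1)[unfolded hom_def, simplified]
  have epi_a: "epi C a" and epi_b: "epi C b" and epi_t: "epi C t"
    by (rule split_epi[OF a a'] split_epi[OF b b'] split_epi[OF t t'(1,3)])+
  have e'_eq: "e' = t \<cdot> e \<cdot> b'"
  proof -
    have "e' = (e' \<cdot> b) \<cdot> b'" by (simp add: b')
    then show ?thesis unfolding sq by simp
  qed
  have "epi C (e' \<cdot> b)" unfolding sq by (rule epi_comp[OF coequalizer_epi[OF c] epi_t]) simp
  then have epi_e': "epi C e'"
    unfolding epi_def[of C e']
  proof (intro conjI ballI impI, goal_cases)
    case (2 h k)
    then have [simp]: "Dom C h = T" "Dom C k = T" and eq: "h \<cdot> e' = k \<cdot> e'" by auto
    have "h \<cdot> (e' \<cdot> b) = (h \<cdot> e') \<cdot> b" using 2(2) by simp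
    also have "\<dots> = k \<cdot> (e' \<cdot> b)" unfolding eq using 2(3) by simp
    finally show ?case by (rule epiD[OF 2(1)]) (use 2 in simp_all)
  qed simp
  have "e' \<cdot> f' = e' \<cdot> g'"
  proof (rule epiD[OF epi_a])
    have "(e' \<cdot> f') \<cdot> a = (e' \<cdot> b) \<cdot> f" by (simp add: sq(1))
    also have "\<dots> = (e' \<cdot> b) \<cdot> g" unfolding sq by (simp add: coequalizer_eqs(7)[OF c])
    also have "\<dots> = (e' \<cdot> g') \<cdot> a" by (simp add: sq(2))
    finally show "(e' \<cdot> f') \<cdot> a = (e' \<cdot> g') \<cdot> a" .
  qed simp_all
  moreover have "\<exists>!k. k \<in> hom C (Cod C e') (Cod C h) \<and> k \<cdot> e' = h"
    if [simp]: "h \<in> Arr C" "Dom C h = Cod C f'" and h: "h \<cdot> f' = h \<cdot> g'" for h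
  proof -
    have "(h \<cdot> b) \<cdot> f = (h \<cdot> f') \<cdot> a" by (simp add: sq(1))
    also have "\<dots> = (h \<cdot> b) \<cdot> g" unfolding h by (simp add: sq(2))
    finally have "(h \<cdot> b) \<cdot> f = (h \<cdot> b) \<cdot> g" .
    from coequalizer_factor[OF c _ _ this] obtain l
      where l: "l \<in> hom C (Cod C e) (Cod C h)" "l \<cdot> e = h \<cdot> b" by auto
    note [simp] = l(1)[unfolded hom_def, simplified]
    have "(l \<cdot> t') \<cdot> e' = l \<cdot> (t' \<cdot> t) \<cdot> e \<cdot> b'" unfolding e'_eq by simp
    also have "\<dots> = (l \<cdot> e) \<cdot> b'" unfolding t' by simp
    also have "\<dots> = h" unfolding l by (simp add: b')
    finally have "(l \<cdot> t') \<cdot> e' = h" .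
    then show ?thesis
      by - (rule ex1I[of _ "l \<cdot> t'"], simp add: hom_def, rule epiD[OF epi_e'], simp_all add: hom_def)
  qed
  ultimately show ?thesis unfolding is_coequalizer_def parallel_pair_def by simp
qed

end

section \<open>Whiskering, split coequalizers and left coflat objects\<close>

context strict_monoidal_category
begin

lemma tens_Obj [simp]: "\<lbrakk>X \<in> Obj C; Y \<in> Obj C\<rbrakk> \<Longrightarrow> X \<boxtimes> Y \<in> Obj C"
  by (rule tens_obj)

lemma unit_Obj [simp]: "\<one> \<in> Obj C"
  by (rule unit_obj)

lemma obj_strict [simp]:
  "\<lbrakk>X \<in> Obj C; Y \<in> Obj C; Z \<in> Obj C\<rbrakk> \<Longrightarrow> (X \<boxtimes> Y) \<boxtimes> Z = X \<boxtimes> (Y \<boxtimes> Z)"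
  "X \<in> Obj C \<Longrightarrow> \<one> \<boxtimes> X = X" "X \<in> Obj C \<Longrightarrow> X \<boxtimes> \<one> = X"
  by (simp_all add: tens_obj_assoc unit_tens_obj tens_unit_obj)

lemma tens_arr [simp]:
  assumes "f \<in> Arr C" "g \<in> Arr C"
  shows "f \<otimes> g \<in> Arr C" "Dom C (f \<otimes> g) = Dom C f \<boxtimes> Dom C g" "Cod C (f \<otimes> g) = Cod C f \<boxtimes> Cod C g"
  using tens_hom[of f "Dom C f" "Cod C f" g "Dom C g" "Cod C g"] assms by (auto simp: hom_def)

lemma arr_strict [simp]:
  "\<lbrakk>f \<in> Arr C; g \<in> Arr C; h \<in> Arr C\<rbrakk> \<Longrightarrow> (f \<otimes> g) \<otimes> h = f \<otimes> (g \<otimes> h)"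
  "f \<in> Arr C \<Longrightarrow> Ide C \<one> \<otimes> f = f" "f \<in> Arr C \<Longrightarrow> f \<otimes> Ide C \<one> = f"
  "\<lbrakk>X \<in> Obj C; Y \<in> Obj C\<rbrakk> \<Longrightarrow> Ide C X \<otimes> Ide C Y = Ide C (X \<boxtimes> Y)"
  by (simp_all add: tens_arr_assoc unit_tens_arr tens_unit_arr tens_ide)

text \<open>Fixes the normal form of whiskered arrows: adjacent identities to the left of an arrow
  are merged into one. To the right of an arrow \<open>arr_strict\<close> already does this.\<close>

lemma ide_tens_ide_tens [simp]:
  "\<lbrakk>X \<in> Obj C; Y \<in> Obj C; f \<in> Arr C\<rbrakk> \<Longrightarrow> Ide C X \<otimes> (Ide C Y \<otimes> f) = Ide C (X \<boxtimes> Y) \<otimes> f"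
  by (simp flip: arr_strict(1,4))

lemma tens_comp:
  "\<lbrakk>f \<in> Arr C; f' \<in> Arr C; g \<in> Arr C; g' \<in> Arr C; Dom C f' = Cod C f; Dom C g' = Cod C g\<rbrakk> \<Longrightarrow>
     (f' \<otimes> g') \<cdot> (f \<otimes> g) = (f' \<cdot> f) \<otimes> (g' \<cdot> g)"
  using interchange[of f "Dom C f" "Cod C f" f' "Cod C f'" g "Dom C g" "Cod C g" g' "Cod C g'"]
  by (simp add: hom_def)

text \<open>Mostly read from right to left below: an equation between composites, tensored with an
  object, becomes an equation between composites of whiskered arrows.\<close>

lemma whisk_comp:
  "\<lbrakk>f \<in> Arr C; g \<in> Arr C; Dom C g = Cod C f; X \<in> Obj C\<rbrakk> \<Longrightarrow> (X \<triangleleft> g) \<cdot> (X \<triangleleft> f) = X \<triangleleft> (g \<cdot> f)"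
  "\<lbrakk>f \<in> Arr C; g \<in> Arr C; Dom C g = Cod C f; X \<in> Obj C\<rbrakk> \<Longrightarrow> (g \<triangleright> X) \<cdot> (f \<triangleright> X) = (g \<cdot> f) \<triangleright> X"
  by (simp_all add: tens_comp)

text \<open>A split coequalizer is given by equations, which any functor preserves, here tensoring
  with W on the left. A general coequalizer need not be preserved by it.\<close>

lemma whisk_split_coequalizer:
  assumes "f \<in> hom C P R" "g \<in> hom C P R" "e \<in> hom C R T" "s \<in> hom C T R" "t \<in> hom C R P"
    and "e \<cdot> f = e \<cdot> g" "e \<cdot> s = Ide C T" "g \<cdot> t = Ide C R" "f \<cdot> t = s \<cdot> e" and [simp]: "W \<in> Obj C"
  shows "is_coequalizer C (W \<triangleleft> f) (W \<triangleleft> g) (W \<triangleleft> e)"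
proof -
  note [simp] = assms(1-5)[unfolded hom_def, simplified]
  have [simp]: "P \<in> Obj C" "R \<in> Obj C" "T \<in> Obj C"
    using arr_dom_cod[of f] arr_dom_cod[of e] by simp_all
  show ?thesis
    by (rule split_coequalizer[of _ "W \<boxtimes> P" "W \<boxtimes> R" _ _ "W \<boxtimes> T" "W \<triangleleft> s" "W \<triangleleft> t"])
      (simp_all add: hom_def whisk_comp assms)
qed

lemma left_coflatD:
  "\<lbrakk>left_coflat C X; is_coequalizer C f g e\<rbrakk> \<Longrightarrow> is_coequalizer C (f \<triangleright> X) (g \<triangleright> X) (e \<triangleright> X)"
  by (simp add: left_coflat_def)

lemma left_coflat_unit: "left_coflat C \<one>"
  using coequalizer_eqs(1-3) by (auto simp: left_coflat_def)

lemma left_coflat_tens: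
  assumes X: "left_coflat C X" and Y: "left_coflat C Y"
  shows "left_coflat C (X \<boxtimes> Y)"
proof -
  have [simp]: "X \<in> Obj C" "Y \<in> Obj C" using assms by (auto simp: left_coflat_def)
  show ?thesis unfolding left_coflat_def
  proof (intro conjI allI impI)
    fix f g e assume c: "is_coequalizer C f g e"
    note [simp] = coequalizer_eqs(1-3)[OF c]
    show "is_coequalizer C (f \<triangleright> (X \<boxtimes> Y)) (g \<triangleright> (X \<boxtimes> Y)) (e \<triangleright> (X \<boxtimes> Y))"
      using left_coflatD[OF Y left_coflatD[OF X c]] by simp
  qed simp
qed

text \<open>Tensoring with \<open>i\<close> gives an isomorphism from a fork tensored with X to the
  same fork tensored with Y.\<close>

lemma left_coflat_iso:
  assumes X: "left_coflat C X" and i: "i \<in> hom C X Y" and j: "j \<in> hom C Y X"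
    and ij: "j \<cdot> i = Ide C X" "i \<cdot> j = Ide C Y"
  shows "left_coflat C Y"
proof -
  note [simp] = i[unfolded hom_def, simplified] j[unfolded hom_def, simplified]
  have [simp]: "X \<in> Obj C" "Y \<in> Obj C" using arr_dom_cod[of i] by auto
  show ?thesis unfolding left_coflat_def
  proof (intro conjI allI impI)
    fix f g e assume c: "is_coequalizer C f g e"
    note [simp] = coequalizer_eqs(1-6)[OF c]
    show "is_coequalizer C (f \<triangleright> Y) (g \<triangleright> Y) (e \<triangleright> Y)"
      by (rule coequalizer_transport[OF left_coflatD[OF X c],
            of _ "Dom C f \<boxtimes> Y" "Cod C f \<boxtimes> Y" _ _ "Cod C e \<boxtimes> Y" "Dom C f \<triangleleft> i" "Dom C f \<triangleleft> j"
              "Cod C f \<triangleleft> i" "Cod C f \<triangleleft> j" "Cod C e \<triangleleft> i" "Cod C e \<triangleleft> j"])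
        (simp_all add: hom_def tens_comp ij)
  qed simp
qed

end

section \<open>Frobenius coalgebras under strong monoidal embeddings\<close>

text \<open>
  The tensor product of \<open>D\<close> only has to behave well on the class \<open>K\<close>, which must contain the tensor
  products of objects \<open>Fo y\<close>: this avoids showing that the bimodules form a monoidal category.
\<close>

locale monoidal_embedding = M: category M + D: category D
  for M :: "('o, 'a, 'z) mon_cat_scheme" and D :: "('p, 'b, 'y) mon_cat_scheme" +
  fixes S :: "'o set" and K :: "'p set" and Fo :: "'o \<Rightarrow> 'p" and Fa :: "'a \<Rightarrow> 'b"
    and J :: "'o \<Rightarrow> 'o \<Rightarrow> 'b"
  assumes S_obj: "S \<subseteq> Obj M"
    and S_unit [simp]: "\<one>\<^bsub>M\<^esub> \<in> S"
    and S_tens [simp]: "\<lbrakk>y \<in> S; z \<in> S\<rbrakk> \<Longrightarrow> y \<boxtimes>\<^bsub>M\<^esub> z \<in> S"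
    and unit_strict [simp]: "y \<in> S \<Longrightarrow> \<one>\<^bsub>M\<^esub> \<boxtimes>\<^bsub>M\<^esub> y = y" "y \<in> S \<Longrightarrow> y \<boxtimes>\<^bsub>M\<^esub> \<one>\<^bsub>M\<^esub> = y"
    and assoc_strict [simp]: "\<lbrakk>y \<in> S; z \<in> S; w \<in> S\<rbrakk> \<Longrightarrow>
          (y \<boxtimes>\<^bsub>M\<^esub> z) \<boxtimes>\<^bsub>M\<^esub> w = y \<boxtimes>\<^bsub>M\<^esub> (z \<boxtimes>\<^bsub>M\<^esub> w)"
    and constraints_strict [simp]: "\<lbrakk>y \<in> S; z \<in> S; w \<in> S\<rbrakk> \<Longrightarrow>
          Assoc M y z w = Ide M (y \<boxtimes>\<^bsub>M\<^esub> (z \<boxtimes>\<^bsub>M\<^esub> w))"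
      "y \<in> S \<Longrightarrow> LUnit M y = Ide M y" "y \<in> S \<Longrightarrow> RUnit M y = Ide M y"
    and M_tens_hom: "\<lbrakk>f \<in> hom M y y'; g \<in> hom M z z'; y \<in> S; y' \<in> S; z \<in> S; z' \<in> S\<rbrakk> \<Longrightarrow>
          f \<otimes>\<^bsub>M\<^esub> g \<in> hom M (y \<boxtimes>\<^bsub>M\<^esub> z) (y' \<boxtimes>\<^bsub>M\<^esub> z')"
    and K_obj: "K \<subseteq> Obj D"
    and K_tens [simp]: "\<lbrakk>N \<in> K; P \<in> K\<rbrakk> \<Longrightarrow> N \<boxtimes>\<^bsub>D\<^esub> P \<in> K"
    and D_tens_hom: "\<lbrakk>h \<in> hom D N N'; k \<in> hom D P P'; N \<in> K; N' \<in> K; P \<in> K; P' \<in> K\<rbrakk> \<Longrightarrow>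
          h \<otimes>\<^bsub>D\<^esub> k \<in> hom D (N \<boxtimes>\<^bsub>D\<^esub> P) (N' \<boxtimes>\<^bsub>D\<^esub> P')"
    and D_tens_ide: "\<lbrakk>N \<in> K; P \<in> K\<rbrakk> \<Longrightarrow> Ide D N \<otimes>\<^bsub>D\<^esub> Ide D P = Ide D (N \<boxtimes>\<^bsub>D\<^esub> P)"
    and D_interchange: "\<lbrakk>h \<in> hom D N N'; h' \<in> hom D N' N''; k \<in> hom D P P'; k' \<in> hom D P' P'';
          N \<in> K; N' \<in> K; N'' \<in> K; P \<in> K; P' \<in> K; P'' \<in> K\<rbrakk> \<Longrightarrow>
          (h' \<cdot>\<^bsub>D\<^esub> h) \<otimes>\<^bsub>D\<^esub> (k' \<cdot>\<^bsub>D\<^esub> k) = (h' \<otimes>\<^bsub>D\<^esub> k') \<cdot>\<^bsub>D\<^esub> (h \<otimes>\<^bsub>D\<^esub> k)"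
    and F_obj [simp]: "y \<in> S \<Longrightarrow> Fo y \<in> K"
    and F_unit: "Fo \<one>\<^bsub>M\<^esub> = \<one>\<^bsub>D\<^esub>"
    and F_bij: "\<lbrakk>y \<in> S; z \<in> S\<rbrakk> \<Longrightarrow> bij_betw Fa (hom M y z) (hom D (Fo y) (Fo z))"
    and F_ide: "y \<in> S \<Longrightarrow> Fa (Ide M y) = Ide D (Fo y)"
    and F_comp: "\<lbrakk>f \<in> hom M y z; g \<in> hom M z w; y \<in> S; z \<in> S; w \<in> S\<rbrakk> \<Longrightarrow>
          Fa (g \<cdot>\<^bsub>M\<^esub> f) = Fa g \<cdot>\<^bsub>D\<^esub> Fa f"
    and J_hom: "\<lbrakk>y \<in> S; z \<in> S\<rbrakk> \<Longrightarrow> J y z \<in> hom D (Fo (y \<boxtimes>\<^bsub>M\<^esub> z)) (Fo y \<boxtimes>\<^bsub>D\<^esub> Fo z)"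
    and J_iso: "\<lbrakk>y \<in> S; z \<in> S\<rbrakk> \<Longrightarrow> \<exists>k \<in> hom D (Fo y \<boxtimes>\<^bsub>D\<^esub> Fo z) (Fo (y \<boxtimes>\<^bsub>M\<^esub> z)).
          k \<cdot>\<^bsub>D\<^esub> J y z = Ide D (Fo (y \<boxtimes>\<^bsub>M\<^esub> z)) \<and> J y z \<cdot>\<^bsub>D\<^esub> k = Ide D (Fo y \<boxtimes>\<^bsub>D\<^esub> Fo z)"
    and J_natural: "\<lbrakk>f \<in> hom M y y'; g \<in> hom M z z'; y \<in> S; y' \<in> S; z \<in> S; z' \<in> S\<rbrakk> \<Longrightarrow>
          J y' z' \<cdot>\<^bsub>D\<^esub> Fa (f \<otimes>\<^bsub>M\<^esub> g) = (Fa f \<otimes>\<^bsub>D\<^esub> Fa g) \<cdot>\<^bsub>D\<^esub> J y z"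
    and assoc_hom: "\<lbrakk>y \<in> S; z \<in> S; w \<in> S\<rbrakk> \<Longrightarrow> Assoc D (Fo y) (Fo z) (Fo w) \<in>
          hom D ((Fo y \<boxtimes>\<^bsub>D\<^esub> Fo z) \<boxtimes>\<^bsub>D\<^esub> Fo w) (Fo y \<boxtimes>\<^bsub>D\<^esub> (Fo z \<boxtimes>\<^bsub>D\<^esub> Fo w))"
    and J_assoc: "\<lbrakk>y \<in> S; z \<in> S; w \<in> S\<rbrakk> \<Longrightarrow>
          Assoc D (Fo y) (Fo z) (Fo w) \<cdot>\<^bsub>D\<^esub> (J y z \<triangleright>\<^bsub>D\<^esub> Fo w) \<cdot>\<^bsub>D\<^esub> J (y \<boxtimes>\<^bsub>M\<^esub> z) w =
          (Fo y \<triangleleft>\<^bsub>D\<^esub> J z w) \<cdot>\<^bsub>D\<^esub> J y (z \<boxtimes>\<^bsub>M\<^esub> w)"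
    and lunit_hom: "y \<in> S \<Longrightarrow> LUnit D (Fo y) \<in> hom D (\<one>\<^bsub>D\<^esub> \<boxtimes>\<^bsub>D\<^esub> Fo y) (Fo y)"
    and J_lunit: "y \<in> S \<Longrightarrow> LUnit D (Fo y) \<cdot>\<^bsub>D\<^esub> J \<one>\<^bsub>M\<^esub> y = Ide D (Fo y)"
    and runit_hom: "y \<in> S \<Longrightarrow> RUnit D (Fo y) \<in> hom D (Fo y \<boxtimes>\<^bsub>D\<^esub> \<one>\<^bsub>D\<^esub>) (Fo y)"
    and J_runit: "y \<in> S \<Longrightarrow> RUnit D (Fo y) \<cdot>\<^bsub>D\<^esub> J y \<one>\<^bsub>M\<^esub> = Ide D (Fo y)"
begin

lemma unit_K [simp]: "\<one>\<^bsub>D\<^esub> \<in> K"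
  using F_obj[OF S_unit] by (simp add: F_unit)

lemma objs [simp]: "y \<in> S \<Longrightarrow> y \<in> Obj M" "N \<in> K \<Longrightarrow> N \<in> Obj D"
  using S_obj K_obj by auto

lemma Fa_hom: "\<lbrakk>f \<in> hom M y z; y \<in> S; z \<in> S\<rbrakk> \<Longrightarrow> Fa f \<in> hom D (Fo y) (Fo z)"
  using F_bij[of y z] by (auto simp: bij_betw_def)

lemma Fa_eq_iff:
  "\<lbrakk>f \<in> hom M y z; g \<in> hom M y z; y \<in> S; z \<in> S\<rbrakk> \<Longrightarrow> Fa f = Fa g \<longleftrightarrow> f = g"
  using F_bij[of y z] by (auto simp: bij_betw_def inj_on_def)

lemma Fa_surj: "\<lbrakk>h \<in> hom D (Fo y) (Fo z); y \<in> S; z \<in> S\<rbrakk> \<Longrightarrow> \<exists>f \<in> hom M y z. Fa f = h"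
  using F_bij[of y z] bij_betw_imp_surj_on[of Fa "hom M y z" "hom D (Fo y) (Fo z)"] by (metis imageE)

lemma inverse_ide: "X \<in> Obj M \<Longrightarrow> inverse_arr M (Ide M X) = Ide M X"
  by (rule M.inverse_arr_eqI[of _ X X]) (simp_all add: M.ide_hom)

lemma J_epi: "\<lbrakk>y \<in> S; z \<in> S\<rbrakk> \<Longrightarrow> epi D (J y z)"
  using J_iso[of y z] J_hom[of y z] by (auto intro: D.split_epi)

lemma D_whisk_comp:
  assumes "f \<in> hom D N N'" "f' \<in> hom D N' N''" "N \<in> K" "N' \<in> K" "N'' \<in> K" "P \<in> K"
  shows "(f' \<cdot>\<^bsub>D\<^esub> f) \<triangleright>\<^bsub>D\<^esub> P = (f' \<triangleright>\<^bsub>D\<^esub> P) \<cdot>\<^bsub>D\<^esub> (f \<triangleright>\<^bsub>D\<^esub> P)"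
    and "P \<triangleleft>\<^bsub>D\<^esub> (f' \<cdot>\<^bsub>D\<^esub> f) = (P \<triangleleft>\<^bsub>D\<^esub> f') \<cdot>\<^bsub>D\<^esub> (P \<triangleleft>\<^bsub>D\<^esub> f)"
  using D_interchange[OF assms(1,2) D.ide_hom D.ide_hom, of P]
    D_interchange[OF D.ide_hom D.ide_hom assms(1,2), of P] assms by simp_all

text \<open>The inverse of the associator is read off \<open>J_assoc\<close>, all other arrows there being invertible.\<close>

lemma assoc_inverse:
  assumes [simp]: "y \<in> S" "z \<in> S" "w \<in> S"
  defines "a \<equiv> Assoc D (Fo y) (Fo z) (Fo w)"
  shows "inverse_arr D a \<in> hom D (Fo y \<boxtimes>\<^bsub>D\<^esub> (Fo z \<boxtimes>\<^bsub>D\<^esub> Fo w)) ((Fo y \<boxtimes>\<^bsub>D\<^esub> Fo z) \<boxtimes>\<^bsub>D\<^esub> Fo w)"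
    "inverse_arr D a \<cdot>\<^bsub>D\<^esub> a = Ide D ((Fo y \<boxtimes>\<^bsub>D\<^esub> Fo z) \<boxtimes>\<^bsub>D\<^esub> Fo w)"
proof -
  let ?L = "(Fo y \<boxtimes>\<^bsub>D\<^esub> Fo z) \<boxtimes>\<^bsub>D\<^esub> Fo w" and ?R = "Fo y \<boxtimes>\<^bsub>D\<^esub> (Fo z \<boxtimes>\<^bsub>D\<^esub> Fo w)"
  let ?YZW = "y \<boxtimes>\<^bsub>M\<^esub> (z \<boxtimes>\<^bsub>M\<^esub> w)"
  have iso_comp: "\<exists>k \<in> hom D Z X. k \<cdot>\<^bsub>D\<^esub> (g \<cdot>\<^bsub>D\<^esub> f) = Ide D X \<and> (g \<cdot>\<^bsub>D\<^esub> f) \<cdot>\<^bsub>D\<^esub> k = Ide D Z"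
    if f: "f \<in> hom D X Y" and g: "g \<in> hom D Y Z"
      and "\<exists>k \<in> hom D Y X. k \<cdot>\<^bsub>D\<^esub> f = Ide D X \<and> f \<cdot>\<^bsub>D\<^esub> k = Ide D Y"
      and "\<exists>k \<in> hom D Z Y. k \<cdot>\<^bsub>D\<^esub> g = Ide D Y \<and> g \<cdot>\<^bsub>D\<^esub> k = Ide D Z" for f g X Y Z
  proof -
    from that obtain h k where h: "h \<in> hom D Y X" "h \<cdot>\<^bsub>D\<^esub> f = Ide D X" "f \<cdot>\<^bsub>D\<^esub> h = Ide D Y"
      and k: "k \<in> hom D Z Y" "k \<cdot>\<^bsub>D\<^esub> g = Ide D Y" "g \<cdot>\<^bsub>D\<^esub> k = Ide D Z" by blast
    note [simp] = f[unfolded hom_def, simplified] g[unfolded hom_def, simplified]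
      h(1)[unfolded hom_def, simplified] k(1)[unfolded hom_def, simplified]
    have "(h \<cdot>\<^bsub>D\<^esub> k) \<cdot>\<^bsub>D\<^esub> (g \<cdot>\<^bsub>D\<^esub> f) = h \<cdot>\<^bsub>D\<^esub> ((k \<cdot>\<^bsub>D\<^esub> g) \<cdot>\<^bsub>D\<^esub> f)" by simp
    moreover have "(g \<cdot>\<^bsub>D\<^esub> f) \<cdot>\<^bsub>D\<^esub> (h \<cdot>\<^bsub>D\<^esub> k) = g \<cdot>\<^bsub>D\<^esub> ((f \<cdot>\<^bsub>D\<^esub> h) \<cdot>\<^bsub>D\<^esub> k)" by simp
    moreover have "h \<cdot>\<^bsub>D\<^esub> k \<in> hom D Z X" by (simp add: hom_def)
    ultimately show ?thesis using h k by (intro bexI[of _ "h \<cdot>\<^bsub>D\<^esub> k"]) simp_all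
  qed
  obtain k where k: "k \<in> hom D (Fo y \<boxtimes>\<^bsub>D\<^esub> Fo z) (Fo (y \<boxtimes>\<^bsub>M\<^esub> z))"
    "k \<cdot>\<^bsub>D\<^esub> J y z = Ide D (Fo (y \<boxtimes>\<^bsub>M\<^esub> z))" "J y z \<cdot>\<^bsub>D\<^esub> k = Ide D (Fo y \<boxtimes>\<^bsub>D\<^esub> Fo z)"
    using J_iso[of y z] by auto
  obtain l where l: "l \<in> hom D (Fo z \<boxtimes>\<^bsub>D\<^esub> Fo w) (Fo (z \<boxtimes>\<^bsub>M\<^esub> w))"
    "l \<cdot>\<^bsub>D\<^esub> J z w = Ide D (Fo (z \<boxtimes>\<^bsub>M\<^esub> w))" "J z w \<cdot>\<^bsub>D\<^esub> l = Ide D (Fo z \<boxtimes>\<^bsub>D\<^esub> Fo w)"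
    using J_iso[of z w] by auto
  \<comment> \<open>These are the two sides of \<open>J_assoc\<close> without the associator, both
    invertible, and \<open>a\<close> carries \<open>?u\<close> to \<open>?v\<close>. Hence the
    inverse of \<open>a\<close> is \<open>?u\<close> composed with the inverse \<open>v'\<close> of
    \<open>?v\<close>.\<close>
  let ?u = "(J y z \<triangleright>\<^bsub>D\<^esub> Fo w) \<cdot>\<^bsub>D\<^esub> J (y \<boxtimes>\<^bsub>M\<^esub> z) w" and ?v = "(Fo y \<triangleleft>\<^bsub>D\<^esub> J z w) \<cdot>\<^bsub>D\<^esub> J y (z \<boxtimes>\<^bsub>M\<^esub> w)"
  have hJ1: "J y z \<triangleright>\<^bsub>D\<^esub> Fo w \<in> hom D (Fo (y \<boxtimes>\<^bsub>M\<^esub> z) \<boxtimes>\<^bsub>D\<^esub> Fo w) ?L"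
    and hk: "k \<triangleright>\<^bsub>D\<^esub> Fo w \<in> hom D ?L (Fo (y \<boxtimes>\<^bsub>M\<^esub> z) \<boxtimes>\<^bsub>D\<^esub> Fo w)"
    and hJ2: "Fo y \<triangleleft>\<^bsub>D\<^esub> J z w \<in> hom D (Fo y \<boxtimes>\<^bsub>D\<^esub> Fo (z \<boxtimes>\<^bsub>M\<^esub> w)) ?R"
    and hl: "Fo y \<triangleleft>\<^bsub>D\<^esub> l \<in> hom D ?R (Fo y \<boxtimes>\<^bsub>D\<^esub> Fo (z \<boxtimes>\<^bsub>M\<^esub> w))"
    using J_hom k(1) l(1) D.ide_hom by (intro D_tens_hom; simp)+
  have "\<exists>k \<in> hom D ?L (Fo (y \<boxtimes>\<^bsub>M\<^esub> z) \<boxtimes>\<^bsub>D\<^esub> Fo w).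
      k \<cdot>\<^bsub>D\<^esub> (J y z \<triangleright>\<^bsub>D\<^esub> Fo w) = Ide D (Fo (y \<boxtimes>\<^bsub>M\<^esub> z) \<boxtimes>\<^bsub>D\<^esub> Fo w) \<and> (J y z \<triangleright>\<^bsub>D\<^esub> Fo w) \<cdot>\<^bsub>D\<^esub> k = Ide D ?L"
    using D_whisk_comp(1)[OF J_hom k(1), of "Fo w"] D_whisk_comp(1)[OF k(1) J_hom, of "Fo w"] hk
    by (intro bexI[of _ "k \<triangleright>\<^bsub>D\<^esub> Fo w"]) (simp_all add: k D_tens_ide)
  from iso_comp[OF J_hom hJ1 J_iso this] obtain u' where u': "u' \<in> hom D ?L (Fo ?YZW)"
    "u' \<cdot>\<^bsub>D\<^esub> ?u = Ide D (Fo ?YZW)" "?u \<cdot>\<^bsub>D\<^esub> u' = Ide D ?L" by auto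
  have "\<exists>k \<in> hom D ?R (Fo y \<boxtimes>\<^bsub>D\<^esub> Fo (z \<boxtimes>\<^bsub>M\<^esub> w)).
      k \<cdot>\<^bsub>D\<^esub> (Fo y \<triangleleft>\<^bsub>D\<^esub> J z w) = Ide D (Fo y \<boxtimes>\<^bsub>D\<^esub> Fo (z \<boxtimes>\<^bsub>M\<^esub> w)) \<and> (Fo y \<triangleleft>\<^bsub>D\<^esub> J z w) \<cdot>\<^bsub>D\<^esub> k = Ide D ?R"
    using D_whisk_comp(2)[OF J_hom l(1), of "Fo y"] D_whisk_comp(2)[OF l(1) J_hom, of "Fo y"] hl
    by (intro bexI[of _ "Fo y \<triangleleft>\<^bsub>D\<^esub> l"]) (simp_all add: l D_tens_ide)
  from iso_comp[OF J_hom hJ2 J_iso this] obtain v' where v': "v' \<in> hom D ?R (Fo ?YZW)"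
    "v' \<cdot>\<^bsub>D\<^esub> ?v = Ide D (Fo ?YZW)" "?v \<cdot>\<^bsub>D\<^esub> v' = Ide D ?R" by auto
  have u: "?u \<in> hom D (Fo ?YZW) ?L"
    using D.comp_hom[OF J_hom hJ1] by simp
  have v: "?v \<in> hom D (Fo ?YZW) ?R"
    using D.comp_hom[OF J_hom hJ2] by simp
  have a: "a \<in> hom D ?L ?R" by (simp add: a_def assoc_hom)
  have auv: "a \<cdot>\<^bsub>D\<^esub> ?u = ?v" by (simp add: a_def J_assoc)
  have "a \<cdot>\<^bsub>D\<^esub> (?u \<cdot>\<^bsub>D\<^esub> v') = Ide D ?R"
    using D.comp_assoc[OF v'(1) u a] by (simp only: auv v')
  moreover have "(?u \<cdot>\<^bsub>D\<^esub> v') \<cdot>\<^bsub>D\<^esub> a = Ide D ?L"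
  proof -
    have "a = ?v \<cdot>\<^bsub>D\<^esub> u'" using D.comp_assoc[OF u'(1) u a] a by (simp only: auv u' D.comp_ide_right)
    then have "(?u \<cdot>\<^bsub>D\<^esub> v') \<cdot>\<^bsub>D\<^esub> a = ?u \<cdot>\<^bsub>D\<^esub> (v' \<cdot>\<^bsub>D\<^esub> (?v \<cdot>\<^bsub>D\<^esub> u'))"
      using D.comp_assoc[OF a v'(1) u] by simp
    also have "v' \<cdot>\<^bsub>D\<^esub> (?v \<cdot>\<^bsub>D\<^esub> u') = u'"
      using D.comp_assoc[OF u'(1) v v'(1)] u'(1) by (simp only: v' D.comp_ide_left)
    finally show ?thesis by (simp only: u')
  qed
  moreover have "?u \<cdot>\<^bsub>D\<^esub> v' \<in> hom D ?R ?L" by (rule D.comp_hom[OF v'(1) u])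
  ultimately show "inverse_arr D a \<in> hom D ?R ?L" "inverse_arr D a \<cdot>\<^bsub>D\<^esub> a = Ide D ?L"
    using D.inverse_arr_eqI[OF a, of "?u \<cdot>\<^bsub>D\<^esub> v'"] by simp_all
qed

text \<open>\<open>J_lunit\<close> and \<open>J_runit\<close> exhibit the unitors only as left
  inverses of \<open>J\<close>. Since \<open>J\<close> is invertible by \<open>J_iso\<close>, a
  one-sided inverse is the inverse.\<close>

lemma unit_inverse:
  assumes [simp]: "y \<in> S"
  shows "inverse_arr D (LUnit D (Fo y)) = J \<one>\<^bsub>M\<^esub> y" "inverse_arr D (RUnit D (Fo y)) = J y \<one>\<^bsub>M\<^esub>"
proof -
  have *: "f \<cdot>\<^bsub>D\<^esub> r = Ide D Y" if f: "f \<in> hom D X Y" and r: "r \<in> hom D Y X"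
    and rf: "r \<cdot>\<^bsub>D\<^esub> f = Ide D X" and iso: "\<exists>k \<in> hom D Y X. k \<cdot>\<^bsub>D\<^esub> f = Ide D X \<and> f \<cdot>\<^bsub>D\<^esub> k = Ide D Y" for f r X Y
  proof -
    obtain k where k: "k \<in> hom D Y X" "f \<cdot>\<^bsub>D\<^esub> k = Ide D Y" using iso by blast
    have "r = k" using D.comp_assoc[OF k(1) f r] r k(1)
      by (simp only: rf k(2) D.comp_ide_left D.comp_ide_right)
    then show ?thesis using k by simp
  qed
  show "inverse_arr D (LUnit D (Fo y)) = J \<one>\<^bsub>M\<^esub> y"
    using *[OF J_hom _ _ J_iso, of "\<one>\<^bsub>M\<^esub>" y "LUnit D (Fo y)"] lunit_hom[of y] J_hom[of "\<one>\<^bsub>M\<^esub>" y] J_lunit[of y]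
    by (intro D.inverse_arr_eqI[OF lunit_hom]) (simp_all add: F_unit)
  show "inverse_arr D (RUnit D (Fo y)) = J y \<one>\<^bsub>M\<^esub>"
    using *[OF J_hom _ _ J_iso, of y "\<one>\<^bsub>M\<^esub>" "RUnit D (Fo y)"] runit_hom[of y] J_hom[of y "\<one>\<^bsub>M\<^esub>"] J_runit[of y]
    by (intro D.inverse_arr_eqI[OF runit_hom]) (simp_all add: F_unit)
qed

section \<open>The image of a coalgebra and its Frobenius structures\<close>

definition F_comult :: "'o \<Rightarrow> 'a \<Rightarrow> 'b" where
  "F_comult x \<delta> = J x x \<cdot>\<^bsub>D\<^esub> Fa \<delta>"

lemma F_tens:
  assumes "f \<in> hom M y y'" "g \<in> hom M z z'" and [simp]: "y \<in> S" "y' \<in> S" "z \<in> S" "z' \<in> S"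
  shows "Fa f \<otimes>\<^bsub>D\<^esub> Fa g \<in> hom D (Fo y \<boxtimes>\<^bsub>D\<^esub> Fo z) (Fo y' \<boxtimes>\<^bsub>D\<^esub> Fo z')"
  using assms by (intro D_tens_hom Fa_hom) simp_all

context
  fixes x \<delta> \<epsilon>
  assumes x [simp]: "x \<in> S"
    and \<delta>: "\<delta> \<in> hom M x (x \<boxtimes>\<^bsub>M\<^esub> x)" and \<epsilon>: "\<epsilon> \<in> hom M x \<one>\<^bsub>M\<^esub>"
begin

abbreviation (input) "E \<equiv> Fo x"
abbreviation (input) "xx \<equiv> x \<boxtimes>\<^bsub>M\<^esub> x"
abbreviation (input) "EE \<equiv> E \<boxtimes>\<^bsub>D\<^esub> E"
abbreviation (input) "a \<equiv> Assoc D E E E"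

lemma D_homs:
  "Fa \<delta> \<in> hom D E (Fo xx)" "Fa \<epsilon> \<in> hom D E \<one>\<^bsub>D\<^esub>" "J x x \<in> hom D (Fo xx) EE"
  "J xx x \<in> hom D (Fo (x \<boxtimes>\<^bsub>M\<^esub> xx)) (Fo xx \<boxtimes>\<^bsub>D\<^esub> E)"
  "J x xx \<in> hom D (Fo (x \<boxtimes>\<^bsub>M\<^esub> xx)) (E \<boxtimes>\<^bsub>D\<^esub> Fo xx)"
  "J x x \<triangleright>\<^bsub>D\<^esub> E \<in> hom D (Fo xx \<boxtimes>\<^bsub>D\<^esub> E) (EE \<boxtimes>\<^bsub>D\<^esub> E)"
  "E \<triangleleft>\<^bsub>D\<^esub> J x x \<in> hom D (E \<boxtimes>\<^bsub>D\<^esub> Fo xx) (E \<boxtimes>\<^bsub>D\<^esub> EE)"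
  "Fa \<delta> \<triangleright>\<^bsub>D\<^esub> E \<in> hom D EE (Fo xx \<boxtimes>\<^bsub>D\<^esub> E)"
  "E \<triangleleft>\<^bsub>D\<^esub> Fa \<delta> \<in> hom D EE (E \<boxtimes>\<^bsub>D\<^esub> Fo xx)"
  "Fa (\<delta> \<triangleright>\<^bsub>M\<^esub> x) \<in> hom D (Fo xx) (Fo (x \<boxtimes>\<^bsub>M\<^esub> xx))"
  "Fa (x \<triangleleft>\<^bsub>M\<^esub> \<delta>) \<in> hom D (Fo xx) (Fo (x \<boxtimes>\<^bsub>M\<^esub> xx))"
  "a \<in> hom D (EE \<boxtimes>\<^bsub>D\<^esub> E) (E \<boxtimes>\<^bsub>D\<^esub> EE)"
  using Fa_hom[OF \<delta>] Fa_hom[OF \<epsilon>] J_hom[of x x] J_hom[of xx x] J_hom[of x xx]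
    D_tens_hom[OF J_hom[of x x] D.ide_hom, of E] D_tens_hom[OF D.ide_hom J_hom[of x x], of E]
    F_tens[OF \<delta> M.ide_hom[of x]] F_tens[OF M.ide_hom[of x] \<delta>]
    Fa_hom[OF M_tens_hom[OF \<delta> M.ide_hom[of x]]] Fa_hom[OF M_tens_hom[OF M.ide_hom[of x] \<delta>]]
    assoc_hom[of x x x]
  by (simp_all add: F_unit F_ide)

lemma M_homs:
  "\<delta> \<triangleright>\<^bsub>M\<^esub> x \<in> hom M xx (x \<boxtimes>\<^bsub>M\<^esub> xx)" "x \<triangleleft>\<^bsub>M\<^esub> \<delta> \<in> hom M xx (x \<boxtimes>\<^bsub>M\<^esub> xx)"
  "\<epsilon> \<triangleright>\<^bsub>M\<^esub> x \<in> hom M xx x" "x \<triangleleft>\<^bsub>M\<^esub> \<epsilon> \<in> hom M xx x"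
  using M_tens_hom[OF \<delta> M.ide_hom[of x]] M_tens_hom[OF M.ide_hom[of x] \<delta>]
    M_tens_hom[OF \<epsilon> M.ide_hom[of x]] M_tens_hom[OF M.ide_hom[of x] \<epsilon>] by simp_all

lemma comult_whisk:
  shows "F_comult x \<delta> \<triangleright>\<^bsub>D\<^esub> E \<in> hom D EE (EE \<boxtimes>\<^bsub>D\<^esub> E)"
    and "E \<triangleleft>\<^bsub>D\<^esub> F_comult x \<delta> \<in> hom D EE (E \<boxtimes>\<^bsub>D\<^esub> EE)"
    and "a \<cdot>\<^bsub>D\<^esub> (F_comult x \<delta> \<triangleright>\<^bsub>D\<^esub> E) \<cdot>\<^bsub>D\<^esub> J x x =
      (E \<triangleleft>\<^bsub>D\<^esub> J x x) \<cdot>\<^bsub>D\<^esub> J x xx \<cdot>\<^bsub>D\<^esub> Fa (\<delta> \<triangleright>\<^bsub>M\<^esub> x)"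
    and "(E \<triangleleft>\<^bsub>D\<^esub> F_comult x \<delta>) \<cdot>\<^bsub>D\<^esub> J x x = (E \<triangleleft>\<^bsub>D\<^esub> J x x) \<cdot>\<^bsub>D\<^esub> J x xx \<cdot>\<^bsub>D\<^esub> Fa (x \<triangleleft>\<^bsub>M\<^esub> \<delta>)"
proof -
  note [simp] = D_homs[unfolded hom_def, simplified]
  have 1: "F_comult x \<delta> \<triangleright>\<^bsub>D\<^esub> E = (J x x \<triangleright>\<^bsub>D\<^esub> E) \<cdot>\<^bsub>D\<^esub> (Fa \<delta> \<triangleright>\<^bsub>D\<^esub> E)"
    and 2: "E \<triangleleft>\<^bsub>D\<^esub> F_comult x \<delta> = (E \<triangleleft>\<^bsub>D\<^esub> J x x) \<cdot>\<^bsub>D\<^esub> (E \<triangleleft>\<^bsub>D\<^esub> Fa \<delta>)"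
    unfolding F_comult_def by (intro D_whisk_comp[OF D_homs(1,3)]; simp)+
  show "F_comult x \<delta> \<triangleright>\<^bsub>D\<^esub> E \<in> hom D EE (EE \<boxtimes>\<^bsub>D\<^esub> E)"
    "E \<triangleleft>\<^bsub>D\<^esub> F_comult x \<delta> \<in> hom D EE (E \<boxtimes>\<^bsub>D\<^esub> EE)"
    unfolding 1 2 by (simp_all add: hom_def)
  have n: "(Fa \<delta> \<triangleright>\<^bsub>D\<^esub> E) \<cdot>\<^bsub>D\<^esub> J x x = J xx x \<cdot>\<^bsub>D\<^esub> Fa (\<delta> \<triangleright>\<^bsub>M\<^esub> x)"
    "(E \<triangleleft>\<^bsub>D\<^esub> Fa \<delta>) \<cdot>\<^bsub>D\<^esub> J x x = J x xx \<cdot>\<^bsub>D\<^esub> Fa (x \<triangleleft>\<^bsub>M\<^esub> \<delta>)"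
    using J_natural[OF \<delta> M.ide_hom[of x]] J_natural[OF M.ide_hom[of x] \<delta>] by (simp_all add: F_ide)
  have "a \<cdot>\<^bsub>D\<^esub> (F_comult x \<delta> \<triangleright>\<^bsub>D\<^esub> E) \<cdot>\<^bsub>D\<^esub> J x x =
      (a \<cdot>\<^bsub>D\<^esub> (J x x \<triangleright>\<^bsub>D\<^esub> E) \<cdot>\<^bsub>D\<^esub> J xx x) \<cdot>\<^bsub>D\<^esub> Fa (\<delta> \<triangleright>\<^bsub>M\<^esub> x)"
    unfolding 1 by (simp add: n)
  then show "a \<cdot>\<^bsub>D\<^esub> (F_comult x \<delta> \<triangleright>\<^bsub>D\<^esub> E) \<cdot>\<^bsub>D\<^esub> J x x =
      (E \<triangleleft>\<^bsub>D\<^esub> J x x) \<cdot>\<^bsub>D\<^esub> J x xx \<cdot>\<^bsub>D\<^esub> Fa (\<delta> \<triangleright>\<^bsub>M\<^esub> x)"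
    by (simp add: J_assoc[OF x x x])
  show "(E \<triangleleft>\<^bsub>D\<^esub> F_comult x \<delta>) \<cdot>\<^bsub>D\<^esub> J x x = (E \<triangleleft>\<^bsub>D\<^esub> J x x) \<cdot>\<^bsub>D\<^esub> J x xx \<cdot>\<^bsub>D\<^esub> Fa (x \<triangleleft>\<^bsub>M\<^esub> \<delta>)"
    unfolding 2 by (simp add: n)
qed

text \<open>Naturality of \<open>J\<close> at \<open>B\<close> and an identity, followed by the unit
  laws. The source \<open>y\<close> is arbitrary because the lemma serves for the counit, with
  \<open>y = x\<close>, and for the Frobenius form, with \<open>y = xx\<close>.\<close>

lemma unit_whisk:
  assumes "B \<in> hom M y \<one>\<^bsub>M\<^esub>" and [simp]: "y \<in> S"
  shows "LUnit D E \<cdot>\<^bsub>D\<^esub> (Fa B \<triangleright>\<^bsub>D\<^esub> E) \<cdot>\<^bsub>D\<^esub> J y x = Fa (B \<triangleright>\<^bsub>M\<^esub> x)"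
    and "RUnit D E \<cdot>\<^bsub>D\<^esub> (E \<triangleleft>\<^bsub>D\<^esub> Fa B) \<cdot>\<^bsub>D\<^esub> J x y = Fa (x \<triangleleft>\<^bsub>M\<^esub> B)"
proof -
  note h = J_hom[of "\<one>\<^bsub>M\<^esub>" x] J_hom[of x "\<one>\<^bsub>M\<^esub>"] lunit_hom[of x] runit_hom[of x]
    Fa_hom[OF M_tens_hom[OF assms(1) M.ide_hom[of x]]] Fa_hom[OF M_tens_hom[OF M.ide_hom[of x] assms(1)]]
  note [simp] = h[unfolded hom_def, simplified, unfolded F_unit]
  have n: "(Fa B \<triangleright>\<^bsub>D\<^esub> E) \<cdot>\<^bsub>D\<^esub> J y x = J \<one>\<^bsub>M\<^esub> x \<cdot>\<^bsub>D\<^esub> Fa (B \<triangleright>\<^bsub>M\<^esub> x)"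
    "(E \<triangleleft>\<^bsub>D\<^esub> Fa B) \<cdot>\<^bsub>D\<^esub> J x y = J x \<one>\<^bsub>M\<^esub> \<cdot>\<^bsub>D\<^esub> Fa (x \<triangleleft>\<^bsub>M\<^esub> B)"
    using J_natural[OF assms(1) M.ide_hom[of x]] J_natural[OF M.ide_hom[of x] assms(1)]
    by (simp_all add: F_ide)
  have "LUnit D E \<cdot>\<^bsub>D\<^esub> (Fa B \<triangleright>\<^bsub>D\<^esub> E) \<cdot>\<^bsub>D\<^esub> J y x = (LUnit D E \<cdot>\<^bsub>D\<^esub> J \<one>\<^bsub>M\<^esub> x) \<cdot>\<^bsub>D\<^esub> Fa (B \<triangleright>\<^bsub>M\<^esub> x)"
    unfolding n by simp
  then show "LUnit D E \<cdot>\<^bsub>D\<^esub> (Fa B \<triangleright>\<^bsub>D\<^esub> E) \<cdot>\<^bsub>D\<^esub> J y x = Fa (B \<triangleright>\<^bsub>M\<^esub> x)"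
    by (simp add: J_lunit)
  have "RUnit D E \<cdot>\<^bsub>D\<^esub> (E \<triangleleft>\<^bsub>D\<^esub> Fa B) \<cdot>\<^bsub>D\<^esub> J x y = (RUnit D E \<cdot>\<^bsub>D\<^esub> J x \<one>\<^bsub>M\<^esub>) \<cdot>\<^bsub>D\<^esub> Fa (x \<triangleleft>\<^bsub>M\<^esub> B)"
    unfolding n by simp
  then show "RUnit D E \<cdot>\<^bsub>D\<^esub> (E \<triangleleft>\<^bsub>D\<^esub> Fa B) \<cdot>\<^bsub>D\<^esub> J x y = Fa (x \<triangleleft>\<^bsub>M\<^esub> B)"
    by (simp add: J_runit)
qed

text \<open>Supplies the coalgebra part of \<open>frobenius_coalgebra\<close> on the side of
  \<open>D\<close>. With \<open>F_comult\<close> written as \<open>J x x\<close> after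
  \<open>Fa \<delta>\<close>, each axiom turns into the image under \<open>Fa\<close> of the strict
  one.\<close>

lemma F_coalgebra:
  assumes "coalgebra M x \<delta> \<epsilon>"
  shows "coalgebra D E (F_comult x \<delta>) (Fa \<epsilon>)"
proof -
  note [simp] = D_homs[unfolded hom_def, simplified] \<delta>[unfolded hom_def, simplified]
    \<epsilon>[unfolded hom_def, simplified] M_homs[unfolded hom_def, simplified] F_comult_def
    comult_whisk(1,2)[unfolded hom_def F_comult_def, simplified]
  have c: "(\<delta> \<triangleright>\<^bsub>M\<^esub> x) \<cdot>\<^bsub>M\<^esub> \<delta> = (x \<triangleleft>\<^bsub>M\<^esub> \<delta>) \<cdot>\<^bsub>M\<^esub> \<delta>"
    "(\<epsilon> \<triangleright>\<^bsub>M\<^esub> x) \<cdot>\<^bsub>M\<^esub> \<delta> = Ide M x" "(x \<triangleleft>\<^bsub>M\<^esub> \<epsilon>) \<cdot>\<^bsub>M\<^esub> \<delta> = Ide M x"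
    using assms unfolding coalgebra_def by simp_all
  have "a \<cdot>\<^bsub>D\<^esub> (F_comult x \<delta> \<triangleright>\<^bsub>D\<^esub> E) \<cdot>\<^bsub>D\<^esub> F_comult x \<delta> =
      (a \<cdot>\<^bsub>D\<^esub> (F_comult x \<delta> \<triangleright>\<^bsub>D\<^esub> E) \<cdot>\<^bsub>D\<^esub> J x x) \<cdot>\<^bsub>D\<^esub> Fa \<delta>"
    by simp
  also have "\<dots> = (E \<triangleleft>\<^bsub>D\<^esub> J x x) \<cdot>\<^bsub>D\<^esub> J x xx \<cdot>\<^bsub>D\<^esub> Fa ((\<delta> \<triangleright>\<^bsub>M\<^esub> x) \<cdot>\<^bsub>M\<^esub> \<delta>)"
    unfolding comult_whisk(3) F_comp[OF \<delta> M_homs(1), simplified] by simp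
  also have "\<dots> = ((E \<triangleleft>\<^bsub>D\<^esub> F_comult x \<delta>) \<cdot>\<^bsub>D\<^esub> J x x) \<cdot>\<^bsub>D\<^esub> Fa \<delta>"
    unfolding comult_whisk(4) c F_comp[OF \<delta> M_homs(2), simplified] by simp
  also have "\<dots> = (E \<triangleleft>\<^bsub>D\<^esub> F_comult x \<delta>) \<cdot>\<^bsub>D\<^esub> F_comult x \<delta>" by simp
  finally have coassoc: "a \<cdot>\<^bsub>D\<^esub> (F_comult x \<delta> \<triangleright>\<^bsub>D\<^esub> E) \<cdot>\<^bsub>D\<^esub> F_comult x \<delta> =
      (E \<triangleleft>\<^bsub>D\<^esub> F_comult x \<delta>) \<cdot>\<^bsub>D\<^esub> F_comult x \<delta>" .
  note h = lunit_hom[of x] runit_hom[of x] F_tens[OF \<epsilon> M.ide_hom[of x]] F_tens[OF M.ide_hom[of x] \<epsilon>]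
  note [simp] = h[unfolded hom_def, simplified, unfolded F_unit F_ide[OF x], simplified]
  have "LUnit D E \<cdot>\<^bsub>D\<^esub> (Fa \<epsilon> \<triangleright>\<^bsub>D\<^esub> E) \<cdot>\<^bsub>D\<^esub> F_comult x \<delta> =
      (LUnit D E \<cdot>\<^bsub>D\<^esub> (Fa \<epsilon> \<triangleright>\<^bsub>D\<^esub> E) \<cdot>\<^bsub>D\<^esub> J x x) \<cdot>\<^bsub>D\<^esub> Fa \<delta>" by simp
  also have "\<dots> = Ide D E"
    unfolding unit_whisk[OF \<epsilon> x] F_comp[OF \<delta> M_homs(3), simplified, symmetric] c by (simp add: F_ide)
  finally have lu: "LUnit D E \<cdot>\<^bsub>D\<^esub> (Fa \<epsilon> \<triangleright>\<^bsub>D\<^esub> E) \<cdot>\<^bsub>D\<^esub> F_comult x \<delta> = Ide D E" .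
  have "RUnit D E \<cdot>\<^bsub>D\<^esub> (E \<triangleleft>\<^bsub>D\<^esub> Fa \<epsilon>) \<cdot>\<^bsub>D\<^esub> F_comult x \<delta> =
      (RUnit D E \<cdot>\<^bsub>D\<^esub> (E \<triangleleft>\<^bsub>D\<^esub> Fa \<epsilon>) \<cdot>\<^bsub>D\<^esub> J x x) \<cdot>\<^bsub>D\<^esub> Fa \<delta>" by simp
  also have "\<dots> = Ide D E"
    unfolding unit_whisk[OF \<epsilon> x] F_comp[OF \<delta> M_homs(4), simplified, symmetric] c by (simp add: F_ide)
  finally have "RUnit D E \<cdot>\<^bsub>D\<^esub> (E \<triangleleft>\<^bsub>D\<^esub> Fa \<epsilon>) \<cdot>\<^bsub>D\<^esub> F_comult x \<delta> = Ide D E" .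
  then show ?thesis using coassoc lu unfolding coalgebra_def by (simp add: hom_def)
qed

text \<open>The equation \<open>BJ\<close> is what makes \<open>B\<close> and \<open>B'\<close>
  correspond. In the first condition both sides are precomposed with the epi \<open>J x x\<close>;
  in the other two the inverse unitors already are comparison arrows. All sides then become images
  under \<open>Fa\<close> of the strict sides, and \<open>Fa\<close> is injective on
  hom-sets.\<close>

lemma frobenius_pair_iff:
  assumes t: "t \<in> hom M \<one>\<^bsub>M\<^esub> x" and B: "B \<in> hom M xx \<one>\<^bsub>M\<^esub>" and B': "B' \<in> hom D EE \<one>\<^bsub>D\<^esub>"
    and BJ: "B' \<cdot>\<^bsub>D\<^esub> J x x = Fa B"
  shows "(RUnit M x \<cdot>\<^bsub>M\<^esub> (x \<triangleleft>\<^bsub>M\<^esub> B) \<cdot>\<^bsub>M\<^esub> Assoc M x x x \<cdot>\<^bsub>M\<^esub> (\<delta> \<triangleright>\<^bsub>M\<^esub> x) =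
        LUnit M x \<cdot>\<^bsub>M\<^esub> (B \<triangleright>\<^bsub>M\<^esub> x) \<cdot>\<^bsub>M\<^esub> inverse_arr M (Assoc M x x x) \<cdot>\<^bsub>M\<^esub> (x \<triangleleft>\<^bsub>M\<^esub> \<delta>)) \<longleftrightarrow>
      (RUnit D E \<cdot>\<^bsub>D\<^esub> (E \<triangleleft>\<^bsub>D\<^esub> B') \<cdot>\<^bsub>D\<^esub> a \<cdot>\<^bsub>D\<^esub> (F_comult x \<delta> \<triangleright>\<^bsub>D\<^esub> E) =
        LUnit D E \<cdot>\<^bsub>D\<^esub> (B' \<triangleright>\<^bsub>D\<^esub> E) \<cdot>\<^bsub>D\<^esub> inverse_arr D a \<cdot>\<^bsub>D\<^esub> (E \<triangleleft>\<^bsub>D\<^esub> F_comult x \<delta>))"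
    and "B \<cdot>\<^bsub>M\<^esub> (t \<triangleright>\<^bsub>M\<^esub> x) \<cdot>\<^bsub>M\<^esub> inverse_arr M (LUnit M x) = \<epsilon> \<longleftrightarrow>
      B' \<cdot>\<^bsub>D\<^esub> (Fa t \<triangleright>\<^bsub>D\<^esub> E) \<cdot>\<^bsub>D\<^esub> inverse_arr D (LUnit D E) = Fa \<epsilon>"
    and "B \<cdot>\<^bsub>M\<^esub> (x \<triangleleft>\<^bsub>M\<^esub> t) \<cdot>\<^bsub>M\<^esub> inverse_arr M (RUnit M x) = \<epsilon> \<longleftrightarrow>
      B' \<cdot>\<^bsub>D\<^esub> (E \<triangleleft>\<^bsub>D\<^esub> Fa t) \<cdot>\<^bsub>D\<^esub> inverse_arr D (RUnit D E) = Fa \<epsilon>"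
proof -
  note hM = M_tens_hom[OF B M.ide_hom[of x], simplified] M_tens_hom[OF M.ide_hom[of x] B, simplified]
    M_tens_hom[OF t M.ide_hom[of x], simplified] M_tens_hom[OF M.ide_hom[of x] t, simplified]
  note [simp] = D_homs[unfolded hom_def, simplified] \<delta>[unfolded hom_def, simplified]
    \<epsilon>[unfolded hom_def, simplified] M_homs[unfolded hom_def, simplified]
    t[unfolded hom_def, simplified] B[unfolded hom_def, simplified] B'[unfolded hom_def, simplified]
    comult_whisk(1,2)[unfolded hom_def, simplified] hM[unfolded hom_def, simplified]
  note hD = lunit_hom[of x] runit_hom[of x] F_tens[OF t M.ide_hom[of x]] F_tens[OF M.ide_hom[of x] t]
    J_hom[of "\<one>\<^bsub>M\<^esub>" x] J_hom[of x "\<one>\<^bsub>M\<^esub>"] Fa_hom[OF hM(1)] Fa_hom[OF hM(2)] Fa_hom[OF hM(3)]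
    Fa_hom[OF hM(4)] F_tens[OF B M.ide_hom[of x]] F_tens[OF M.ide_hom[of x] B]
  note [simp] = hD[unfolded hom_def, simplified, unfolded F_unit F_ide[OF x], simplified]
  note hB' = D_tens_hom[OF B' D.ide_hom[of E]] D_tens_hom[OF D.ide_hom[of E] B']
    assoc_inverse(1)[of x x x]
  note [simp] = hB'[unfolded hom_def, simplified]
  have wB: "(B' \<triangleright>\<^bsub>D\<^esub> E) \<cdot>\<^bsub>D\<^esub> (J x x \<triangleright>\<^bsub>D\<^esub> E) = Fa B \<triangleright>\<^bsub>D\<^esub> E" "(E \<triangleleft>\<^bsub>D\<^esub> B') \<cdot>\<^bsub>D\<^esub> (E \<triangleleft>\<^bsub>D\<^esub> J x x) = E \<triangleleft>\<^bsub>D\<^esub> Fa B"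
    using D_whisk_comp[OF D_homs(3) B', of E] by (simp_all add: BJ)
  let ?l = "RUnit D E \<cdot>\<^bsub>D\<^esub> (E \<triangleleft>\<^bsub>D\<^esub> B') \<cdot>\<^bsub>D\<^esub> a \<cdot>\<^bsub>D\<^esub> (F_comult x \<delta> \<triangleright>\<^bsub>D\<^esub> E)"
    and ?r = "LUnit D E \<cdot>\<^bsub>D\<^esub> (B' \<triangleright>\<^bsub>D\<^esub> E) \<cdot>\<^bsub>D\<^esub> inverse_arr D a \<cdot>\<^bsub>D\<^esub> (E \<triangleleft>\<^bsub>D\<^esub> F_comult x \<delta>)"
  have "?l \<cdot>\<^bsub>D\<^esub> J x x = RUnit D E \<cdot>\<^bsub>D\<^esub> ((E \<triangleleft>\<^bsub>D\<^esub> B') \<cdot>\<^bsub>D\<^esub> (E \<triangleleft>\<^bsub>D\<^esub> J x x)) \<cdot>\<^bsub>D\<^esub> J x xx \<cdot>\<^bsub>D\<^esub> Fa (\<delta> \<triangleright>\<^bsub>M\<^esub> x)"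
    by (simp add: comult_whisk(3))
  also have "\<dots> = (RUnit D E \<cdot>\<^bsub>D\<^esub> (E \<triangleleft>\<^bsub>D\<^esub> Fa B) \<cdot>\<^bsub>D\<^esub> J x xx) \<cdot>\<^bsub>D\<^esub> Fa (\<delta> \<triangleright>\<^bsub>M\<^esub> x)" unfolding wB by simp
  also have "\<dots> = Fa ((x \<triangleleft>\<^bsub>M\<^esub> B) \<cdot>\<^bsub>M\<^esub> (\<delta> \<triangleright>\<^bsub>M\<^esub> x))"
    by (simp add: unit_whisk[OF B] F_comp[OF M_homs(1) hM(2)])
  finally have l: "?l \<cdot>\<^bsub>D\<^esub> J x x = Fa ((x \<triangleleft>\<^bsub>M\<^esub> B) \<cdot>\<^bsub>M\<^esub> (\<delta> \<triangleright>\<^bsub>M\<^esub> x))" .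
  \<comment> \<open>\<open>J_assoc\<close> with the associator moved to the other side, as the
    right-hand side of the Frobenius equation contains its inverse.\<close>
  have aJ: "inverse_arr D a \<cdot>\<^bsub>D\<^esub> (E \<triangleleft>\<^bsub>D\<^esub> J x x) \<cdot>\<^bsub>D\<^esub> J x xx = (J x x \<triangleright>\<^bsub>D\<^esub> E) \<cdot>\<^bsub>D\<^esub> J xx x"
  proof -
    have "inverse_arr D a \<cdot>\<^bsub>D\<^esub> (E \<triangleleft>\<^bsub>D\<^esub> J x x) \<cdot>\<^bsub>D\<^esub> J x xx = (inverse_arr D a \<cdot>\<^bsub>D\<^esub> a) \<cdot>\<^bsub>D\<^esub> ((J x x \<triangleright>\<^bsub>D\<^esub> E) \<cdot>\<^bsub>D\<^esub> J xx x)"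
      unfolding J_assoc[OF x x x, symmetric] by simp
    then show ?thesis by (simp only: assoc_inverse(2)[OF x x x]) simp
  qed
  have "?r \<cdot>\<^bsub>D\<^esub> J x x = LUnit D E \<cdot>\<^bsub>D\<^esub> (B' \<triangleright>\<^bsub>D\<^esub> E) \<cdot>\<^bsub>D\<^esub> (inverse_arr D a \<cdot>\<^bsub>D\<^esub> (E \<triangleleft>\<^bsub>D\<^esub> J x x) \<cdot>\<^bsub>D\<^esub> J x xx) \<cdot>\<^bsub>D\<^esub> Fa (x \<triangleleft>\<^bsub>M\<^esub> \<delta>)"
    by (simp add: comult_whisk(4))
  also have "\<dots> = LUnit D E \<cdot>\<^bsub>D\<^esub> ((B' \<triangleright>\<^bsub>D\<^esub> E) \<cdot>\<^bsub>D\<^esub> (J x x \<triangleright>\<^bsub>D\<^esub> E)) \<cdot>\<^bsub>D\<^esub> J xx x \<cdot>\<^bsub>D\<^esub> Fa (x \<triangleleft>\<^bsub>M\<^esub> \<delta>)"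
    unfolding aJ by simp
  also have "\<dots> = (LUnit D E \<cdot>\<^bsub>D\<^esub> (Fa B \<triangleright>\<^bsub>D\<^esub> E) \<cdot>\<^bsub>D\<^esub> J xx x) \<cdot>\<^bsub>D\<^esub> Fa (x \<triangleleft>\<^bsub>M\<^esub> \<delta>)" unfolding wB by simp
  also have "\<dots> = Fa ((B \<triangleright>\<^bsub>M\<^esub> x) \<cdot>\<^bsub>M\<^esub> (x \<triangleleft>\<^bsub>M\<^esub> \<delta>))"
    by (simp add: unit_whisk[OF B] F_comp[OF M_homs(2) hM(1)])
  finally have r: "?r \<cdot>\<^bsub>D\<^esub> J x x = Fa ((B \<triangleright>\<^bsub>M\<^esub> x) \<cdot>\<^bsub>M\<^esub> (x \<triangleleft>\<^bsub>M\<^esub> \<delta>))" .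
  have "?l = ?r \<longleftrightarrow> ?l \<cdot>\<^bsub>D\<^esub> J x x = ?r \<cdot>\<^bsub>D\<^esub> J x x"
    by (rule iffI, simp only:, rule D.epiD[OF J_epi[OF x x]], assumption) simp_all
  also have "\<dots> \<longleftrightarrow> (x \<triangleleft>\<^bsub>M\<^esub> B) \<cdot>\<^bsub>M\<^esub> (\<delta> \<triangleright>\<^bsub>M\<^esub> x) = (B \<triangleright>\<^bsub>M\<^esub> x) \<cdot>\<^bsub>M\<^esub> (x \<triangleleft>\<^bsub>M\<^esub> \<delta>)"
    unfolding l r by (rule Fa_eq_iff[of _ xx x]) (simp_all add: hom_def)
  finally show "(RUnit M x \<cdot>\<^bsub>M\<^esub> (x \<triangleleft>\<^bsub>M\<^esub> B) \<cdot>\<^bsub>M\<^esub> Assoc M x x x \<cdot>\<^bsub>M\<^esub> (\<delta> \<triangleright>\<^bsub>M\<^esub> x) =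
        LUnit M x \<cdot>\<^bsub>M\<^esub> (B \<triangleright>\<^bsub>M\<^esub> x) \<cdot>\<^bsub>M\<^esub> inverse_arr M (Assoc M x x x) \<cdot>\<^bsub>M\<^esub> (x \<triangleleft>\<^bsub>M\<^esub> \<delta>)) \<longleftrightarrow> ?l = ?r"
    by (simp add: inverse_ide)
  have n: "(Fa t \<triangleright>\<^bsub>D\<^esub> E) \<cdot>\<^bsub>D\<^esub> J \<one>\<^bsub>M\<^esub> x = J x x \<cdot>\<^bsub>D\<^esub> Fa (t \<triangleright>\<^bsub>M\<^esub> x)"
    "(E \<triangleleft>\<^bsub>D\<^esub> Fa t) \<cdot>\<^bsub>D\<^esub> J x \<one>\<^bsub>M\<^esub> = J x x \<cdot>\<^bsub>D\<^esub> Fa (x \<triangleleft>\<^bsub>M\<^esub> t)"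
    using J_natural[OF t M.ide_hom[of x]] J_natural[OF M.ide_hom[of x] t] by (simp_all add: F_ide)
  have "B' \<cdot>\<^bsub>D\<^esub> (Fa t \<triangleright>\<^bsub>D\<^esub> E) \<cdot>\<^bsub>D\<^esub> inverse_arr D (LUnit D E) = (B' \<cdot>\<^bsub>D\<^esub> J x x) \<cdot>\<^bsub>D\<^esub> Fa (t \<triangleright>\<^bsub>M\<^esub> x)"
    unfolding unit_inverse(1)[OF x] n by simp
  then have "B' \<cdot>\<^bsub>D\<^esub> (Fa t \<triangleright>\<^bsub>D\<^esub> E) \<cdot>\<^bsub>D\<^esub> inverse_arr D (LUnit D E) = Fa (B \<cdot>\<^bsub>M\<^esub> (t \<triangleright>\<^bsub>M\<^esub> x))"
    unfolding BJ by (simp add: F_comp[OF hM(3) B])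
  then show "B \<cdot>\<^bsub>M\<^esub> (t \<triangleright>\<^bsub>M\<^esub> x) \<cdot>\<^bsub>M\<^esub> inverse_arr M (LUnit M x) = \<epsilon> \<longleftrightarrow>
      B' \<cdot>\<^bsub>D\<^esub> (Fa t \<triangleright>\<^bsub>D\<^esub> E) \<cdot>\<^bsub>D\<^esub> inverse_arr D (LUnit D E) = Fa \<epsilon>"
    using Fa_eq_iff[of "B \<cdot>\<^bsub>M\<^esub> (t \<triangleright>\<^bsub>M\<^esub> x)" x "\<one>\<^bsub>M\<^esub>" \<epsilon>] by (simp add: inverse_ide hom_def)
  have "B' \<cdot>\<^bsub>D\<^esub> (E \<triangleleft>\<^bsub>D\<^esub> Fa t) \<cdot>\<^bsub>D\<^esub> inverse_arr D (RUnit D E) = (B' \<cdot>\<^bsub>D\<^esub> J x x) \<cdot>\<^bsub>D\<^esub> Fa (x \<triangleleft>\<^bsub>M\<^esub> t)"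
    unfolding unit_inverse(2)[OF x] n by simp
  then have "B' \<cdot>\<^bsub>D\<^esub> (E \<triangleleft>\<^bsub>D\<^esub> Fa t) \<cdot>\<^bsub>D\<^esub> inverse_arr D (RUnit D E) = Fa (B \<cdot>\<^bsub>M\<^esub> (x \<triangleleft>\<^bsub>M\<^esub> t))"
    unfolding BJ by (simp add: F_comp[OF hM(4) B])
  then show "B \<cdot>\<^bsub>M\<^esub> (x \<triangleleft>\<^bsub>M\<^esub> t) \<cdot>\<^bsub>M\<^esub> inverse_arr M (RUnit M x) = \<epsilon> \<longleftrightarrow>
      B' \<cdot>\<^bsub>D\<^esub> (E \<triangleleft>\<^bsub>D\<^esub> Fa t) \<cdot>\<^bsub>D\<^esub> inverse_arr D (RUnit D E) = Fa \<epsilon>"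
    using Fa_eq_iff[of "B \<cdot>\<^bsub>M\<^esub> (x \<triangleleft>\<^bsub>M\<^esub> t)" x "\<one>\<^bsub>M\<^esub>" \<epsilon>] by (simp add: inverse_ide hom_def)
qed

text \<open>From left to right, \<open>B\<close> is transported along the inverse of
  \<open>J x x\<close>. From right to left, fullness of \<open>Fa\<close> provides preimages of
  \<open>t'\<close> and of \<open>B'\<close> composed with \<open>J x x\<close>.\<close>

lemma frobenius_iff:
  assumes "coalgebra M x \<delta> \<epsilon>"
  shows "frobenius_coalgebra M x \<delta> \<epsilon> \<longleftrightarrow> frobenius_coalgebra D E (F_comult x \<delta>) (Fa \<epsilon>)"
proof
  assume "frobenius_coalgebra M x \<delta> \<epsilon>"
  then obtain t B where t: "t \<in> hom M \<one>\<^bsub>M\<^esub> x" and B: "B \<in> hom M xx \<one>\<^bsub>M\<^esub>"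
    and eqs: "RUnit M x \<cdot>\<^bsub>M\<^esub> (x \<triangleleft>\<^bsub>M\<^esub> B) \<cdot>\<^bsub>M\<^esub> Assoc M x x x \<cdot>\<^bsub>M\<^esub> (\<delta> \<triangleright>\<^bsub>M\<^esub> x) =
        LUnit M x \<cdot>\<^bsub>M\<^esub> (B \<triangleright>\<^bsub>M\<^esub> x) \<cdot>\<^bsub>M\<^esub> inverse_arr M (Assoc M x x x) \<cdot>\<^bsub>M\<^esub> (x \<triangleleft>\<^bsub>M\<^esub> \<delta>)"
      "B \<cdot>\<^bsub>M\<^esub> (t \<triangleright>\<^bsub>M\<^esub> x) \<cdot>\<^bsub>M\<^esub> inverse_arr M (LUnit M x) = \<epsilon>"
      "B \<cdot>\<^bsub>M\<^esub> (x \<triangleleft>\<^bsub>M\<^esub> t) \<cdot>\<^bsub>M\<^esub> inverse_arr M (RUnit M x) = \<epsilon>"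
    unfolding frobenius_coalgebra_def by blast
  obtain k where k: "k \<in> hom D EE (Fo xx)" "k \<cdot>\<^bsub>D\<^esub> J x x = Ide D (Fo xx)" using J_iso[of x x] by auto
  have FB: "Fa B \<in> hom D (Fo xx) \<one>\<^bsub>D\<^esub>" using Fa_hom[OF B] by (simp add: F_unit)
  then have B': "Fa B \<cdot>\<^bsub>D\<^esub> k \<in> hom D EE \<one>\<^bsub>D\<^esub>" using k by (intro D.comp_hom)
  have "(Fa B \<cdot>\<^bsub>D\<^esub> k) \<cdot>\<^bsub>D\<^esub> J x x = Fa B"
    using D.comp_assoc[OF J_hom k(1) FB] D.comp_ide_right[OF FB] by (simp add: k)
  note * = frobenius_pair_iff[OF t B B' this]
  have "Fa t \<in> hom D \<one>\<^bsub>D\<^esub> E" using Fa_hom[OF t] by (simp add: F_unit)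
  then show "frobenius_coalgebra D E (F_comult x \<delta>) (Fa \<epsilon>)"
    unfolding frobenius_coalgebra_def
    using F_coalgebra[OF assms] eqs[unfolded *] B' by blast
next
  assume "frobenius_coalgebra D E (F_comult x \<delta>) (Fa \<epsilon>)"
  then obtain t' B' where t': "t' \<in> hom D \<one>\<^bsub>D\<^esub> E" and B': "B' \<in> hom D EE \<one>\<^bsub>D\<^esub>"
    and eqs: "RUnit D E \<cdot>\<^bsub>D\<^esub> (E \<triangleleft>\<^bsub>D\<^esub> B') \<cdot>\<^bsub>D\<^esub> a \<cdot>\<^bsub>D\<^esub> (F_comult x \<delta> \<triangleright>\<^bsub>D\<^esub> E) =
        LUnit D E \<cdot>\<^bsub>D\<^esub> (B' \<triangleright>\<^bsub>D\<^esub> E) \<cdot>\<^bsub>D\<^esub> inverse_arr D a \<cdot>\<^bsub>D\<^esub> (E \<triangleleft>\<^bsub>D\<^esub> F_comult x \<delta>)"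
      "B' \<cdot>\<^bsub>D\<^esub> (t' \<triangleright>\<^bsub>D\<^esub> E) \<cdot>\<^bsub>D\<^esub> inverse_arr D (LUnit D E) = Fa \<epsilon>"
      "B' \<cdot>\<^bsub>D\<^esub> (E \<triangleleft>\<^bsub>D\<^esub> t') \<cdot>\<^bsub>D\<^esub> inverse_arr D (RUnit D E) = Fa \<epsilon>"
    unfolding frobenius_coalgebra_def by blast
  obtain t where t: "t \<in> hom M \<one>\<^bsub>M\<^esub> x" "Fa t = t'"
    using Fa_surj[of t' "\<one>\<^bsub>M\<^esub>" x] t' by (auto simp: F_unit)
  obtain B where B: "B \<in> hom M xx \<one>\<^bsub>M\<^esub>" "Fa B = B' \<cdot>\<^bsub>D\<^esub> J x x"
    using Fa_surj[of "B' \<cdot>\<^bsub>D\<^esub> J x x" xx "\<one>\<^bsub>M\<^esub>"] D.comp_hom[OF J_hom B'] by (auto simp: F_unit)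
  note * = frobenius_pair_iff[OF t(1) B(1) B' B(2)[symmetric]]
  show "frobenius_coalgebra M x \<delta> \<epsilon>"
    unfolding frobenius_coalgebra_def
    using assms eqs[folded t(2), folded *] t(1) B(1) by blast
qed

end
end

section \<open>The category of transfer morphisms\<close>

locale algebra_in_category = strict_monoidal_category C
  for C :: "('o, 'a, 'z) tensor_cat_scheme" (structure) +
  fixes A :: 'o and m \<eta> :: 'a
  assumes alg: "algebra C A m \<eta>"
begin

lemma alg_simps [simp]:
  "A \<in> Obj C" "m \<in> Arr C" "Dom C m = A \<boxtimes> A" "Cod C m = A"
  "\<eta> \<in> Arr C" "Dom C \<eta> = \<one>" "Cod C \<eta> = A"
  using alg by (auto simp: algebra_def hom_def)

lemma alg_eqs:
  "m \<cdot> (m \<triangleright> A) = m \<cdot> (A \<triangleleft> m)" "m \<cdot> (\<eta> \<triangleright> A) = Ide C A" "m \<cdot> (A \<triangleleft> \<eta>) = Ide C A"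
  using alg by (auto simp: algebra_def)

section \<open>Left linear maps between free left modules\<close>

lemma mult_assoc_whisk:
  assumes "Y \<in> Obj C"
  shows "(m \<triangleright> Y) \<cdot> (m \<triangleright> (A \<boxtimes> Y)) = (m \<triangleright> Y) \<cdot> (A \<triangleleft> (m \<triangleright> Y))"
proof -
  have "(m \<cdot> (m \<triangleright> A)) \<triangleright> Y = (m \<cdot> (A \<triangleleft> m)) \<triangleright> Y" by (simp add: alg_eqs)
  then show ?thesis using assms by (simp flip: whisk_comp)
qed

lemma mult_unit_whisk:
  assumes "Y \<in> Obj C"
  shows "(m \<triangleright> Y) \<cdot> (\<eta> \<triangleright> (A \<boxtimes> Y)) = Ide C (A \<boxtimes> Y)"
    and "(m \<triangleright> Y) \<cdot> (A \<triangleleft> (\<eta> \<triangleright> Y)) = Ide C (A \<boxtimes> Y)"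
proof -
  have "(m \<cdot> (\<eta> \<triangleright> A)) \<triangleright> Y = Ide C (A \<boxtimes> Y)" "(m \<cdot> (A \<triangleleft> \<eta>)) \<triangleright> Y = Ide C (A \<boxtimes> Y)"
    using assms by (simp_all add: alg_eqs)
  then show "(m \<triangleright> Y) \<cdot> (\<eta> \<triangleright> (A \<boxtimes> Y)) = Ide C (A \<boxtimes> Y)"
    "(m \<triangleright> Y) \<cdot> (A \<triangleleft> (\<eta> \<triangleright> Y)) = Ide C (A \<boxtimes> Y)"
    using assms by (simp_all flip: whisk_comp)
qed

text \<open>The left linear map AY to AZ that extends f from Y to AZ. Composition of transfer
  morphisms is \<open>ext Z g \<cdot> f\<close>, the Kleisli composition of the monad that tensors
  with A on the left.\<close>

definition ext :: "'o \<Rightarrow> 'a \<Rightarrow> 'a" where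
  "ext Z f = (m \<triangleright> Z) \<cdot> (A \<triangleleft> f)"

lemma ext_arr [simp]:
  assumes "f \<in> Arr C" "Cod C f = A \<boxtimes> Z" "Z \<in> Obj C"
  shows "ext Z f \<in> Arr C" "Dom C (ext Z f) = A \<boxtimes> Dom C f" "Cod C (ext Z f) = A \<boxtimes> Z"
  using assms by (simp_all add: ext_def)

lemma ext_linear:
  assumes [simp]: "f \<in> Arr C" "Cod C f = A \<boxtimes> Z" "Z \<in> Obj C"
  shows "ext Z f \<cdot> (m \<triangleright> Dom C f) = (m \<triangleright> Z) \<cdot> (A \<triangleleft> ext Z f)"
proof -
  have "ext Z f \<cdot> (m \<triangleright> Dom C f) = (m \<triangleright> Z) \<cdot> ((A \<triangleleft> f) \<cdot> (m \<triangleright> Dom C f))" by (simp add: ext_def)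
  also have "(A \<triangleleft> f) \<cdot> (m \<triangleright> Dom C f) = (m \<triangleright> (A \<boxtimes> Z)) \<cdot> ((A \<boxtimes> A) \<triangleleft> f)" by (simp add: tens_comp)
  also have "(m \<triangleright> Z) \<cdot> \<dots> = ((m \<triangleright> Z) \<cdot> (m \<triangleright> (A \<boxtimes> Z))) \<cdot> ((A \<boxtimes> A) \<triangleleft> f)" by simp
  also have "\<dots> = (m \<triangleright> Z) \<cdot> (A \<triangleleft> ext Z f)"
    unfolding mult_assoc_whisk[OF assms(3)] by (simp add: ext_def flip: whisk_comp)
  finally show ?thesis .
qed

lemma ext_unit:
  assumes [simp]: "f \<in> Arr C" "Cod C f = A \<boxtimes> Z" "Z \<in> Obj C"
  shows "ext Z f \<cdot> (\<eta> \<triangleright> Dom C f) = f"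
proof -
  have "ext Z f \<cdot> (\<eta> \<triangleright> Dom C f) = (m \<triangleright> Z) \<cdot> ((A \<triangleleft> f) \<cdot> (\<eta> \<triangleright> Dom C f))" by (simp add: ext_def)
  \<comment> \<open>Interchange of \<open>f\<close> with the unit of A. For this \<open>f\<close>
    has to be seen as tensored with the identity of the unit object, so the rule erasing that
    identity is switched off.\<close>
  also have "(A \<triangleleft> f) \<cdot> (\<eta> \<triangleright> Dom C f) = (\<eta> \<triangleright> (A \<boxtimes> Z)) \<cdot> (\<one> \<triangleleft> f)"
    unfolding tens_comp[of \<eta> "Ide C A", symmetric] by (simp add: tens_comp del: arr_strict(2))
  also have "(m \<triangleright> Z) \<cdot> \<dots> = ((m \<triangleright> Z) \<cdot> (\<eta> \<triangleright> (A \<boxtimes> Z))) \<cdot> f" by simp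
  also have "\<dots> = f" unfolding mult_unit_whisk(1)[OF assms(3)] by simp
  finally show ?thesis .
qed

text \<open>With \<open>ext_linear\<close> and \<open>ext_unit\<close> this is the universal
  property of free left modules: \<open>ext Z\<close> and precomposition with the unit of A are
  inverse bijections between maps Y to AZ and left linear maps AY to AZ.\<close>

lemma linear_eq_ext:
  assumes [simp]: "h \<in> Arr C" "Dom C h = A \<boxtimes> Y" "Cod C h = A \<boxtimes> Z" "Y \<in> Obj C" "Z \<in> Obj C"
    and lin: "h \<cdot> (m \<triangleright> Y) = (m \<triangleright> Z) \<cdot> (A \<triangleleft> h)"
  shows "ext Z (h \<cdot> (\<eta> \<triangleright> Y)) = h"
proof -
  have "ext Z (h \<cdot> (\<eta> \<triangleright> Y)) = ((m \<triangleright> Z) \<cdot> (A \<triangleleft> h)) \<cdot> (A \<triangleleft> (\<eta> \<triangleright> Y))"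
    by (simp add: ext_def flip: whisk_comp)
  also have "\<dots> = h \<cdot> ((m \<triangleright> Y) \<cdot> (A \<triangleleft> (\<eta> \<triangleright> Y)))" unfolding lin[symmetric] by simp
  finally show ?thesis by (simp add: mult_unit_whisk)
qed

text \<open>\<open>ext\<close> turns Kleisli composition into composition, because the left linear
  \<open>ext Z g\<close> can be moved past the multiplication.\<close>

lemma ext_comp:
  assumes [simp]: "f \<in> Arr C" "Cod C f = A \<boxtimes> Y" "Y \<in> Obj C"
    "g \<in> Arr C" "Dom C g = Y" "Cod C g = A \<boxtimes> Z" "Z \<in> Obj C"
  shows "ext Z (ext Z g \<cdot> f) = ext Z g \<cdot> ext Y f"
proof -
  have "ext Z g \<cdot> (m \<triangleright> Y) = (m \<triangleright> Z) \<cdot> (A \<triangleleft> ext Z g)" using ext_linear[of g Z] by simp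
  then have "((m \<triangleright> Z) \<cdot> (A \<triangleleft> ext Z g)) \<cdot> (A \<triangleleft> f) = ext Z g \<cdot> ((m \<triangleright> Y) \<cdot> (A \<triangleleft> f))"
    by (simp flip: comp_assoc')
  then show ?thesis by (simp add: ext_def[of Z "ext Z g \<cdot> f"] ext_def[of Y f] flip: whisk_comp)
qed

lemma ext_ide: "Y \<in> Obj C \<Longrightarrow> ext Y (\<eta> \<triangleright> Y) = Ide C (A \<boxtimes> Y)"
  by (simp add: ext_def mult_unit_whisk)

lemma ext_whisk:
  assumes [simp]: "f \<in> Arr C" "Cod C f = A \<boxtimes> Z" "Z \<in> Obj C" "W \<in> Obj C"
  shows "ext Z f \<triangleright> W = ext (Z \<boxtimes> W) (f \<triangleright> W)"
  by (simp add: ext_def flip: whisk_comp)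

section \<open>Transfer objects as right actions on AY\<close>

abbreviation "TO \<equiv> transfer_objs C A m \<eta>"

text \<open>For a transfer object \<open>y = (Y, \<phi>)\<close>, \<open>act y\<close> is the right action $\mu_{AY}$, and
  \<open>bal y z\<close> is $\mu_{AY}Z : AYAZ \to AYZ$, the concrete coequalizer map for $AY\otimes_A AZ$.\<close>

definition act :: "('o, 'a) tr_obj \<Rightarrow> 'a" where
  "act y = ext (fst y) (snd y)"

definition bal :: "('o, 'a) tr_obj \<Rightarrow> ('o, 'a) tr_obj \<Rightarrow> 'a" where
  "bal y z = act y \<triangleright> fst z"

lemma TO_simps [simp]:
  assumes "y \<in> TO"
  shows "fst y \<in> Obj C" "snd y \<in> Arr C" "Dom C (snd y) = fst y \<boxtimes> A" "Cod C (snd y) = A \<boxtimes> fst y"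
    "act y \<in> Arr C" "Dom C (act y) = A \<boxtimes> (fst y \<boxtimes> A)" "Cod C (act y) = A \<boxtimes> fst y"
proof -
  show [simp]: "fst y \<in> Obj C" "snd y \<in> Arr C" "Dom C (snd y) = fst y \<boxtimes> A" "Cod C (snd y) = A \<boxtimes> fst y"
    using assms by (auto simp: transfer_objs_def hom_def)
  show "act y \<in> Arr C" "Dom C (act y) = A \<boxtimes> (fst y \<boxtimes> A)" "Cod C (act y) = A \<boxtimes> fst y"
    by (simp_all add: act_def)
qed

lemma bal_simps [simp]:
  assumes "y \<in> TO" "z \<in> TO"
  shows "bal y z \<in> Arr C" "Dom C (bal y z) = A \<boxtimes> (fst y \<boxtimes> (A \<boxtimes> fst z))"
    "Cod C (bal y z) = A \<boxtimes> (fst y \<boxtimes> fst z)"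
  using assms by (simp_all add: bal_def)

lemma act_linear:
  "y \<in> TO \<Longrightarrow> act y \<cdot> (m \<triangleright> (fst y \<boxtimes> A)) = (m \<triangleright> fst y) \<cdot> (A \<triangleleft> act y)"
  using ext_linear[of "snd y" "fst y"] by (simp add: act_def)

lemma act_unit_left: "y \<in> TO \<Longrightarrow> act y \<cdot> (\<eta> \<triangleright> (fst y \<boxtimes> A)) = snd y"
  using ext_unit[of "snd y" "fst y"] by (simp add: act_def)

text \<open>The two equations on a transfer object say that \<open>act y\<close> is an associative
  and unital right action on AY. Applying \<open>ext\<close> to an equation of maps into AY produces
  the corresponding law, and \<open>ext\<close> is injective because the unit of A recovers its
  argument.\<close>

lemma TO_iff:
  "y \<in> TO \<longleftrightarrow> fst y \<in> Obj C \<and> snd y \<in> hom C (fst y \<boxtimes> A) (A \<boxtimes> fst y) \<and>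
     act y \<cdot> ((A \<boxtimes> fst y) \<triangleleft> m) = act y \<cdot> (act y \<triangleright> A) \<and>
     act y \<cdot> ((A \<boxtimes> fst y) \<triangleleft> \<eta>) = Ide C (A \<boxtimes> fst y)"
proof -
  obtain Y \<phi> where y: "y = (Y, \<phi>)" by (cases y)
  show ?thesis
  proof (cases "Y \<in> Obj C \<and> \<phi> \<in> hom C (Y \<boxtimes> A) (A \<boxtimes> Y)")
    case True
    then have [simp]: "Y \<in> Obj C" "\<phi> \<in> Arr C" "Dom C \<phi> = Y \<boxtimes> A" "Cod C \<phi> = A \<boxtimes> Y"
      by (auto simp: hom_def)
    have 1: "act y \<cdot> ((A \<boxtimes> Y) \<triangleleft> m) = ext Y (\<phi> \<cdot> (Y \<triangleleft> m))"
      by (simp add: act_def ext_def y flip: whisk_comp)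
    \<comment> \<open>The right-hand side of the multiplicativity equation is a Kleisli composite,
      so \<open>ext_comp\<close> splits its extension into two actions.\<close>
    have 2: "act y \<cdot> (act y \<triangleright> A) = ext Y ((m \<triangleright> Y) \<cdot> (A \<triangleleft> \<phi>) \<cdot> (\<phi> \<triangleright> A))"
    proof -
      have "(m \<triangleright> Y) \<cdot> (A \<triangleleft> \<phi>) \<cdot> (\<phi> \<triangleright> A) = ext Y \<phi> \<cdot> (\<phi> \<triangleright> A)" by (simp add: ext_def)
      moreover have "ext Y (ext Y \<phi> \<cdot> (\<phi> \<triangleright> A)) = ext Y \<phi> \<cdot> ext (Y \<boxtimes> A) (\<phi> \<triangleright> A)"
        by (rule ext_comp) simp_all
      ultimately show ?thesis by (simp add: act_def y ext_whisk)
    qed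
    have 3: "act y \<cdot> ((A \<boxtimes> Y) \<triangleleft> \<eta>) = ext Y (\<phi> \<cdot> (Y \<triangleleft> \<eta>))"
      by (simp add: act_def ext_def y flip: whisk_comp)
    have inj: "f = g" if "ext Y f = ext Y g" and [simp]: "f \<in> Arr C" "Cod C f = A \<boxtimes> Y"
      "g \<in> Arr C" "Cod C g = A \<boxtimes> Y" "Dom C f = Dom C g" for f g
    proof -
      have "f = ext Y f \<cdot> (\<eta> \<triangleright> Dom C f)" by (rule ext_unit[symmetric]) simp_all
      also have "\<dots> = ext Y g \<cdot> (\<eta> \<triangleright> Dom C g)" unfolding that(1) that(6) ..
      also have "\<dots> = g" by (rule ext_unit) simp_all
      finally show ?thesis .
    qed
    have "act y \<cdot> ((A \<boxtimes> Y) \<triangleleft> m) = act y \<cdot> (act y \<triangleright> A) \<longleftrightarrow>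
      \<phi> \<cdot> (Y \<triangleleft> m) = (m \<triangleright> Y) \<cdot> (A \<triangleleft> \<phi>) \<cdot> (\<phi> \<triangleright> A)"
      unfolding 1 2 by (rule iffI, rule inj, simp_all)
    moreover have "act y \<cdot> ((A \<boxtimes> Y) \<triangleleft> \<eta>) = Ide C (A \<boxtimes> Y) \<longleftrightarrow> \<phi> \<cdot> (Y \<triangleleft> \<eta>) = \<eta> \<triangleright> Y"
      unfolding 3 by (rule iffI, rule inj, simp_all add: ext_ide)
    moreover have "y \<in> TO \<longleftrightarrow> \<phi> \<cdot> (Y \<triangleleft> m) = (m \<triangleright> Y) \<cdot> (A \<triangleleft> \<phi>) \<cdot> (\<phi> \<triangleright> A) \<and>
        \<phi> \<cdot> (Y \<triangleleft> \<eta>) = \<eta> \<triangleright> Y"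
      using True unfolding transfer_objs_def y by blast
    ultimately show ?thesis using True unfolding y fst_conv snd_conv by blast
  qed (auto simp: transfer_objs_def y)
qed

lemma act_assoc: "y \<in> TO \<Longrightarrow> act y \<cdot> ((A \<boxtimes> fst y) \<triangleleft> m) = act y \<cdot> (act y \<triangleright> A)"
  and act_unit: "y \<in> TO \<Longrightarrow> act y \<cdot> ((A \<boxtimes> fst y) \<triangleleft> \<eta>) = Ide C (A \<boxtimes> fst y)"
  using TO_iff by auto

text \<open>Inserting the unit of A between Y and Z is a section, by unitality of the right action.
  This is why \<open>bal\<close> is epi.\<close>

lemma bal_split:
  assumes [simp]: "y \<in> TO" "Z \<in> Obj C"
  shows "(act y \<triangleright> Z) \<cdot> ((A \<boxtimes> fst y) \<triangleleft> (\<eta> \<triangleright> Z)) = Ide C (A \<boxtimes> (fst y \<boxtimes> Z))"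
proof -
  have "(act y \<cdot> ((A \<boxtimes> fst y) \<triangleleft> \<eta>)) \<triangleright> Z = Ide C (A \<boxtimes> (fst y \<boxtimes> Z))"
    by (simp add: act_unit)
  then show ?thesis by (simp flip: whisk_comp)
qed

lemma epi_act: "\<lbrakk>y \<in> TO; Z \<in> Obj C\<rbrakk> \<Longrightarrow> epi C (act y \<triangleright> Z)"
  by (rule split_epi[OF _ _ bal_split]) (simp_all add: hom_def)

lemma epi_bal: "\<lbrakk>y \<in> TO; z \<in> TO\<rbrakk> \<Longrightarrow> epi C (bal y z)"
  by (simp add: bal_def epi_act)

text \<open>Associativity of the right action on AY, tensored with Z: in AYAAZ the first of the two
  middle factors may act to the left or be multiplied to the right.\<close>

lemma bal_balanced:
  assumes [simp]: "y \<in> TO" "z \<in> TO"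
  shows "bal y z \<cdot> ((A \<boxtimes> fst y) \<triangleleft> (m \<triangleright> fst z)) = bal y z \<cdot> (act y \<triangleright> (A \<boxtimes> fst z))"
proof -
  have "(act y \<cdot> ((A \<boxtimes> fst y) \<triangleleft> m)) \<triangleright> fst z = (act y \<cdot> (act y \<triangleright> A)) \<triangleright> fst z"
    by (simp add: act_assoc)
  then show ?thesis by (simp add: bal_def flip: whisk_comp)
qed

lemma bal_linear:
  assumes [simp]: "y \<in> TO" "z \<in> TO"
  shows "bal y z \<cdot> (m \<triangleright> (fst y \<boxtimes> (A \<boxtimes> fst z))) = (m \<triangleright> (fst y \<boxtimes> fst z)) \<cdot> (A \<triangleleft> bal y z)"
proof -
  have "(act y \<cdot> (m \<triangleright> (fst y \<boxtimes> A))) \<triangleright> fst z = ((m \<triangleright> fst y) \<cdot> (A \<triangleleft> act y)) \<triangleright> fst z"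
    by (simp add: act_linear)
  then show ?thesis by (simp add: bal_def flip: whisk_comp)
qed

abbreviation tobj :: "('o, 'a) tr_obj \<Rightarrow> ('o, 'a) tr_obj \<Rightarrow> ('o, 'a) tr_obj" where
  "tobj \<equiv> transfer_tobj C"

lemma fst_tobj [simp]: "fst (tobj y z) = fst y \<boxtimes> fst z"
  by (cases y; cases z) simp

lemma act_tobj:
  assumes [simp]: "y \<in> TO" "z \<in> TO"
  shows "act (tobj y z) = bal y z \<cdot> ((A \<boxtimes> fst y) \<triangleleft> snd z)"
  using TO_simps[OF assms(1)] TO_simps[OF assms(2)]
  by (cases y; cases z) (simp add: act_def bal_def ext_def flip: whisk_comp)

lemma act_tobj_arr:
  assumes [simp]: "y \<in> TO" "z \<in> TO"
  shows "act (tobj y z) \<in> Arr C" "Dom C (act (tobj y z)) = A \<boxtimes> (fst y \<boxtimes> (fst z \<boxtimes> A))"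
    "Cod C (act (tobj y z)) = A \<boxtimes> (fst y \<boxtimes> fst z)"
  by (simp_all add: act_tobj)

text \<open>Interchange lets the arrow of \<open>z\<close> be applied before \<open>act y\<close>;
  balancedness then replaces the action of the A it produces by a multiplication, and the two
  together are \<open>act z\<close>. So the action on AYZ coming from \<open>tobj\<close> is the one
  induced by AZ.\<close>

lemma bal_right_linear:
  assumes [simp]: "y \<in> TO" "z \<in> TO"
  shows "act (tobj y z) \<cdot> (bal y z \<triangleright> A) = bal y z \<cdot> ((A \<boxtimes> fst y) \<triangleleft> act z)"
proof -
  have "act (tobj y z) \<cdot> (bal y z \<triangleright> A) =
      bal y z \<cdot> (((A \<boxtimes> fst y) \<triangleleft> snd z) \<cdot> (act y \<triangleright> (fst z \<boxtimes> A)))"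
    by (simp add: act_tobj) (simp add: bal_def)
  also have "((A \<boxtimes> fst y) \<triangleleft> snd z) \<cdot> (act y \<triangleright> (fst z \<boxtimes> A)) =
      (act y \<triangleright> (A \<boxtimes> fst z)) \<cdot> ((A \<boxtimes> (fst y \<boxtimes> A)) \<triangleleft> snd z)"
    by (simp add: tens_comp)
  also have "bal y z \<cdot> \<dots> = (bal y z \<cdot> (act y \<triangleright> (A \<boxtimes> fst z))) \<cdot> ((A \<boxtimes> (fst y \<boxtimes> A)) \<triangleleft> snd z)"
    by simp
  also have "\<dots> = bal y z \<cdot> ((A \<boxtimes> fst y) \<triangleleft> ((m \<triangleright> fst z) \<cdot> (A \<triangleleft> snd z)))"
    by (simp add: bal_balanced[symmetric] flip: whisk_comp)
  finally show ?thesis by (simp add: act_def ext_def)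
qed

text \<open>By \<open>TO_iff\<close> it is enough that AYZ is a right module. Both laws are tested
  on epis built from \<open>bal\<close>, where \<open>bal_right_linear\<close> reduces them to the
  laws for AZ.\<close>

lemma tobj_TO [simp]:
  assumes [simp]: "y \<in> TO" "z \<in> TO"
  shows "tobj y z \<in> TO"
proof -
  note [simp] = act_tobj_arr
  let ?Y = "fst y" and ?Z = "fst z" and ?p = "bal y z" and ?a = "act (tobj y z)"
  have hom: "snd (tobj y z) \<in> hom C ((?Y \<boxtimes> ?Z) \<boxtimes> A) (A \<boxtimes> (?Y \<boxtimes> ?Z))"
    using TO_simps[OF assms(1)] TO_simps[OF assms(2)] by (cases y; cases z) (simp add: hom_def)
  have ep: "epi C (?p \<triangleright> W)" if "W \<in> Obj C" for W
    using that epi_act[of y "?Z \<boxtimes> W"] by (simp add: bal_def)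
  have "?a \<cdot> ((A \<boxtimes> (?Y \<boxtimes> ?Z)) \<triangleleft> m) = ?a \<cdot> (?a \<triangleright> A)"
  proof (rule epiD[OF ep[of "A \<boxtimes> A"]])
    have "(?a \<cdot> ((A \<boxtimes> (?Y \<boxtimes> ?Z)) \<triangleleft> m)) \<cdot> (?p \<triangleright> (A \<boxtimes> A)) =
        (?a \<cdot> (?p \<triangleright> A)) \<cdot> ((A \<boxtimes> (?Y \<boxtimes> (A \<boxtimes> ?Z))) \<triangleleft> m)"
      by (simp add: tens_comp)
    also have "\<dots> = ?p \<cdot> ((A \<boxtimes> ?Y) \<triangleleft> (act z \<cdot> ((A \<boxtimes> ?Z) \<triangleleft> m)))"
      unfolding bal_right_linear[OF assms] by (simp flip: whisk_comp)
    also have "\<dots> = (?p \<cdot> ((A \<boxtimes> ?Y) \<triangleleft> act z)) \<cdot> (((A \<boxtimes> ?Y) \<triangleleft> act z) \<triangleright> A)"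
      unfolding act_assoc[OF assms(2)] by (simp flip: whisk_comp)
    also have "\<dots> = (?a \<cdot> (?p \<triangleright> A)) \<cdot> (((A \<boxtimes> ?Y) \<triangleleft> act z) \<triangleright> A)"
      unfolding bal_right_linear[OF assms] ..
    also have "\<dots> = ?a \<cdot> ((?p \<cdot> ((A \<boxtimes> ?Y) \<triangleleft> act z)) \<triangleright> A)"
      by (simp flip: whisk_comp)
    also have "\<dots> = (?a \<cdot> (?a \<triangleright> A)) \<cdot> (?p \<triangleright> (A \<boxtimes> A))"
      unfolding bal_right_linear[OF assms, symmetric] by (simp flip: whisk_comp)
    finally show "(?a \<cdot> ((A \<boxtimes> (?Y \<boxtimes> ?Z)) \<triangleleft> m)) \<cdot> (?p \<triangleright> (A \<boxtimes> A)) =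
        (?a \<cdot> (?a \<triangleright> A)) \<cdot> (?p \<triangleright> (A \<boxtimes> A))" .
  qed simp_all
  moreover have "?a \<cdot> ((A \<boxtimes> (?Y \<boxtimes> ?Z)) \<triangleleft> \<eta>) = Ide C (A \<boxtimes> (?Y \<boxtimes> ?Z))"
  proof (rule epiD[OF epi_bal[OF assms]])
    have "((A \<boxtimes> (?Y \<boxtimes> ?Z)) \<triangleleft> \<eta>) \<cdot> (?p \<triangleright> \<one>) = (?p \<triangleright> A) \<cdot> ((A \<boxtimes> (?Y \<boxtimes> (A \<boxtimes> ?Z))) \<triangleleft> \<eta>)"
      by (simp add: tens_comp del: arr_strict(2,3))
    then have "(?a \<cdot> ((A \<boxtimes> (?Y \<boxtimes> ?Z)) \<triangleleft> \<eta>)) \<cdot> ?p =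
        (?a \<cdot> (?p \<triangleright> A)) \<cdot> ((A \<boxtimes> (?Y \<boxtimes> (A \<boxtimes> ?Z))) \<triangleleft> \<eta>)"
      by simp
    also have "\<dots> = ?p \<cdot> ((A \<boxtimes> ?Y) \<triangleleft> (act z \<cdot> ((A \<boxtimes> ?Z) \<triangleleft> \<eta>)))"
      unfolding bal_right_linear[OF assms] by (simp flip: whisk_comp)
    also have "\<dots> = Ide C (A \<boxtimes> (?Y \<boxtimes> ?Z)) \<cdot> ?p" by (simp add: act_unit)
    finally show "(?a \<cdot> ((A \<boxtimes> (?Y \<boxtimes> ?Z)) \<triangleleft> \<eta>)) \<cdot> ?p = Ide C (A \<boxtimes> (?Y \<boxtimes> ?Z)) \<cdot> ?p" .
  qed simp_all
  ultimately show ?thesis using hom by (simp add: TO_iff[of "tobj y z"])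
qed

section \<open>Transfer morphisms and their tensor products\<close>

definition transfer_arr :: "('o, 'a) tr_obj \<Rightarrow> 'a \<Rightarrow> ('o, 'a) tr_obj \<Rightarrow> bool" where
  "transfer_arr y f z \<longleftrightarrow> y \<in> TO \<and> z \<in> TO \<and> f \<in> hom C (fst y) (A \<boxtimes> fst z) \<and>
     ext (fst z) f \<cdot> act y = act z \<cdot> (ext (fst z) f \<triangleright> A)"

lemma transfer_arrD:
  assumes "transfer_arr y f z"
  shows "y \<in> TO" "z \<in> TO" "f \<in> Arr C" "Dom C f = fst y" "Cod C f = A \<boxtimes> fst z"
  using assms by (auto simp: transfer_arr_def hom_def)

lemma transfer_arr_linear:
  "transfer_arr y f z \<Longrightarrow> ext (fst z) f \<cdot> act y = act z \<cdot> (ext (fst z) f \<triangleright> A)"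
  by (simp add: transfer_arr_def)

text \<open>The defining equation of a transfer morphism is the right linearity required by
  \<open>transfer_arr\<close>, restricted along the unit of A. Both sides of the latter are left
  linear, so nothing is lost by the restriction.\<close>

lemma transfer_arrs_iff: "(y, f, z) \<in> transfer_arrs C A m \<eta> \<longleftrightarrow> transfer_arr y f z"
proof -
  have "ext (fst z) f \<cdot> snd y = act z \<cdot> (f \<triangleright> A) \<longleftrightarrow>
      ext (fst z) f \<cdot> act y = act z \<cdot> (ext (fst z) f \<triangleright> A)"
    if [simp]: "y \<in> TO" "z \<in> TO" "f \<in> Arr C" "Dom C f = fst y" "Cod C f = A \<boxtimes> fst z"
  proof
    let ?F = "ext (fst z) f"
    have lin: "?F \<cdot> (m \<triangleright> fst y) = (m \<triangleright> fst z) \<cdot> (A \<triangleleft> ?F)"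
      using ext_linear[of f "fst z"] by simp
    {
      assume eq: "?F \<cdot> snd y = act z \<cdot> (f \<triangleright> A)"
      have "?F \<cdot> act y = (?F \<cdot> (m \<triangleright> fst y)) \<cdot> (A \<triangleleft> snd y)"
        by (simp add: act_def ext_def[of "fst y"])
      also have "\<dots> = (m \<triangleright> fst z) \<cdot> (A \<triangleleft> (?F \<cdot> snd y))"
        unfolding lin by (simp flip: whisk_comp)
      also have "\<dots> = ((m \<triangleright> fst z) \<cdot> (A \<triangleleft> act z)) \<cdot> (A \<triangleleft> (f \<triangleright> A))"
        unfolding eq by (simp flip: whisk_comp)
      also have "\<dots> = act z \<cdot> (?F \<triangleright> A)"
        unfolding act_linear[OF \<open>z \<in> TO\<close>, symmetric] by (simp add: ext_def[of "fst z"] flip: whisk_comp)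
      finally show "?F \<cdot> act y = act z \<cdot> (?F \<triangleright> A)" .
    next
      assume eq: "?F \<cdot> act y = act z \<cdot> (?F \<triangleright> A)"
      have "?F \<cdot> snd y = (?F \<cdot> act y) \<cdot> (\<eta> \<triangleright> (fst y \<boxtimes> A))" by (simp add: act_unit_left)
      also have "\<dots> = act z \<cdot> ((?F \<cdot> (\<eta> \<triangleright> fst y)) \<triangleright> A)" unfolding eq by (simp flip: whisk_comp)
      also have "?F \<cdot> (\<eta> \<triangleright> fst y) = f" using ext_unit[of f "fst z"] by simp
      finally show "?F \<cdot> snd y = act z \<cdot> (f \<triangleright> A)" .
    }
  qed
  moreover have "(m \<triangleright> fst z) \<cdot> (A \<triangleleft> f) \<cdot> snd y = ext (fst z) f \<cdot> snd y \<and>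
      (m \<triangleright> fst z) \<cdot> (A \<triangleleft> snd z) \<cdot> (f \<triangleright> A) = act z \<cdot> (f \<triangleright> A)"
    if [simp]: "y \<in> TO" "z \<in> TO" "f \<in> Arr C" "Dom C f = fst y" "Cod C f = A \<boxtimes> fst z"
    by (simp add: ext_def act_def)
  ultimately show ?thesis
    by (cases y; cases z) (auto simp: transfer_arrs_def transfer_arr_def hom_def)
qed

lemma ext_inj:
  assumes "ext Z f = ext Z g" "f \<in> hom C Y (A \<boxtimes> Z)" "g \<in> hom C Y (A \<boxtimes> Z)" "Z \<in> Obj C"
  shows "f = g"
  using assms ext_unit[of f Z] ext_unit[of g Z] by (simp add: hom_def)

lemma transfer_arr_ide:
  assumes [simp]: "y \<in> TO"
  shows "transfer_arr y (\<eta> \<triangleright> fst y) y"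
  by (simp add: transfer_arr_def hom_def ext_ide)

lemma transfer_arr_comp:
  assumes "transfer_arr x f y" "transfer_arr y g z"
  shows "transfer_arr x (ext (fst z) g \<cdot> f) z"
proof -
  note [simp] = transfer_arrD[OF assms(1)] transfer_arrD[OF assms(2)]
  let ?F = "ext (fst y) f" and ?G = "ext (fst z) g"
  have "(?G \<cdot> ?F) \<cdot> act x = (?G \<cdot> act y) \<cdot> (?F \<triangleright> A)"
    by (simp add: transfer_arr_linear[OF assms(1)])
  also have "\<dots> = act z \<cdot> ((?G \<cdot> ?F) \<triangleright> A)"
    unfolding transfer_arr_linear[OF assms(2)] by (simp flip: whisk_comp)
  finally show ?thesis by (simp add: transfer_arr_def hom_def ext_comp[of f "fst y"])
qed

text \<open>The tensor product of transfer morphisms extends to the map induced on AYZ by the tensor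
  product of the extensions. Right linearity of the first extension and balancedness hand the middle
  A over to \<open>g\<close>, which completes \<open>g\<close> to its own extension.\<close>

lemma ext_tens:
  assumes "transfer_arr y f y'" "transfer_arr z g z'"
  shows "ext (fst y' \<boxtimes> fst z') (bal y' z' \<cdot> (f \<otimes> g)) \<cdot> bal y z =
    bal y' z' \<cdot> (ext (fst y') f \<otimes> ext (fst z') g)"
proof -
  note [simp] = transfer_arrD[OF assms(1)] transfer_arrD[OF assms(2)]
  let ?F = "ext (fst y') f" and ?G = "ext (fst z') g"
  \<comment> \<open>A closed form of the extension: \<open>?h\<close> is left linear in the leading
    A, and along the unit it restricts to \<open>bal y' z' \<cdot> (f \<otimes> g)\<close>.\<close>
  let ?h = "bal y' z' \<cdot> (?F \<otimes> g)"
  have lin: "?F \<cdot> (m \<triangleright> fst y) = (m \<triangleright> fst y') \<cdot> (A \<triangleleft> ?F)"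
    using ext_linear[of f "fst y'"] by simp
  have "ext (fst y' \<boxtimes> fst z') (?h \<cdot> (\<eta> \<triangleright> (fst y \<boxtimes> fst z))) = ?h"
  proof (rule linear_eq_ext)
    have "?h \<cdot> (m \<triangleright> (fst y \<boxtimes> fst z)) = bal y' z' \<cdot> ((?F \<cdot> (m \<triangleright> fst y)) \<otimes> g)"
      using tens_comp[of "m \<triangleright> fst y" ?F "Ide C (fst z)" g] by simp
    also have "\<dots> = bal y' z' \<cdot> ((m \<triangleright> (fst y' \<boxtimes> (A \<boxtimes> fst z'))) \<cdot> (A \<triangleleft> (?F \<otimes> g)))"
      unfolding lin using tens_comp[of "A \<triangleleft> ?F" "m \<triangleright> fst y'" g "Ide C (A \<boxtimes> fst z')"] by simp
    also have "\<dots> = (bal y' z' \<cdot> (m \<triangleright> (fst y' \<boxtimes> (A \<boxtimes> fst z')))) \<cdot> (A \<triangleleft> (?F \<otimes> g))" by simp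
    also have "\<dots> = (m \<triangleright> (fst y' \<boxtimes> fst z')) \<cdot> (A \<triangleleft> ?h)"
      unfolding bal_linear[OF transfer_arrD(2)[OF assms(1)] transfer_arrD(2)[OF assms(2)]]
      by (simp flip: whisk_comp)
    finally show "?h \<cdot> (m \<triangleright> (fst y \<boxtimes> fst z)) = (m \<triangleright> (fst y' \<boxtimes> fst z')) \<cdot> (A \<triangleleft> ?h)" .
  qed simp_all
  moreover have "?h \<cdot> (\<eta> \<triangleright> (fst y \<boxtimes> fst z)) = bal y' z' \<cdot> (f \<otimes> g)"
    using tens_comp[of "\<eta> \<triangleright> fst y" ?F "Ide C (fst z)" g] ext_unit[of f "fst y'"] by simp
  ultimately have h: "ext (fst y' \<boxtimes> fst z') (bal y' z' \<cdot> (f \<otimes> g)) = ?h" by simp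
  have "?h \<cdot> bal y z = bal y' z' \<cdot> ((?F \<cdot> act y) \<otimes> g)"
    by (simp add: bal_def[of y z] tens_comp)
  also have "\<dots> = bal y' z' \<cdot> ((act y' \<triangleright> (A \<boxtimes> fst z')) \<cdot> (?F \<otimes> (A \<triangleleft> g)))"
    unfolding transfer_arr_linear[OF assms(1)]
    using tens_comp[of "?F \<triangleright> A" "act y'" g "Ide C (A \<boxtimes> fst z')"] by simp
  also have "\<dots> = (bal y' z' \<cdot> (act y' \<triangleright> (A \<boxtimes> fst z'))) \<cdot> (?F \<otimes> (A \<triangleleft> g))" by simp
  also have "\<dots> = bal y' z' \<cdot> (?F \<otimes> ((m \<triangleright> fst z') \<cdot> (A \<triangleleft> g)))"
    unfolding bal_balanced[OF transfer_arrD(2)[OF assms(1)] transfer_arrD(2)[OF assms(2)], symmetric]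
    by (simp add: tens_comp)
  finally show ?thesis by (simp add: h ext_def[of "fst z'"])
qed

text \<open>Right linearity is tested on the epi \<open>bal y z \<triangleright> A\<close>. There
  \<open>ext_tens\<close> replaces the extension by a tensor product of two maps, and right
  linearity of the second one finishes the argument.\<close>

lemma transfer_arr_tens:
  assumes "transfer_arr y f y'" "transfer_arr z g z'"
  shows "transfer_arr (tobj y z) (bal y' z' \<cdot> (f \<otimes> g)) (tobj y' z')"
proof -
  note [simp] = transfer_arrD[OF assms(1)] transfer_arrD[OF assms(2)] act_tobj_arr
  let ?F = "ext (fst y') f" and ?G = "ext (fst z') g"
  let ?H = "ext (fst y' \<boxtimes> fst z') (bal y' z' \<cdot> (f \<otimes> g))"
  have "?H \<cdot> act (tobj y z) = act (tobj y' z') \<cdot> (?H \<triangleright> A)"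
  proof (rule epiD)
    show "epi C (bal y z \<triangleright> A)" using epi_act[of y "fst z \<boxtimes> A"] by (simp add: bal_def)
    have "(?H \<cdot> act (tobj y z)) \<cdot> (bal y z \<triangleright> A) = (?H \<cdot> bal y z) \<cdot> ((A \<boxtimes> fst y) \<triangleleft> act z)"
      by (simp add: bal_right_linear)
    also have "\<dots> = bal y' z' \<cdot> (?F \<otimes> (?G \<cdot> act z))"
      unfolding ext_tens[OF assms] by (simp add: tens_comp)
    also have "\<dots> = (bal y' z' \<cdot> ((A \<boxtimes> fst y') \<triangleleft> act z')) \<cdot> (?F \<otimes> (?G \<triangleright> A))"
      unfolding transfer_arr_linear[OF assms(2)] by (simp add: tens_comp)
    also have "\<dots> = act (tobj y' z') \<cdot> ((bal y' z' \<cdot> (?F \<otimes> ?G)) \<triangleright> A)"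
      unfolding bal_right_linear[OF transfer_arrD(2)[OF assms(1)] transfer_arrD(2)[OF assms(2)], symmetric]
      by (simp flip: whisk_comp)
    also have "\<dots> = (act (tobj y' z') \<cdot> (?H \<triangleright> A)) \<cdot> (bal y z \<triangleright> A)"
      unfolding ext_tens[OF assms, symmetric] by (simp flip: whisk_comp)
    finally show "(?H \<cdot> act (tobj y z)) \<cdot> (bal y z \<triangleright> A) =
        (act (tobj y' z') \<cdot> (?H \<triangleright> A)) \<cdot> (bal y z \<triangleright> A)" .
  qed simp_all
  then show ?thesis by (simp add: transfer_arr_def hom_def)
qed

text \<open>Two ways to contract AYAZAW to AYZW. The equation is right linearity of
  \<open>bal y z\<close> tensored with W; the compatibility of the comparison arrows with the
  associator rests on it.\<close>

lemma bal_assoc: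
  assumes [simp]: "y \<in> TO" "z \<in> TO" "w \<in> TO"
  shows "bal (tobj y z) w \<cdot> (bal y z \<triangleright> (A \<boxtimes> fst w)) = bal y (tobj z w) \<cdot> ((A \<boxtimes> fst y) \<triangleleft> bal z w)"
proof -
  note [simp] = act_tobj_arr
  have "(act (tobj y z) \<cdot> (bal y z \<triangleright> A)) \<triangleright> fst w = (bal y z \<cdot> ((A \<boxtimes> fst y) \<triangleleft> act z)) \<triangleright> fst w"
    by (simp only: bal_right_linear[OF assms(1,2)])
  then show ?thesis by (simp add: bal_def flip: whisk_comp)
qed

section \<open>The unit object and the category of transfer morphisms\<close>

abbreviation tunit :: "('o, 'a) tr_obj" where
  "tunit \<equiv> transfer_unit C A"

lemma tunit_TO [simp]: "tunit \<in> TO" "fst tunit = \<one>" "snd tunit = Ide C A"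
  by (simp_all add: transfer_unit_def transfer_objs_def hom_def)

lemma act_tunit: "act tunit = m"
  by (simp add: act_def ext_def)

lemma tobj_strict:
  "y \<in> TO \<Longrightarrow> tobj tunit y = y" "y \<in> TO \<Longrightarrow> tobj y tunit = y"
  "\<lbrakk>y \<in> TO; z \<in> TO; w \<in> TO\<rbrakk> \<Longrightarrow> tobj (tobj y z) w = tobj y (tobj z w)"
  using TO_simps[of y] TO_simps[of z] TO_simps[of w]
  by (cases y; cases z; cases w; simp add: transfer_unit_def flip: whisk_comp)+

abbreviation "T \<equiv> transfer_cat C A m \<eta>"

lemma transfer_cat_simps [simp]:
  "Obj T = TO" "Arr T = transfer_arrs C A m \<eta>" "Dom T (y, f, z) = y" "Cod T (y, f, z) = z"
  "y \<boxtimes>\<^bsub>T\<^esub> z = tobj y z" "\<one>\<^bsub>T\<^esub> = tunit" "Assoc T y z w = Ide T (tobj (tobj y z) w)"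
  "LUnit T y = Ide T y" "RUnit T y = Ide T y" "Ide T y = (y, \<eta> \<triangleright> fst y, y)"
  by (cases y; simp add: transfer_cat_def)+

lemma hom_transfer_cat: "h \<in> hom T y z \<longleftrightarrow> (\<exists>f. h = (y, f, z) \<and> transfer_arr y f z)"
  by (cases h) (auto simp: hom_def transfer_arrs_iff)

lemma transfer_cat_comp:
  "\<lbrakk>transfer_arr x f y; transfer_arr y g z\<rbrakk> \<Longrightarrow> (y, g, z) \<cdot>\<^bsub>T\<^esub> (x, f, y) = (x, ext (fst z) g \<cdot> f, z)"
  using transfer_arrD[of x f y] transfer_arrD[of y g z] TO_simps(1)[of z]
  by (cases z) (simp add: transfer_cat_def ext_def)

lemma transfer_cat_tens:
  assumes "transfer_arr y f y'" "transfer_arr z g z'"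
  shows "(y, f, y') \<otimes>\<^bsub>T\<^esub> (z, g, z') = (tobj y z, bal y' z' \<cdot> (f \<otimes> g), tobj y' z')"
proof -
  obtain Y' \<phi> Z' \<omega> where [simp]: "y' = (Y', \<phi>)" "z' = (Z', \<omega>)" by (cases y'; cases z')
  note [simp] = transfer_arrD[OF assms(1), simplified] transfer_arrD[OF assms(2), simplified]
    TO_simps[OF transfer_arrD(2)[OF assms(1)], simplified] TO_simps[OF transfer_arrD(2)[OF assms(2)], simplified]
  show ?thesis by (simp add: transfer_cat_def bal_def act_def ext_def flip: whisk_comp)
qed

lemma category_transfer_cat: "category T"
proof
  fix f assume "f \<in> Arr T"
  then show "Dom T f \<in> Obj T \<and> Cod T f \<in> Obj T"
    by (cases f) (auto simp: transfer_arrs_iff dest: transfer_arrD)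
next
  fix y assume "y \<in> Obj T"
  then show "Ide T y \<in> hom T y y" by (simp add: hom_transfer_cat transfer_arr_ide)
next
  fix x y z f g assume "f \<in> hom T x y" "g \<in> hom T y z"
  then show "g \<cdot>\<^bsub>T\<^esub> f \<in> hom T x z"
    by (auto simp: hom_transfer_cat transfer_cat_comp transfer_arr_comp)
next
  fix x y f assume "f \<in> hom T x y"
  then obtain f' where f: "f = (x, f', y)" "transfer_arr x f' y" by (auto simp: hom_transfer_cat)
  note [simp] = transfer_arrD[OF f(2)]
  show "f \<cdot>\<^bsub>T\<^esub> Ide T x = f" "Ide T y \<cdot>\<^bsub>T\<^esub> f = f"
    using ext_unit[of f' "fst y"]
    by (simp_all add: f transfer_cat_comp[OF transfer_arr_ide] transfer_cat_comp[OF _ transfer_arr_ide] ext_ide)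
next
  fix w x y z f g h assume "f \<in> hom T w x" "g \<in> hom T x y" "h \<in> hom T y z"
  then obtain f' g' h' where f: "f = (w, f', x)" "transfer_arr w f' x"
    and g: "g = (x, g', y)" "transfer_arr x g' y" and h: "h = (y, h', z)" "transfer_arr y h' z"
    by (auto simp: hom_transfer_cat)
  note [simp] = transfer_arrD[OF f(2)] transfer_arrD[OF g(2)] transfer_arrD[OF h(2)]
  show "(h \<cdot>\<^bsub>T\<^esub> g) \<cdot>\<^bsub>T\<^esub> f = h \<cdot>\<^bsub>T\<^esub> (g \<cdot>\<^bsub>T\<^esub> f)"
    by (simp add: f(1) g(1) h(1) transfer_cat_comp[OF f(2) g(2)] transfer_cat_comp[OF g(2) h(2)]
        transfer_cat_comp[OF f(2) transfer_arr_comp[OF g(2) h(2)]]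
        transfer_cat_comp[OF transfer_arr_comp[OF f(2) g(2)] h(2)] ext_comp[of g' "fst y"])
qed

end

section \<open>Free bimodules and their tensor products\<close>

text \<open>Coflatness of A keeps \<open>q M N \<triangleright> A\<close> a coequalizer, so that
  right actions descend to tensor products, and makes AY left coflat whenever Y is. Here
  \<open>'a\<close> is the type of objects and \<open>'b\<close> the type of arrows.\<close>

locale coflat_algebra = algebra_in_category +
  fixes Q :: "'b \<Rightarrow> 'b \<Rightarrow> 'b"
  assumes coequalizers: "has_coequalizers C Q" and A_coflat: "left_coflat C A"
begin

abbreviation "BO \<equiv> bimod_objs C Q A m \<eta>"

definition free :: "('a, 'b) tr_obj \<Rightarrow> ('a, 'b) bimod" where
  "free y = coring_obj C A m (fst y) (snd y)"

lemma free_simps [simp]: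
  "und (free y) = A \<boxtimes> fst y" "lact (free y) = m \<triangleright> fst y" "ract (free y) = act y"
  by (simp_all add: free_def coring_obj_def act_def ext_def)

text \<open>\<open>N\<close> is a bimodule by transport along the isomorphism \<open>i\<close> from $AY$; this covers the iterated
  tensor products over \<open>A\<close>, which are not literally of the form \<open>free y\<close>.\<close>

definition free_iso :: "('a, 'b) tr_obj \<Rightarrow> ('a, 'b) bimod \<Rightarrow> 'b \<Rightarrow> 'b \<Rightarrow> bool" where
  "free_iso y N i j \<longleftrightarrow> y \<in> TO \<and> left_coflat C (fst y) \<and>
     i \<in> hom C (A \<boxtimes> fst y) (und N) \<and> j \<in> hom C (und N) (A \<boxtimes> fst y) \<and>
     j \<cdot> i = Ide C (A \<boxtimes> fst y) \<and> i \<cdot> j = Ide C (und N) \<and>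
     lact N \<in> hom C (A \<boxtimes> und N) (und N) \<and> ract N \<in> hom C (und N \<boxtimes> A) (und N) \<and>
     i \<cdot> (m \<triangleright> fst y) = lact N \<cdot> (A \<triangleleft> i) \<and> i \<cdot> act y = ract N \<cdot> (i \<triangleright> A)"

lemma free_isoD:
  assumes "free_iso y N i j"
  shows "y \<in> TO" "left_coflat C (fst y)" "i \<in> Arr C" "Dom C i = A \<boxtimes> fst y" "Cod C i = und N"
    "j \<in> Arr C" "Dom C j = und N" "Cod C j = A \<boxtimes> fst y" "und N \<in> Obj C"
    "lact N \<in> Arr C" "Dom C (lact N) = A \<boxtimes> und N" "Cod C (lact N) = und N"
    "ract N \<in> Arr C" "Dom C (ract N) = und N \<boxtimes> A" "Cod C (ract N) = und N"
    "j \<cdot> i = Ide C (A \<boxtimes> fst y)" "i \<cdot> j = Ide C (und N)"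
    "i \<cdot> (m \<triangleright> fst y) = lact N \<cdot> (A \<triangleleft> i)" "i \<cdot> act y = ract N \<cdot> (i \<triangleright> A)"
  using assms arr_dom_cod[of i] by (auto simp: free_iso_def hom_def)

lemma free_iso_inverse:
  assumes f: "free_iso y N i j"
  shows "j \<cdot> lact N = (m \<triangleright> fst y) \<cdot> (A \<triangleleft> j)" "j \<cdot> ract N = act y \<cdot> (j \<triangleright> A)"
proof -
  note [simp] = free_isoD(1,3-15)[OF f]
  note d = free_isoD[OF f]
  have "j \<cdot> lact N = j \<cdot> (lact N \<cdot> (A \<triangleleft> i)) \<cdot> (A \<triangleleft> j)" by (simp add: whisk_comp d(17))
  also have "\<dots> = (j \<cdot> i) \<cdot> (m \<triangleright> fst y) \<cdot> (A \<triangleleft> j)" unfolding d(18)[symmetric] by simp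
  finally show "j \<cdot> lact N = (m \<triangleright> fst y) \<cdot> (A \<triangleleft> j)" unfolding d(16) by simp
  have "j \<cdot> ract N = j \<cdot> (ract N \<cdot> (i \<triangleright> A)) \<cdot> (j \<triangleright> A)" by (simp add: whisk_comp d(17))
  also have "\<dots> = (j \<cdot> i) \<cdot> act y \<cdot> (j \<triangleright> A)" unfolding d(19)[symmetric] by simp
  finally show "j \<cdot> ract N = act y \<cdot> (j \<triangleright> A)" unfolding d(16) by simp
qed

lemma free_iso_acts:
  assumes f: "free_iso y N i j"
  shows "lact N = i \<cdot> (m \<triangleright> fst y) \<cdot> (A \<triangleleft> j)" "ract N = i \<cdot> act y \<cdot> (j \<triangleright> A)"
proof -
  note [simp] = free_isoD(1,3-15)[OF f]
  have "lact N = (i \<cdot> j) \<cdot> lact N" "ract N = (i \<cdot> j) \<cdot> ract N" by (simp_all only: free_isoD[OF f]) simp_all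
  then show "lact N = i \<cdot> (m \<triangleright> fst y) \<cdot> (A \<triangleleft> j)" "ract N = i \<cdot> act y \<cdot> (j \<triangleright> A)"
    by (simp_all add: free_iso_inverse[OF f])
qed

text \<open>\<open>free_iso\<close> prescribes only the types of the actions and their compatibility
  with \<open>i\<close>, which is all that can be read off for a tensor product. The actions are
  conjugates of those on AY, and so are the bimodule axioms.\<close>

lemma free_iso_bimodule:
  assumes f: "free_iso y N i j"
  shows "bimodule C A m \<eta> N"
proof -
  note [simp] = free_isoD(1,3-15)[OF f]
  note d = free_isoD[OF f] and inv = free_iso_inverse[OF f]
  let ?Y = "fst y" and ?l = "m \<triangleright> fst y"
  note [simp] = TO_simps[OF d(1)]
  have ll: "?l \<cdot> (A \<triangleleft> ?l) = ?l \<cdot> (m \<triangleright> (A \<boxtimes> ?Y))" by (simp add: mult_assoc_whisk)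
  have "lact N \<cdot> (A \<triangleleft> lact N) = i \<cdot> ?l \<cdot> (A \<triangleleft> (j \<cdot> lact N))"
    unfolding free_iso_acts(1)[OF f] by (simp flip: whisk_comp)
  also have "\<dots> = i \<cdot> (?l \<cdot> (A \<triangleleft> ?l)) \<cdot> ((A \<boxtimes> A) \<triangleleft> j)" unfolding inv by (simp flip: whisk_comp)
  also have "\<dots> = i \<cdot> ?l \<cdot> ((m \<triangleright> (A \<boxtimes> ?Y)) \<cdot> ((A \<boxtimes> A) \<triangleleft> j))" unfolding ll by simp
  also have "(m \<triangleright> (A \<boxtimes> ?Y)) \<cdot> ((A \<boxtimes> A) \<triangleleft> j) = (A \<triangleleft> j) \<cdot> (m \<triangleright> und N)" by (simp add: tens_comp)
  also have "i \<cdot> ?l \<cdot> \<dots> = lact N \<cdot> (m \<triangleright> und N)" unfolding free_iso_acts(1)[OF f] by simp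
  finally have 1: "lact N \<cdot> (A \<triangleleft> lact N) = lact N \<cdot> (m \<triangleright> und N)" .
  have "lact N \<cdot> (\<eta> \<triangleright> und N) = i \<cdot> ?l \<cdot> ((A \<triangleleft> j) \<cdot> (\<eta> \<triangleright> und N))"
    unfolding free_iso_acts(1)[OF f] by simp
  also have "(A \<triangleleft> j) \<cdot> (\<eta> \<triangleright> und N) = (\<eta> \<triangleright> (A \<boxtimes> ?Y)) \<cdot> (\<one> \<triangleleft> j)"
    by (simp add: tens_comp del: arr_strict(2))
  also have "i \<cdot> ?l \<cdot> \<dots> = i \<cdot> (?l \<cdot> (\<eta> \<triangleright> (A \<boxtimes> ?Y))) \<cdot> j" by simp
  finally have 2: "lact N \<cdot> (\<eta> \<triangleright> und N) = Ide C (und N)" by (simp add: mult_unit_whisk d)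
  have "ract N \<cdot> (ract N \<triangleright> A) = i \<cdot> act y \<cdot> ((j \<cdot> ract N) \<triangleright> A)"
    unfolding free_iso_acts(2)[OF f] by (simp flip: whisk_comp)
  also have "\<dots> = i \<cdot> (act y \<cdot> (act y \<triangleright> A)) \<cdot> (j \<triangleright> (A \<boxtimes> A))" unfolding inv by (simp flip: whisk_comp)
  also have "\<dots> = i \<cdot> act y \<cdot> (((A \<boxtimes> ?Y) \<triangleleft> m) \<cdot> (j \<triangleright> (A \<boxtimes> A)))"
    unfolding act_assoc[OF d(1), symmetric] by simp
  also have "((A \<boxtimes> ?Y) \<triangleleft> m) \<cdot> (j \<triangleright> (A \<boxtimes> A)) = (j \<triangleright> A) \<cdot> (und N \<triangleleft> m)" by (simp add: tens_comp)
  also have "i \<cdot> act y \<cdot> \<dots> = ract N \<cdot> (und N \<triangleleft> m)" unfolding free_iso_acts(2)[OF f] by simp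
  finally have 3: "ract N \<cdot> (ract N \<triangleright> A) = ract N \<cdot> (und N \<triangleleft> m)" .
  have "ract N \<cdot> (und N \<triangleleft> \<eta>) = i \<cdot> act y \<cdot> ((j \<triangleright> A) \<cdot> (und N \<triangleleft> \<eta>))"
    unfolding free_iso_acts(2)[OF f] by simp
  also have "(j \<triangleright> A) \<cdot> (und N \<triangleleft> \<eta>) = ((A \<boxtimes> ?Y) \<triangleleft> \<eta>) \<cdot> (j \<triangleright> \<one>)"
    by (simp add: tens_comp del: arr_strict(3))
  also have "i \<cdot> act y \<cdot> \<dots> = i \<cdot> (act y \<cdot> ((A \<boxtimes> ?Y) \<triangleleft> \<eta>)) \<cdot> j" by simp
  finally have 4: "ract N \<cdot> (und N \<triangleleft> \<eta>) = Ide C (und N)" by (simp add: act_unit d)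
  have "lact N \<cdot> (A \<triangleleft> ract N) = i \<cdot> ?l \<cdot> (A \<triangleleft> (j \<cdot> ract N))"
    unfolding free_iso_acts(1)[OF f] by (simp flip: whisk_comp)
  also have "\<dots> = i \<cdot> (?l \<cdot> (A \<triangleleft> act y)) \<cdot> (A \<triangleleft> (j \<triangleright> A))" unfolding inv by (simp flip: whisk_comp)
  also have "\<dots> = i \<cdot> act y \<cdot> ((?l \<cdot> (A \<triangleleft> j)) \<triangleright> A)"
    unfolding act_linear[OF d(1), symmetric] by (simp flip: whisk_comp)
  also have "\<dots> = ract N \<cdot> (lact N \<triangleright> A)"
    unfolding inv(1)[symmetric] free_iso_acts(2)[OF f] by (simp flip: whisk_comp)
  finally have 5: "lact N \<cdot> (A \<triangleleft> ract N) = ract N \<cdot> (lact N \<triangleright> A)" .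
  show ?thesis using 1 2 3 4 5
    by (simp add: bimodule_def left_module_def right_module_def hom_def)
qed

text \<open>Tensoring over \<open>A\<close> with a free left module is a split coequalizer, hence preserved by every
  functor; this is where robustness comes from.\<close>

lemma free_tensor_split:
  assumes f: "free_iso y N i j" and Z: "right_module C A m \<eta> Z \<mu>"
  defines "r \<equiv> (\<mu> \<triangleright> fst y) \<cdot> (Z \<triangleleft> j)" and "u \<equiv> i \<cdot> (\<eta> \<triangleright> fst y)"
  shows "\<mu> \<triangleright> und N \<in> hom C (Z \<boxtimes> (A \<boxtimes> und N)) (Z \<boxtimes> und N)"
    "Z \<triangleleft> lact N \<in> hom C (Z \<boxtimes> (A \<boxtimes> und N)) (Z \<boxtimes> und N)"
    "r \<in> hom C (Z \<boxtimes> und N) (Z \<boxtimes> fst y)"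
    "Z \<triangleleft> u \<in> hom C (Z \<boxtimes> fst y) (Z \<boxtimes> und N)"
    "((Z \<boxtimes> A) \<triangleleft> u) \<cdot> (Z \<triangleleft> j) \<in> hom C (Z \<boxtimes> und N) (Z \<boxtimes> (A \<boxtimes> und N))"
    "r \<cdot> (\<mu> \<triangleright> und N) = r \<cdot> (Z \<triangleleft> lact N)" "r \<cdot> (Z \<triangleleft> u) = Ide C (Z \<boxtimes> fst y)"
    "(Z \<triangleleft> lact N) \<cdot> ((Z \<boxtimes> A) \<triangleleft> u) \<cdot> (Z \<triangleleft> j) = Ide C (Z \<boxtimes> und N)"
    "(\<mu> \<triangleright> und N) \<cdot> ((Z \<boxtimes> A) \<triangleleft> u) \<cdot> (Z \<triangleleft> j) = (Z \<triangleleft> u) \<cdot> r"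
proof -
  note [simp] = free_isoD(1,3-15)[OF f] TO_simps[OF free_isoD(1)[OF f]]
  note d = free_isoD[OF f] and inv = free_iso_inverse[OF f]
  have [simp]: "Z \<in> Obj C" "\<mu> \<in> Arr C" "Dom C \<mu> = Z \<boxtimes> A" "Cod C \<mu> = Z"
    and Zm: "\<mu> \<cdot> (Z \<triangleleft> m) = \<mu> \<cdot> (\<mu> \<triangleright> A)" "\<mu> \<cdot> (Z \<triangleleft> \<eta>) = Ide C Z"
    using Z by (auto simp: right_module_def hom_def)
  \<comment> \<open>\<open>u\<close> includes the generators Y into N, and \<open>r\<close> lets the
    coefficients of N act on Z. The conclusions are ordered as the premises of
    \<open>split_coequalizer\<close>.\<close>
  have [simp]: "u \<in> Arr C" "Dom C u = fst y" "Cod C u = und N" by (simp_all add: u_def)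
  show "\<mu> \<triangleright> und N \<in> hom C (Z \<boxtimes> (A \<boxtimes> und N)) (Z \<boxtimes> und N)"
    "Z \<triangleleft> lact N \<in> hom C (Z \<boxtimes> (A \<boxtimes> und N)) (Z \<boxtimes> und N)"
    "r \<in> hom C (Z \<boxtimes> und N) (Z \<boxtimes> fst y)"
    "Z \<triangleleft> u \<in> hom C (Z \<boxtimes> fst y) (Z \<boxtimes> und N)"
    "((Z \<boxtimes> A) \<triangleleft> u) \<cdot> (Z \<triangleleft> j) \<in> hom C (Z \<boxtimes> und N) (Z \<boxtimes> (A \<boxtimes> und N))"
    by (simp_all add: r_def hom_def)
  have "r \<cdot> (\<mu> \<triangleright> und N) = (\<mu> \<triangleright> fst y) \<cdot> ((Z \<triangleleft> j) \<cdot> (\<mu> \<triangleright> und N))" by (simp add: r_def)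
  also have "(Z \<triangleleft> j) \<cdot> (\<mu> \<triangleright> und N) = (\<mu> \<triangleright> (A \<boxtimes> fst y)) \<cdot> ((Z \<boxtimes> A) \<triangleleft> j)" by (simp add: tens_comp)
  also have "(\<mu> \<triangleright> fst y) \<cdot> \<dots> = ((\<mu> \<cdot> (\<mu> \<triangleright> A)) \<triangleright> fst y) \<cdot> ((Z \<boxtimes> A) \<triangleleft> j)" by (simp flip: whisk_comp)
  also have "\<dots> = (\<mu> \<triangleright> fst y) \<cdot> (Z \<triangleleft> ((m \<triangleright> fst y) \<cdot> (A \<triangleleft> j)))"
    unfolding Zm(1)[symmetric] by (simp flip: whisk_comp)
  also have "\<dots> = r \<cdot> (Z \<triangleleft> lact N)" unfolding inv(1)[symmetric] by (simp add: r_def flip: whisk_comp)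
  finally show "r \<cdot> (\<mu> \<triangleright> und N) = r \<cdot> (Z \<triangleleft> lact N)" .
  have "r \<cdot> (Z \<triangleleft> u) = (\<mu> \<triangleright> fst y) \<cdot> (Z \<triangleleft> ((j \<cdot> i) \<cdot> (\<eta> \<triangleright> fst y)))"
    by (simp add: r_def u_def flip: whisk_comp)
  also have "\<dots> = (\<mu> \<cdot> (Z \<triangleleft> \<eta>)) \<triangleright> fst y" unfolding d(16) by (simp flip: whisk_comp)
  finally show "r \<cdot> (Z \<triangleleft> u) = Ide C (Z \<boxtimes> fst y)" by (simp add: Zm)
  \<comment> \<open>Letting A act on the generators recovers all of \<open>i\<close>; this is what
    splits the second arrow of the pair.\<close>
  have "lact N \<cdot> (A \<triangleleft> u) = (lact N \<cdot> (A \<triangleleft> i)) \<cdot> (A \<triangleleft> (\<eta> \<triangleright> fst y))"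
    by (simp add: u_def flip: whisk_comp)
  also have "\<dots> = i \<cdot> ((m \<triangleright> fst y) \<cdot> (A \<triangleleft> (\<eta> \<triangleright> fst y)))" unfolding d(18)[symmetric] by simp
  also have "\<dots> = i" by (simp only: mult_unit_whisk TO_simps[OF d(1)]) simp
  finally have lu: "lact N \<cdot> (A \<triangleleft> u) = i" .
  have "(Z \<triangleleft> lact N) \<cdot> ((Z \<boxtimes> A) \<triangleleft> u) \<cdot> (Z \<triangleleft> j) = Z \<triangleleft> ((lact N \<cdot> (A \<triangleleft> u)) \<cdot> j)" by (simp flip: whisk_comp)
  then show "(Z \<triangleleft> lact N) \<cdot> ((Z \<boxtimes> A) \<triangleleft> u) \<cdot> (Z \<triangleleft> j) = Ide C (Z \<boxtimes> und N)"
    unfolding lu by (simp add: d(17))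
  have "(\<mu> \<triangleright> und N) \<cdot> ((Z \<boxtimes> A) \<triangleleft> u) \<cdot> (Z \<triangleleft> j) = ((\<mu> \<triangleright> und N) \<cdot> ((Z \<boxtimes> A) \<triangleleft> u)) \<cdot> (Z \<triangleleft> j)" by simp
  also have "(\<mu> \<triangleright> und N) \<cdot> ((Z \<boxtimes> A) \<triangleleft> u) = (Z \<triangleleft> u) \<cdot> (\<mu> \<triangleright> fst y)" by (simp add: tens_comp)
  finally show "(\<mu> \<triangleright> und N) \<cdot> ((Z \<boxtimes> A) \<triangleleft> u) \<cdot> (Z \<triangleleft> j) = (Z \<triangleleft> u) \<cdot> r" by (simp add: r_def)
qed

lemma tens_map_coequalizer:
  assumes "left_module C A m \<eta> Y \<nu>" "right_module C A m \<eta> Z \<mu>"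
  shows "is_coequalizer C (\<mu> \<triangleright> Y) (Z \<triangleleft> \<nu>) (tens_map C Q Z \<mu> Y \<nu>)"
proof -
  have "parallel_pair C (\<mu> \<triangleright> Y) (Z \<triangleleft> \<nu>)"
    using assms by (auto simp: left_module_def right_module_def hom_def parallel_pair_def)
  then show ?thesis using coequalizers by (simp add: has_coequalizers_def tens_map_def)
qed

text \<open>The split coequalizer of \<open>free_tensor_split\<close> survives tensoring with W, and
  the chosen coequalizer map differs from it by an isomorphism, which survives as well: this is
  robustness. Coflatness is inherited from AY.\<close>

lemma free_iso_BO:
  assumes f: "free_iso y N i j"
  shows "N \<in> BO"
proof -
  note d = free_isoD[OF f]
  note b = free_iso_bimodule[OF f]
  then have lm: "left_module C A m \<eta> (und N) (lact N)" by (simp add: bimodule_def)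
  have "left_coflat C (und N)"
    by (rule left_coflat_iso[OF left_coflat_tens[OF A_coflat d(2)]]) (use d in \<open>auto simp: hom_def\<close>)
  moreover have "robust C Q A m \<eta> (und N) (lact N)"
    unfolding robust_def
  proof (intro conjI allI impI)
    fix W Z \<mu> assume "W \<in> Obj C \<and> right_module C A m \<eta> Z \<mu>"
    then have [simp]: "W \<in> Obj C" and Z: "right_module C A m \<eta> Z \<mu>" by auto
    note s = free_tensor_split[OF f Z] and t = tens_map_coequalizer[OF lm Z]
    let ?r = "(\<mu> \<triangleright> fst y) \<cdot> (Z \<triangleleft> j)" and ?q = "tens_map C Q Z \<mu> (und N) (lact N)"
    note c = split_coequalizer[OF s]
    have [simp]: "Cod C ?r = Z \<boxtimes> fst y" "Dom C ?r = Z \<boxtimes> und N" "?r \<in> Arr C"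
      using s(3) by (auto simp: hom_def)
    note u1 = coequalizer_unique[OF c t] and u2 = coequalizer_unique[OF t c]
    have [simp]: "Z \<in> Obj C" using Z by (simp add: right_module_def)
    note [simp] = coequalizer_eqs(3)[OF t] TO_simps(1)[OF d(1)]
      u1(1)[unfolded hom_def, simplified] u2(1)[unfolded hom_def, simplified]
    have "is_coequalizer C (W \<triangleleft> (\<mu> \<triangleright> und N)) (W \<triangleleft> (Z \<triangleleft> lact N)) ((W \<triangleleft> factor C ?q ?r) \<cdot> (W \<triangleleft> ?r))"
      by (rule coequalizer_iso_comp[where k = "W \<triangleleft> factor C ?q ?r" and l = "W \<triangleleft> factor C ?r ?q"
            and T = "W \<boxtimes> Cod C ?q", OF whisk_split_coequalizer[OF s]])
        (simp_all add: hom_def whisk_comp u1(3) u2(3))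
    then show "is_coequalizer C (W \<triangleleft> (\<mu> \<triangleright> und N)) (W \<triangleleft> (Z \<triangleleft> lact N)) (W \<triangleleft> ?q)"
      unfolding whisk_comp(1)[of ?r "factor C ?q ?r" W, simplified] u1(2) .
  qed (rule lm)
  ultimately show ?thesis using b by (simp add: bimod_objs_def)
qed

section \<open>Tensor products over A and their actions\<close>

abbreviation "q \<equiv> bimod_q C Q"
abbreviation "bt \<equiv> bimod_tobj C Q A"

lemma BO_simps [simp]:
  assumes "N \<in> BO"
  shows "und N \<in> Obj C" "lact N \<in> Arr C" "Dom C (lact N) = A \<boxtimes> und N" "Cod C (lact N) = und N"
    "ract N \<in> Arr C" "Dom C (ract N) = und N \<boxtimes> A" "Cod C (ract N) = und N"
  using assms by (auto simp: bimod_objs_def bimodule_def left_module_def right_module_def hom_def)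

lemma BO_bimodule: "N \<in> BO \<Longrightarrow> lact N \<cdot> (A \<triangleleft> ract N) = ract N \<cdot> (lact N \<triangleright> A)"
  by (auto simp: bimod_objs_def bimodule_def)

lemma q_coequalizer:
  "\<lbrakk>M \<in> BO; N \<in> BO\<rbrakk> \<Longrightarrow> is_coequalizer C (ract M \<triangleright> und N) (und M \<triangleleft> lact N) (q M N)"
  unfolding bimod_q_def by (rule tens_map_coequalizer) (auto simp: bimod_objs_def bimodule_def)

lemma whisk_q_coequalizer:
  "\<lbrakk>M \<in> BO; N \<in> BO; W \<in> Obj C\<rbrakk> \<Longrightarrow>
     is_coequalizer C (W \<triangleleft> (ract M \<triangleright> und N)) (W \<triangleleft> (und M \<triangleleft> lact N)) (W \<triangleleft> q M N)"
  unfolding bimod_q_def bimod_objs_def robust_def bimodule_def by blast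

lemma q_whisk_coequalizer:
  "\<lbrakk>M \<in> BO; N \<in> BO; left_coflat C W\<rbrakk> \<Longrightarrow>
     is_coequalizer C ((ract M \<triangleright> und N) \<triangleright> W) ((und M \<triangleleft> lact N) \<triangleright> W) (q M N \<triangleright> W)"
  by (rule left_coflatD[OF _ q_coequalizer])

lemma und_bt [simp]: "und (bt M N) = Cod C (q M N)"
  by (simp add: bimod_tobj_def)

lemma q_arr [simp]:
  assumes "M \<in> BO" "N \<in> BO"
  shows "q M N \<in> Arr C" "Dom C (q M N) = und M \<boxtimes> und N"
  using coequalizer_eqs[OF q_coequalizer[OF assms]] assms by simp_all

lemma q_balanced:
  "\<lbrakk>M \<in> BO; N \<in> BO\<rbrakk> \<Longrightarrow> q M N \<cdot> (ract M \<triangleright> und N) = q M N \<cdot> (und M \<triangleleft> lact N)"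
  by (rule coequalizer_eqs(7)[OF q_coequalizer])

lemma q_epi:
  assumes "M \<in> BO" "N \<in> BO"
  shows "epi C (q M N)" "W \<in> Obj C \<Longrightarrow> epi C (W \<triangleleft> q M N)" "left_coflat C W \<Longrightarrow> epi C (q M N \<triangleright> W)"
  using coequalizer_epi[OF q_coequalizer] coequalizer_epi[OF whisk_q_coequalizer]
    coequalizer_epi[OF q_whisk_coequalizer] assms by blast+

text \<open>\<open>A \<triangleleft> q M N\<close> is a coequalizer because \<open>N\<close> is
  robust. The left action of \<open>M\<close> passes to it since it commutes with the right action
  of \<open>M\<close>.\<close>

lemma bt_lact:
  assumes [simp]: "M \<in> BO" "N \<in> BO"
  shows "lact (bt M N) \<in> Arr C" "Dom C (lact (bt M N)) = A \<boxtimes> Cod C (q M N)"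
    "Cod C (lact (bt M N)) = Cod C (q M N)"
    "lact (bt M N) \<cdot> (A \<triangleleft> q M N) = q M N \<cdot> (lact M \<triangleright> und N)"
proof -
  let ?h = "q M N \<cdot> (lact M \<triangleright> und N)"
  have "?h \<cdot> (A \<triangleleft> (ract M \<triangleright> und N)) = q M N \<cdot> ((lact M \<cdot> (A \<triangleleft> ract M)) \<triangleright> und N)"
    by (simp flip: whisk_comp)
  also have "\<dots> = (q M N \<cdot> (ract M \<triangleright> und N)) \<cdot> (lact M \<triangleright> (A \<boxtimes> und N))"
    unfolding BO_bimodule[OF assms(1)] by (simp flip: whisk_comp)
  also have "\<dots> = ?h \<cdot> (A \<triangleleft> (und M \<triangleleft> lact N))"
    unfolding q_balanced[OF assms] by (simp add: tens_comp)
  finally have *: "?h \<cdot> (A \<triangleleft> (ract M \<triangleright> und N)) = ?h \<cdot> (A \<triangleleft> (und M \<triangleleft> lact N))" .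
  show "lact (bt M N) \<in> Arr C" "Dom C (lact (bt M N)) = A \<boxtimes> Cod C (q M N)"
    "Cod C (lact (bt M N)) = Cod C (q M N)"
    "lact (bt M N) \<cdot> (A \<triangleleft> q M N) = q M N \<cdot> (lact M \<triangleright> und N)"
    using coequalizer_factor[OF whisk_q_coequalizer _ _ *] by (auto simp: bimod_tobj_def hom_def)
qed

text \<open>\<open>q M N \<triangleright> A\<close> is a coequalizer because A is left coflat. The
  right action of \<open>N\<close> passes to it since it commutes with the left action of
  \<open>N\<close>.\<close>

lemma bt_ract:
  assumes [simp]: "M \<in> BO" "N \<in> BO"
  shows "ract (bt M N) \<in> Arr C" "Dom C (ract (bt M N)) = Cod C (q M N) \<boxtimes> A"
    "Cod C (ract (bt M N)) = Cod C (q M N)"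
    "ract (bt M N) \<cdot> (q M N \<triangleright> A) = q M N \<cdot> (und M \<triangleleft> ract N)"
proof -
  let ?h = "q M N \<cdot> (und M \<triangleleft> ract N)"
  have "?h \<cdot> ((ract M \<triangleright> und N) \<triangleright> A) = (q M N \<cdot> (ract M \<triangleright> und N)) \<cdot> ((und M \<boxtimes> A) \<triangleleft> ract N)"
    by (simp add: tens_comp)
  also have "\<dots> = q M N \<cdot> (und M \<triangleleft> (lact N \<cdot> (A \<triangleleft> ract N)))"
    unfolding q_balanced[OF assms] by (simp flip: whisk_comp)
  also have "\<dots> = ?h \<cdot> ((und M \<triangleleft> lact N) \<triangleright> A)"
    unfolding BO_bimodule[OF assms(2)] by (simp flip: whisk_comp)
  finally have *: "?h \<cdot> ((ract M \<triangleright> und N) \<triangleright> A) = ?h \<cdot> ((und M \<triangleleft> lact N) \<triangleright> A)" .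
  show "ract (bt M N) \<in> Arr C" "Dom C (ract (bt M N)) = Cod C (q M N) \<boxtimes> A"
    "Cod C (ract (bt M N)) = Cod C (q M N)"
    "ract (bt M N) \<cdot> (q M N \<triangleright> A) = q M N \<cdot> (und M \<triangleleft> ract N)"
    using coequalizer_factor[OF q_whisk_coequalizer[OF assms A_coflat] _ _ *]
    by (auto simp: bimod_tobj_def hom_def)
qed

text \<open>Following the split coequalizer of \<open>free_tensor_split\<close> by \<open>j\<close>
  on the left factor gives \<open>bal y z \<cdot> (j \<otimes> j')\<close>, a second coequalizer of
  the pair belonging to \<open>q M N\<close>; \<open>I\<close> is the comparison isomorphism, and
  its linearity is tested on epis built from \<open>bal\<close>. As \<open>M\<close> and
  \<open>N\<close> are only isomorphic to free bimodules, the result can be iterated.\<close>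

lemma free_iso_tens:
  assumes M: "free_iso y M i j" and N: "free_iso z N i' j'"
  obtains I I' where "free_iso (tobj y z) (bt M N) I I'" "I \<cdot> bal y z = q M N \<cdot> (i \<otimes> i')"
proof -
  note d = free_isoD[OF M] and e = free_isoD[OF N]
  note BO [simp] = free_iso_BO[OF M] free_iso_BO[OF N]
  have [simp]: "y \<in> TO" "z \<in> TO" by (fact d(1) e(1))+
  note [simp] = d(3-8) e(3-8) act_tobj_arr bt_lact(1-3) bt_ract(1-3)
  have Z: "right_module C A m \<eta> (und M) (ract M)"
    using BO(1) by (simp add: bimod_objs_def bimodule_def)
  let ?r = "(ract M \<triangleright> fst z) \<cdot> (und M \<triangleleft> j')" and ?p = "bal y z \<cdot> (j \<otimes> j')"
  have "(j \<triangleright> fst z) \<cdot> ?r = ((j \<cdot> ract M) \<triangleright> fst z) \<cdot> (und M \<triangleleft> j')" by (simp flip: whisk_comp)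
  also have "\<dots> = bal y z \<cdot> ((j \<triangleright> (A \<boxtimes> fst z)) \<cdot> (und M \<triangleleft> j'))"
    unfolding free_iso_inverse[OF M] by (simp add: bal_def flip: whisk_comp)
  also have "\<dots> = ?p" by (simp add: tens_comp)
  finally have jr: "(j \<triangleright> fst z) \<cdot> ?r = ?p" .
  have "is_coequalizer C (ract M \<triangleright> und N) (und M \<triangleleft> lact N) ((j \<triangleright> fst z) \<cdot> ?r)"
    by (rule coequalizer_iso_comp[OF split_coequalizer[OF free_tensor_split[OF N Z]],
          where T = "A \<boxtimes> (fst y \<boxtimes> fst z)" and l = "i \<triangleright> fst z"])
      (simp_all add: hom_def whisk_comp d(16,17))
  then have p: "is_coequalizer C (ract M \<triangleright> und N) (und M \<triangleleft> lact N) ?p" unfolding jr .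
  note qc = q_coequalizer[OF BO]
  define I I' where "I = factor C (q M N) ?p" and "I' = factor C ?p (q M N)"
  note u = coequalizer_unique[OF p qc, folded I_def I'_def]
    and u' = coequalizer_unique[OF qc p, folded I_def I'_def]
  note [simp] = u(1)[unfolded hom_def, simplified] u'(1)[unfolded hom_def, simplified]
  have "I \<cdot> bal y z = (I \<cdot> ?p) \<cdot> (i \<otimes> i')" by (simp add: tens_comp d(16) e(16))
  then have I: "I \<cdot> bal y z = q M N \<cdot> (i \<otimes> i')" unfolding u(2) .
  have "I \<cdot> (m \<triangleright> (fst y \<boxtimes> fst z)) = lact (bt M N) \<cdot> (A \<triangleleft> I)"
  proof (rule epiD)
    show "epi C (A \<triangleleft> bal y z)"
      by (rule split_epi[of _ _ _ "A \<triangleleft> ((A \<boxtimes> fst y) \<triangleleft> (\<eta> \<triangleright> fst z))"])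
        (simp_all add: hom_def bal_def whisk_comp bal_split del: ide_tens_ide_tens)
    have "(I \<cdot> (m \<triangleright> (fst y \<boxtimes> fst z))) \<cdot> (A \<triangleleft> bal y z) =
        (I \<cdot> bal y z) \<cdot> (m \<triangleright> (fst y \<boxtimes> (A \<boxtimes> fst z)))" by (simp add: bal_linear)
    also have "\<dots> = q M N \<cdot> ((i \<cdot> (m \<triangleright> fst y)) \<otimes> i')"
      unfolding I using tens_comp[of "m \<triangleright> fst y" i "Ide C (A \<boxtimes> fst z)" i'] by simp
    also have "\<dots> = (q M N \<cdot> (lact M \<triangleright> und N)) \<cdot> (A \<triangleleft> (i \<otimes> i'))"
      unfolding d(18) using tens_comp[of "A \<triangleleft> i" "lact M" i' "Ide C (und N)"] by simp
    also have "\<dots> = lact (bt M N) \<cdot> (A \<triangleleft> (I \<cdot> bal y z))"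
      unfolding bt_lact(4)[OF BO, symmetric] I by (simp flip: whisk_comp)
    finally show "(I \<cdot> (m \<triangleright> (fst y \<boxtimes> fst z))) \<cdot> (A \<triangleleft> bal y z) =
        (lact (bt M N) \<cdot> (A \<triangleleft> I)) \<cdot> (A \<triangleleft> bal y z)" by (simp flip: whisk_comp)
  qed simp_all
  moreover have "I \<cdot> act (tobj y z) = ract (bt M N) \<cdot> (I \<triangleright> A)"
  proof (rule epiD)
    show "epi C (bal y z \<triangleright> A)" using epi_act[of y "fst z \<boxtimes> A"] by (simp add: bal_def)
    have "(I \<cdot> act (tobj y z)) \<cdot> (bal y z \<triangleright> A) = (I \<cdot> bal y z) \<cdot> ((A \<boxtimes> fst y) \<triangleleft> act z)"
      by (simp add: bal_right_linear)
    also have "\<dots> = q M N \<cdot> (i \<otimes> (i' \<cdot> act z))" unfolding I by (simp add: tens_comp)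
    also have "\<dots> = (q M N \<cdot> (und M \<triangleleft> ract N)) \<cdot> ((i \<otimes> i') \<triangleright> A)"
      unfolding e(19) by (simp add: tens_comp)
    also have "\<dots> = ract (bt M N) \<cdot> ((I \<cdot> bal y z) \<triangleright> A)"
      unfolding bt_ract(4)[OF BO, symmetric] I by (simp flip: whisk_comp)
    finally show "(I \<cdot> act (tobj y z)) \<cdot> (bal y z \<triangleright> A) =
        (ract (bt M N) \<cdot> (I \<triangleright> A)) \<cdot> (bal y z \<triangleright> A)" by (simp flip: whisk_comp)
  qed simp_all
  ultimately have "free_iso (tobj y z) (bt M N) I I'"
    using u'(3) u(3) left_coflat_tens[OF d(2) e(2)] by (simp add: free_iso_def hom_def)
  then show thesis using I that by blast
qed

text \<open>The class \<open>K\<close> of the embedding. Unlike the bimodules literally of the form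
  \<open>free y\<close>, those isomorphic to them are closed under the chosen tensor
  product.\<close>

definition free_bimods :: "('a, 'b) bimod set" where
  "free_bimods = {N. \<exists>y i j. free_iso y N i j}"

lemma free_bimods_BO [simp]: "N \<in> free_bimods \<Longrightarrow> N \<in> BO"
  using free_iso_BO by (auto simp: free_bimods_def)

lemma free_bimods_tens [simp]:
  assumes "M \<in> free_bimods" "N \<in> free_bimods"
  shows "bt M N \<in> free_bimods"
proof -
  obtain y i j z i' j' where "free_iso y M i j" "free_iso z N i' j'"
    using assms by (auto simp: free_bimods_def)
  then obtain I I' where "free_iso (tobj y z) (bt M N) I I'" by (rule free_iso_tens)
  then show ?thesis unfolding free_bimods_def by blast
qed

lemma free_iso_free:
  "\<lbrakk>y \<in> TO; left_coflat C (fst y)\<rbrakk> \<Longrightarrow> free_iso y (free y) (Ide C (A \<boxtimes> fst y)) (Ide C (A \<boxtimes> fst y))"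
  by (simp add: free_iso_def hom_def)

section \<open>Bilinear maps and their tensor products\<close>

abbreviation "BA \<equiv> bimod_arrs C Q A m \<eta>"

lemma BA_iff: "(M, f, N) \<in> BA \<longleftrightarrow> M \<in> BO \<and> N \<in> BO \<and> f \<in> hom C (und M) (und N) \<and>
    f \<cdot> lact M = lact N \<cdot> (A \<triangleleft> f) \<and> f \<cdot> ract M = ract N \<cdot> (f \<triangleright> A)"
  by (simp add: bimod_arrs_def)

lemma BA_D:
  assumes "(M, f, N) \<in> BA"
  shows "M \<in> BO" "N \<in> BO" "f \<in> Arr C" "Dom C f = und M" "Cod C f = und N"
    "f \<cdot> lact M = lact N \<cdot> (A \<triangleleft> f)" "f \<cdot> ract M = ract N \<cdot> (f \<triangleright> A)"
  using assms by (auto simp: BA_iff hom_def)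

definition tens_und ::
    "('a, 'b) bimod \<Rightarrow> 'b \<Rightarrow> ('a, 'b) bimod \<Rightarrow> ('a, 'b) bimod \<Rightarrow> 'b \<Rightarrow> ('a, 'b) bimod \<Rightarrow> 'b" where
  "tens_und M f M' N g N' = factor C (q M' N' \<cdot> (f \<otimes> g)) (q M N)"

text \<open>Right linearity of \<open>f\<close> and left linearity of \<open>g\<close> let the
  middle A pass from one factor to the other, so their tensor product descends. Compatibility with
  the actions is tested on the epis \<open>A \<triangleleft> q M N\<close> and
  \<open>q M N \<triangleright> A\<close>.\<close>

lemma tens_und:
  assumes f: "(M, f, M') \<in> BA" and g: "(N, g, N') \<in> BA"
  defines "k \<equiv> tens_und M f M' N g N'"
  shows "k \<in> Arr C" "Dom C k = Cod C (q M N)" "Cod C k = Cod C (q M' N')"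
    "k \<cdot> q M N = q M' N' \<cdot> (f \<otimes> g)"
    "k \<cdot> lact (bt M N) = lact (bt M' N') \<cdot> (A \<triangleleft> k)"
    "k \<cdot> ract (bt M N) = ract (bt M' N') \<cdot> (k \<triangleright> A)"
proof -
  note [simp] = BA_D(1-5)[OF f] BA_D(1-5)[OF g] bt_lact(1-3) bt_ract(1-3)
  note BO = BA_D(1)[OF f] BA_D(1)[OF g] and BO' = BA_D(2)[OF f] BA_D(2)[OF g]
  have "(q M' N' \<cdot> (f \<otimes> g)) \<cdot> (ract M \<triangleright> und N) = q M' N' \<cdot> ((f \<cdot> ract M) \<otimes> g)"
    by (simp add: tens_comp)
  also have "\<dots> = (q M' N' \<cdot> (ract M' \<triangleright> und N')) \<cdot> (f \<otimes> (A \<triangleleft> g))"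
    unfolding BA_D(7)[OF f] using tens_comp[of "f \<triangleright> A" "ract M'" g "Ide C (und N')"] by simp
  also have "\<dots> = q M' N' \<cdot> (f \<otimes> (g \<cdot> lact N))"
    unfolding q_balanced[OF BO'] BA_D(6)[OF g] by (simp add: tens_comp)
  also have "\<dots> = (q M' N' \<cdot> (f \<otimes> g)) \<cdot> (und M \<triangleleft> lact N)" by (simp add: tens_comp)
  finally have *: "(q M' N' \<cdot> (f \<otimes> g)) \<cdot> (ract M \<triangleright> und N) = (q M' N' \<cdot> (f \<otimes> g)) \<cdot> (und M \<triangleleft> lact N)" .
  note c = coequalizer_factor[OF q_coequalizer[OF BO] _ _ *, folded tens_und_def k_def, simplified]
  show k [simp]: "k \<in> Arr C" "Dom C k = Cod C (q M N)" "Cod C k = Cod C (q M' N')"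
    and kq: "k \<cdot> q M N = q M' N' \<cdot> (f \<otimes> g)"
    using c by (auto simp: hom_def)
  show "k \<cdot> lact (bt M N) = lact (bt M' N') \<cdot> (A \<triangleleft> k)"
  proof (rule epiD[OF q_epi(2)[OF BO, of A]])
    have "(k \<cdot> lact (bt M N)) \<cdot> (A \<triangleleft> q M N) = (k \<cdot> q M N) \<cdot> (lact M \<triangleright> und N)" by (simp add: bt_lact(4))
    also have "\<dots> = q M' N' \<cdot> ((f \<cdot> lact M) \<otimes> g)" unfolding kq by (simp add: tens_comp)
    also have "\<dots> = (q M' N' \<cdot> (lact M' \<triangleright> und N')) \<cdot> (A \<triangleleft> (f \<otimes> g))"
      unfolding BA_D(6)[OF f] using tens_comp[of "A \<triangleleft> f" "lact M'" g "Ide C (und N')"] by simp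
    also have "\<dots> = lact (bt M' N') \<cdot> (A \<triangleleft> (k \<cdot> q M N))"
      unfolding bt_lact(4)[OF BO', symmetric] kq by (simp flip: whisk_comp)
    finally show "(k \<cdot> lact (bt M N)) \<cdot> (A \<triangleleft> q M N) = (lact (bt M' N') \<cdot> (A \<triangleleft> k)) \<cdot> (A \<triangleleft> q M N)"
      by (simp flip: whisk_comp)
  qed simp_all
  show "k \<cdot> ract (bt M N) = ract (bt M' N') \<cdot> (k \<triangleright> A)"
  proof (rule epiD[OF q_epi(3)[OF BO A_coflat]])
    have "(k \<cdot> ract (bt M N)) \<cdot> (q M N \<triangleright> A) = (k \<cdot> q M N) \<cdot> (und M \<triangleleft> ract N)" by (simp add: bt_ract(4))
    also have "\<dots> = q M' N' \<cdot> (f \<otimes> (g \<cdot> ract N))" unfolding kq by (simp add: tens_comp)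
    also have "\<dots> = (q M' N' \<cdot> (und M' \<triangleleft> ract N')) \<cdot> ((f \<otimes> g) \<triangleright> A)"
      unfolding BA_D(7)[OF g] by (simp add: tens_comp)
    also have "\<dots> = ract (bt M' N') \<cdot> ((k \<cdot> q M N) \<triangleright> A)"
      unfolding bt_ract(4)[OF BO', symmetric] kq by (simp flip: whisk_comp)
    finally show "(k \<cdot> ract (bt M N)) \<cdot> (q M N \<triangleright> A) = (ract (bt M' N') \<cdot> (k \<triangleright> A)) \<cdot> (q M N \<triangleright> A)"
      by (simp flip: whisk_comp)
  qed simp_all
qed

lemma tens_undI:
  assumes "(M, f, M') \<in> BA" "(N, g, N') \<in> BA" "k \<in> Arr C" "Dom C k = Cod C (q M N)"
    "k \<cdot> q M N = q M' N' \<cdot> (f \<otimes> g)"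
  shows "tens_und M f M' N g N' = k"
  unfolding tens_und_def using assms BA_D(1) q_epi(1) by (intro factor_eqI) auto

lemma tens_und_ide:
  assumes [simp]: "M \<in> BO" "N \<in> BO"
  shows "tens_und M (Ide C (und M)) M N (Ide C (und N)) N = Ide C (Cod C (q M N))"
  by (rule tens_undI) (simp_all add: BA_iff hom_def)

lemma tens_und_comp:
  assumes f: "(M, f, M') \<in> BA" and f': "(M', f', M'') \<in> BA"
    and g: "(N, g, N') \<in> BA" and g': "(N', g', N'') \<in> BA" and "(M, f' \<cdot> f, M'') \<in> BA" "(N, g' \<cdot> g, N'') \<in> BA"
  shows "tens_und M (f' \<cdot> f) M'' N (g' \<cdot> g) N'' =
    tens_und M' f' M'' N' g' N'' \<cdot> tens_und M f M' N g N'"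
proof (rule tens_undI)
  note [simp] = BA_D(1-5)[OF f] BA_D(1-5)[OF g] BA_D(1-5)[OF f'] BA_D(1-5)[OF g']
    tens_und(1-3)[OF f g] tens_und(1-3)[OF f' g']
  let ?k = "tens_und M f M' N g N'" and ?k' = "tens_und M' f' M'' N' g' N''"
  have "(?k' \<cdot> ?k) \<cdot> q M N = (?k' \<cdot> q M' N') \<cdot> (f \<otimes> g)" by (simp add: tens_und(4)[OF f g])
  also have "\<dots> = q M'' N'' \<cdot> ((f' \<cdot> f) \<otimes> (g' \<cdot> g))"
    unfolding tens_und(4)[OF f' g'] by (simp add: tens_comp)
  finally show "(?k' \<cdot> ?k) \<cdot> q M N = q M'' N'' \<cdot> ((f' \<cdot> f) \<otimes> (g' \<cdot> g))" .
  show "?k' \<cdot> ?k \<in> Arr C" "Dom C (?k' \<cdot> ?k) = Cod C (q M N)" by simp_all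
qed (rule assms)+

section \<open>The category of bimodules\<close>

abbreviation "D \<equiv> bimod_cat C Q A m \<eta>"

lemma bimod_cat_simps [simp]:
  "Obj D = BO" "Arr D = BA" "Dom D (M, f, N) = M" "Cod D (M, f, N) = N"
  "M \<boxtimes>\<^bsub>D\<^esub> N = bt M N" "\<one>\<^bsub>D\<^esub> = bimod_unit A m" "Assoc D = bimod_assoc C Q A"
  "Ide D M = (M, Ide C (und M), M)" "(N, g, P) \<cdot>\<^bsub>D\<^esub> (M, f, N') = (M, g \<cdot> f, P)"
  "(M, f, M') \<otimes>\<^bsub>D\<^esub> (N, g, N') = (bt M N, tens_und M f M' N g N', bt M' N')"
  by (simp_all add: bimod_cat_def tens_und_def)

lemma hom_bimod_cat: "h \<in> hom D M N \<longleftrightarrow> (\<exists>f. h = (M, f, N) \<and> (M, f, N) \<in> BA)"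
  by (cases h) (auto simp: hom_def)

lemma BA_comp:
  assumes f: "(M, f, N) \<in> BA" and g: "(N, g, P) \<in> BA"
  shows "(M, g \<cdot> f, P) \<in> BA"
proof -
  note [simp] = BA_D(1-5)[OF f] BA_D(1-5)[OF g]
  have "(g \<cdot> f) \<cdot> lact M = (g \<cdot> lact N) \<cdot> (A \<triangleleft> f)" by (simp add: BA_D(6)[OF f])
  also have "\<dots> = lact P \<cdot> (A \<triangleleft> (g \<cdot> f))" unfolding BA_D(6)[OF g] by (simp flip: whisk_comp)
  finally have 1: "(g \<cdot> f) \<cdot> lact M = lact P \<cdot> (A \<triangleleft> (g \<cdot> f))" .
  have "(g \<cdot> f) \<cdot> ract M = (g \<cdot> ract N) \<cdot> (f \<triangleright> A)" by (simp add: BA_D(7)[OF f])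
  also have "\<dots> = ract P \<cdot> ((g \<cdot> f) \<triangleright> A)" unfolding BA_D(7)[OF g] by (simp flip: whisk_comp)
  finally show ?thesis using 1 by (simp add: BA_iff hom_def)
qed

lemma category_bimod_cat: "category D"
proof
  fix f assume "f \<in> Arr D"
  then show "Dom D f \<in> Obj D \<and> Cod D f \<in> Obj D" by (cases f) (auto dest: BA_D)
next
  fix M assume "M \<in> Obj D"
  then show "Ide D M \<in> hom D M M" by (simp add: hom_bimod_cat BA_iff) (simp add: hom_def)
next
  fix M N P f g assume "f \<in> hom D M N" "g \<in> hom D N P"
  then show "g \<cdot>\<^bsub>D\<^esub> f \<in> hom D M P" by (auto simp: hom_bimod_cat BA_comp)
next
  fix M N f assume "f \<in> hom D M N"
  then obtain f' where f: "f = (M, f', N)" "(M, f', N) \<in> BA" by (auto simp: hom_bimod_cat)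
  show "f \<cdot>\<^bsub>D\<^esub> Ide D M = f" "Ide D N \<cdot>\<^bsub>D\<^esub> f = f" using BA_D[OF f(2)] by (simp_all add: f(1))
next
  fix L M N P f g h assume "f \<in> hom D L M" "g \<in> hom D M N" "h \<in> hom D N P"
  then obtain f' g' h' where f: "f = (L, f', M)" "(L, f', M) \<in> BA"
    and g: "g = (M, g', N)" "(M, g', N) \<in> BA" and h: "h = (N, h', P)" "(N, h', P) \<in> BA"
    by (auto simp: hom_bimod_cat)
  show "(h \<cdot>\<^bsub>D\<^esub> g) \<cdot>\<^bsub>D\<^esub> f = h \<cdot>\<^bsub>D\<^esub> (g \<cdot>\<^bsub>D\<^esub> f)"
    using BA_D(3-5)[OF f(2)] BA_D(3-5)[OF g(2)] BA_D(3-5)[OF h(2)] by (simp add: f(1) g(1) h(1))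
qed

section \<open>The embedding and its comparison arrows\<close>

definition coflat_objs :: "('a, 'b) tr_obj set" where
  "coflat_objs = {y \<in> TO. left_coflat C (fst y)}"

fun free_arr :: "('a, 'b) tr_arr \<Rightarrow> ('a, 'b) bim_arr" where
  "free_arr (y, f, z) = (free y, ext (fst z) f, free z)"

text \<open>The isomorphism from AYZ to the tensor product of AY and AZ over A, obtained by
  factoring the chosen coequalizer map through the concrete one. For two copies of the cowreath it
  is \<open>coring_ident\<close>.\<close>

definition J_und :: "('a, 'b) tr_obj \<Rightarrow> ('a, 'b) tr_obj \<Rightarrow> 'b" where
  "J_und y z = factor C (q (free y) (free z)) (bal y z)"

definition J :: "('a, 'b) tr_obj \<Rightarrow> ('a, 'b) tr_obj \<Rightarrow> ('a, 'b) bim_arr" where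
  "J y z = (free (tobj y z), J_und y z, bt (free y) (free z))"

text \<open>Coflatness of Y is what puts \<open>free y\<close> among the bimodules considered; it
  holds for the unit object and passes to tensor products, so the embedding is defined on a class
  closed under the monoidal structure.\<close>

lemma coflat_objs_simps [simp]:
  "y \<in> coflat_objs \<Longrightarrow> y \<in> TO" "tunit \<in> coflat_objs"
  "\<lbrakk>y \<in> coflat_objs; z \<in> coflat_objs\<rbrakk> \<Longrightarrow> tobj y z \<in> coflat_objs"
  by (auto simp: coflat_objs_def left_coflat_unit left_coflat_tens)

lemma coflat_free_iso: "y \<in> coflat_objs \<Longrightarrow> free_iso y (free y) (Ide C (A \<boxtimes> fst y)) (Ide C (A \<boxtimes> fst y))"
  unfolding coflat_objs_def by (blast intro: free_iso_free)

lemma free_free_bimods [simp]: "y \<in> coflat_objs \<Longrightarrow> free y \<in> free_bimods"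
  using coflat_free_iso unfolding free_bimods_def by blast

lemma free_tunit: "free tunit = bimod_unit A m"
  by (simp add: free_def coring_obj_def bimod_unit_def)

lemma free_iso_BA:
  assumes "free_iso y N i j"
  shows "(free y, i, N) \<in> BA" "(N, j, free y) \<in> BA"
  using free_isoD[OF assms] free_iso_inverse[OF assms] free_iso_BO[OF assms]
    free_iso_BO[OF free_iso_free[OF free_isoD(1,2)[OF assms]]] by (simp_all add: BA_iff hom_def)

text \<open>With identities for both isomorphisms, \<open>free_iso_tens\<close> gives some
  \<open>I\<close> carrying \<open>bal y z\<close> to the chosen coequalizer map. As
  \<open>bal y z\<close> is epi, \<open>factor\<close> picks this \<open>I\<close>.\<close>

lemma J_und:
  assumes [simp]: "y \<in> coflat_objs" "z \<in> coflat_objs"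
  shows "\<exists>I'. free_iso (tobj y z) (bt (free y) (free z)) (J_und y z) I'"
    and "J_und y z \<cdot> bal y z = q (free y) (free z)"
proof -
  from free_iso_tens[OF coflat_free_iso[OF assms(1)] coflat_free_iso[OF assms(2)]]
  obtain I I' where I: "free_iso (tobj y z) (bt (free y) (free z)) I I'"
    and "I \<cdot> bal y z = q (free y) (free z) \<cdot> (Ide C (A \<boxtimes> fst y) \<otimes> Ide C (A \<boxtimes> fst z))" by blast
  then have *: "I \<cdot> bal y z = q (free y) (free z)" by simp
  have "J_und y z = I"
    unfolding J_und_def by (rule factor_eqI) (simp_all add: epi_bal free_isoD[OF I] *)
  then show "\<exists>I'. free_iso (tobj y z) (bt (free y) (free z)) (J_und y z) I'"
    "J_und y z \<cdot> bal y z = q (free y) (free z)" using I * by auto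
qed

lemma J_und_simps [simp]:
  assumes "y \<in> coflat_objs" "z \<in> coflat_objs"
  shows "J_und y z \<in> Arr C" "Dom C (J_und y z) = A \<boxtimes> (fst y \<boxtimes> fst z)"
    "Cod C (J_und y z) = Cod C (q (free y) (free z))"
    "(free (tobj y z), J_und y z, bt (free y) (free z)) \<in> BA"
proof -
  obtain I' where I: "free_iso (tobj y z) (bt (free y) (free z)) (J_und y z) I'"
    using J_und(1)[OF assms] by blast
  show "J_und y z \<in> Arr C" "Dom C (J_und y z) = A \<boxtimes> (fst y \<boxtimes> fst z)"
    "Cod C (J_und y z) = Cod C (q (free y) (free z))" using free_isoD[OF I] by simp_all
  show "(free (tobj y z), J_und y z, bt (free y) (free z)) \<in> BA" by (rule free_iso_BA[OF I])
qed

lemma BA_ide [simp]: "M \<in> BO \<Longrightarrow> (M, Ide C (und M), M) \<in> BA"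
  by (simp add: BA_iff hom_def)

text \<open>The last equation is what evaluates the \<open>factor\<close> terms in the associator
  and the unitors.\<close>

lemma J_inverse:
  assumes "y \<in> coflat_objs" "z \<in> coflat_objs"
  obtains k where "(bt (free y) (free z), k, free (tobj y z)) \<in> BA"
    "k \<cdot> J_und y z = Ide C (A \<boxtimes> (fst y \<boxtimes> fst z))"
    "J_und y z \<cdot> k = Ide C (Cod C (q (free y) (free z)))" "k \<cdot> q (free y) (free z) = bal y z"
proof -
  note [simp] = assms
  obtain k where k: "free_iso (tobj y z) (bt (free y) (free z)) (J_und y z) k"
    using J_und(1)[OF assms] by blast
  note [simp] = free_isoD(6-8)[OF k]
  have "k \<cdot> q (free y) (free z) = (k \<cdot> J_und y z) \<cdot> bal y z"
    using J_und(2)[OF assms] by simp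
  also have "\<dots> = bal y z" unfolding free_isoD(16)[OF k] by simp
  finally show thesis using that free_iso_BA(2)[OF k] free_isoD(16,17)[OF k] by simp
qed

lemma free_arr_BA:
  assumes "transfer_arr y f z" "y \<in> coflat_objs" "z \<in> coflat_objs"
  shows "(free y, ext (fst z) f, free z) \<in> BA"
proof -
  note [simp] = transfer_arrD[OF assms(1)] assms(2,3)
  show ?thesis using ext_linear[of f "fst z"] transfer_arr_linear[OF assms(1)]
    by (simp add: BA_iff hom_def)
qed

lemma bij_free_arr:
  assumes [simp]: "y \<in> coflat_objs" "z \<in> coflat_objs"
  shows "bij_betw free_arr (hom T y z) (hom D (free y) (free z))"
proof (rule bij_betwI')
  fix g h assume "g \<in> hom T y z" "h \<in> hom T y z"
  then show "free_arr g = free_arr h \<longleftrightarrow> g = h"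
    by (auto simp: hom_transfer_cat transfer_arr_def intro: ext_inj)
next
  fix h assume "h \<in> hom T y z"
  then show "free_arr h \<in> hom D (free y) (free z)"
    by (auto simp: hom_transfer_cat hom_bimod_cat free_arr_BA)
next
  fix h assume "h \<in> hom D (free y) (free z)"
  then obtain g where h: "h = (free y, g, free z)" "(free y, g, free z) \<in> BA"
    by (auto simp: hom_bimod_cat)
  note d = BA_D[OF h(2), simplified]
  note [simp] = d(3-5)
  have *: "ext (fst z) (g \<cdot> (\<eta> \<triangleright> fst y)) = g"
    by (rule linear_eq_ext) (simp_all add: d(6))
  then have "transfer_arr y (g \<cdot> (\<eta> \<triangleright> fst y)) z"
    using d(7) by (simp add: transfer_arr_def hom_def)
  then show "\<exists>k \<in> hom T y z. h = free_arr k"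
    using * by (intro bexI[of _ "(y, g \<cdot> (\<eta> \<triangleright> fst y), z)"]) (simp_all add: hom_transfer_cat h(1))
qed

text \<open>On the epi \<open>bal y z\<close> the left side is computed by \<open>ext_tens\<close>
  and the right side by the defining equation of \<open>tens_und\<close>.\<close>

lemma J_natural:
  assumes f: "transfer_arr y f y'" and g: "transfer_arr z g z'"
    and [simp]: "y \<in> coflat_objs" "y' \<in> coflat_objs" "z \<in> coflat_objs" "z' \<in> coflat_objs"
  shows "J_und y' z' \<cdot> ext (fst y' \<boxtimes> fst z') (bal y' z' \<cdot> (f \<otimes> g)) =
    tens_und (free y) (ext (fst y') f) (free y') (free z) (ext (fst z') g) (free z') \<cdot> J_und y z"
proof (rule epiD[OF epi_bal[of y z]])
  note t = tens_und[OF free_arr_BA[OF f] free_arr_BA[OF g], simplified]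
  note [simp] = transfer_arrD[OF f] transfer_arrD[OF g] t(1-3)
  let ?F = "ext (fst y') f" and ?G = "ext (fst z') g"
  let ?k = "tens_und (free y) ?F (free y') (free z) ?G (free z')"
  let ?h = "ext (fst y' \<boxtimes> fst z') (bal y' z' \<cdot> (f \<otimes> g))"
  have "(J_und y' z' \<cdot> ?h) \<cdot> bal y z = (J_und y' z' \<cdot> bal y' z') \<cdot> (?F \<otimes> ?G)"
    by (simp add: ext_tens[OF f g])
  also have "\<dots> = (?k \<cdot> J_und y z) \<cdot> bal y z" by (simp add: J_und(2) t(4))
  finally show "(J_und y' z' \<cdot> ?h) \<cdot> bal y z = (?k \<cdot> J_und y z) \<cdot> bal y z" .
qed (use transfer_arrD[OF f] transfer_arrD[OF g]
    tens_und(1-3)[OF free_arr_BA[OF f] free_arr_BA[OF g], simplified] in simp_all)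

text \<open>The class \<open>K\<close> enters here: that the tensor products lie in
  \<open>BO\<close> is provided by closure of \<open>free_bimods\<close>.\<close>

lemma tens_und_BA:
  assumes f: "(M, f, M') \<in> BA" and g: "(N, g, N') \<in> BA"
    and "M \<in> free_bimods" "M' \<in> free_bimods" "N \<in> free_bimods" "N' \<in> free_bimods"
  shows "(bt M N, tens_und M f M' N g N', bt M' N') \<in> BA"
  using tens_und[OF f g] assms(3-) by (simp add: BA_iff hom_def)

text \<open>\<open>bimod_assoc\<close> is a \<open>factor\<close> term whose existence condition is
  not established beforehand. The arrow is therefore built from the comparison isomorphisms, as
  \<open>v\<close> after an inverse of \<open>u\<close>, and then recognized as that
  \<open>factor\<close> by its values on an epi.\<close>

lemma free_assoc:
  assumes [simp]: "y \<in> coflat_objs" "z \<in> coflat_objs" "w \<in> coflat_objs"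
  defines "u \<equiv> tens_und (free (tobj y z)) (J_und y z) (bt (free y) (free z))
      (free w) (Ide C (und (free w))) (free w) \<cdot> J_und (tobj y z) w"
    and "v \<equiv> tens_und (free y) (Ide C (und (free y))) (free y)
      (free (tobj z w)) (J_und z w) (bt (free z) (free w)) \<cdot> J_und y (tobj z w)"
  obtains a where "bimod_assoc C Q A (free y) (free z) (free w) =
      (bt (bt (free y) (free z)) (free w), a, bt (free y) (bt (free z) (free w)))"
    "(bt (bt (free y) (free z)) (free w), a, bt (free y) (bt (free z) (free w))) \<in> BA" "a \<cdot> u = v"
proof -
  let ?M = "free y" and ?N = "free z" and ?P = "free w"
  let ?MN = "bt ?M ?N" and ?NP = "bt ?N ?P" and ?yz = "tobj y z" and ?zw = "tobj z w"
  note iP = BA_ide[of ?P, simplified] and iM = BA_ide[of ?M, simplified]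
  obtain k where k: "(?MN, k, free ?yz) \<in> BA" "k \<cdot> J_und y z = Ide C (A \<boxtimes> (fst y \<boxtimes> fst z))"
    "J_und y z \<cdot> k = Ide C (Cod C (q ?M ?N))" "k \<cdot> q ?M ?N = bal y z" by (rule J_inverse[of y z]) simp_all
  obtain l where l: "(bt (free ?yz) ?P, l, free (tobj ?yz w)) \<in> BA"
    "l \<cdot> J_und ?yz w = Ide C (A \<boxtimes> (fst ?yz \<boxtimes> fst w))"
    "l \<cdot> q (free ?yz) ?P = bal ?yz w" by (rule J_inverse[of ?yz w]) simp_all
  have Jyz: "(free ?yz, J_und y z, ?MN) \<in> BA" and Jzw: "(free ?zw, J_und z w, ?NP) \<in> BA"
    by simp_all
  let ?kP = "tens_und ?MN k (free ?yz) ?P (Ide C (A \<boxtimes> fst w)) ?P"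
  let ?JP = "tens_und (free ?yz) (J_und y z) ?MN ?P (Ide C (A \<boxtimes> fst w)) ?P"
  let ?MJ = "tens_und ?M (Ide C (A \<boxtimes> fst y)) ?M (free ?zw) (J_und z w) ?NP"
  note tk = tens_und[OF k(1) iP, simplified] and tJ = tens_und[OF Jyz iP, simplified]
    and tM = tens_und[OF iM Jzw, simplified]
  have TO [simp]: "tobj y ?zw = tobj ?yz w" "tobj y (tobj z w) \<in> TO"
    using tobj_strict(3)[of y z w] by (simp_all flip: tobj_strict(3))
  note [simp] = tk(1-3) tJ(1-3) tM(1-3) BA_D(3-5)[OF k(1), simplified] BA_D(3-5)[OF l(1), simplified]
  have u': "(bt ?MN ?P, l \<cdot> ?kP, free (tobj ?yz w)) \<in> BA"
    by (rule BA_comp[OF tens_und_BA[OF k(1) iP] l(1)]) simp_all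
  have v: "(free (tobj ?yz w), v, bt ?M ?NP) \<in> BA"
    unfolding v_def using BA_comp[OF J_und_simps(4)[of y ?zw] tens_und_BA[OF iM Jzw]] by simp
  \<comment> \<open>\<open>l\<close> and \<open>?kP\<close> undo the two factors of
    \<open>u\<close>, so \<open>a\<close> is \<open>v\<close> composed with an inverse of
    \<open>u\<close>.\<close>
  define a where "a = v \<cdot> (l \<cdot> ?kP)"
  note [simp] = BA_D(3-5)[OF u', simplified] BA_D(3-5)[OF v, simplified]
  have a: "(bt ?MN ?P, a, bt ?M ?NP) \<in> BA" unfolding a_def by (rule BA_comp[OF u' v])
  have "?kP \<cdot> ?JP = tens_und (free ?yz) (k \<cdot> J_und y z) (free ?yz) ?P
      (Ide C (A \<boxtimes> fst w) \<cdot> Ide C (A \<boxtimes> fst w)) ?P"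
    using iP by (intro tens_und_comp[symmetric] Jyz k(1) BA_comp[OF Jyz k(1)]) simp_all
  also have "\<dots> = Ide C (Cod C (q (free ?yz) ?P))"
    using tens_und_ide[of "free ?yz" ?P] by (simp add: k(2))
  finally have kJ: "?kP \<cdot> ?JP = Ide C (Cod C (q (free ?yz) ?P))" .
  have "a \<cdot> u = v \<cdot> l \<cdot> (?kP \<cdot> ?JP) \<cdot> J_und ?yz w" by (simp add: a_def u_def)
  also have "\<dots> = v" unfolding kJ using l(2) by simp
  finally have au: "a \<cdot> u = v" .
  have cof: "left_coflat C (und ?P)" using free_bimods_BO[of ?P] by (simp add: bimod_objs_def)
  have ep: "epi C (q ?MN ?P \<cdot> (q ?M ?N \<triangleright> und ?P))"
    by (rule epi_comp[OF q_epi(3)[OF _ _ cof] q_epi(1)]) simp_all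
  have "a \<cdot> (q ?MN ?P \<cdot> (q ?M ?N \<triangleright> und ?P)) = v \<cdot> l \<cdot> (?kP \<cdot> q ?MN ?P) \<cdot> (q ?M ?N \<triangleright> und ?P)"
    by (simp add: a_def)
  also have "\<dots> = v \<cdot> (l \<cdot> q (free ?yz) ?P) \<cdot> ((k \<cdot> q ?M ?N) \<triangleright> und ?P)"
    unfolding tk(4) by (simp flip: whisk_comp)
  \<comment> \<open>Both coequalizer maps have now been replaced by concrete ones, so
    \<open>bal_assoc\<close> can change the bracketing.\<close>
  also have "\<dots> = v \<cdot> (bal ?yz w \<cdot> (bal y z \<triangleright> (A \<boxtimes> fst w)))" unfolding l(3) k(4) by simp
  also have "\<dots> = ?MJ \<cdot> (J_und y ?zw \<cdot> bal y ?zw) \<cdot> ((A \<boxtimes> fst y) \<triangleleft> bal z w)"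
    unfolding bal_assoc[OF coflat_objs_simps(1) coflat_objs_simps(1) coflat_objs_simps(1), OF assms(1-3)]
    by (simp add: v_def)
  also have "\<dots> = (?MJ \<cdot> q ?M (free ?zw)) \<cdot> ((A \<boxtimes> fst y) \<triangleleft> bal z w)"
    by (simp add: J_und(2))
  also have "\<dots> = q ?M ?NP \<cdot> (und ?M \<triangleleft> (J_und z w \<cdot> bal z w))"
    unfolding tM(4) by (simp flip: whisk_comp)
  finally have "factor C (q ?M ?NP \<cdot> (und ?M \<triangleleft> q ?N ?P)) (q ?MN ?P \<cdot> (q ?M ?N \<triangleright> und ?P)) = a"
    using BA_D(3-5)[OF a] by (intro factor_eqI[OF ep]) (simp_all add: J_und(2))
  then have "bimod_assoc C Q A ?M ?N ?P = (bt ?MN ?P, a, bt ?M ?NP)" by (simp add: bimod_assoc_def)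
  then show thesis using a au by (rule that)
qed

text \<open>\<open>bal tunit y\<close> is the left action on AY and \<open>bal y tunit\<close> is
  the right action, exactly the arrows that the unitors factor. Hence the unitors are the inverses
  of the comparison arrows.\<close>

lemma free_unitors:
  assumes [simp]: "y \<in> coflat_objs"
  obtains l r where "LUnit D (free y) = (bt (bimod_unit A m) (free y), l, free y)"
    "(bt (bimod_unit A m) (free y), l, free y) \<in> BA" "l \<cdot> J_und tunit y = Ide C (A \<boxtimes> fst y)"
    and "RUnit D (free y) = (bt (free y) (bimod_unit A m), r, free y)"
    "(bt (free y) (bimod_unit A m), r, free y) \<in> BA" "r \<cdot> J_und y tunit = Ide C (A \<boxtimes> fst y)"
proof -
  have s [simp]: "tobj tunit y = y" "tobj y tunit = y" by (simp_all add: tobj_strict)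
  obtain l where l: "(bt (free tunit) (free y), l, free y) \<in> BA"
    "l \<cdot> J_und tunit y = Ide C (A \<boxtimes> fst y)" "l \<cdot> q (free tunit) (free y) = bal tunit y"
    by (rule J_inverse[of tunit y]) simp_all
  obtain r where r: "(bt (free y) (free tunit), r, free y) \<in> BA"
    "r \<cdot> J_und y tunit = Ide C (A \<boxtimes> fst y)" "r \<cdot> q (free y) (free tunit) = bal y tunit"
    by (rule J_inverse[of y tunit]) simp_all
  have "factor C (lact (free y)) (q (free tunit) (free y)) = l"
    by (rule factor_eqI[OF q_epi(1)]) (use l BA_D(3-5)[OF l(1)] in \<open>simp_all add: bal_def act_tunit\<close>)
  moreover have "factor C (ract (free y)) (q (free y) (free tunit)) = r"
    by (rule factor_eqI[OF q_epi(1)]) (use r BA_D(3-5)[OF r(1)] in \<open>simp_all add: bal_def\<close>)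
  ultimately show thesis using l(1,2) r(1,2)
    by (intro that[of l r]) (simp_all add: bimod_cat_def flip: free_tunit)
qed

lemma embedding: "monoidal_embedding T D coflat_objs free_bimods free free_arr J"
proof (intro monoidal_embedding.intro category_transfer_cat category_bimod_cat
    monoidal_embedding_axioms.intro)
  let ?S = coflat_objs and ?K = free_bimods
  show "?S \<subseteq> Obj T" "\<one>\<^bsub>T\<^esub> \<in> ?S" "?K \<subseteq> Obj D" "free \<one>\<^bsub>T\<^esub> = \<one>\<^bsub>D\<^esub>"
    by (auto simp: free_tunit)
  show "y \<boxtimes>\<^bsub>T\<^esub> z \<in> ?S" if "y \<in> ?S" "z \<in> ?S" for y z using that by simp
  show "\<one>\<^bsub>T\<^esub> \<boxtimes>\<^bsub>T\<^esub> y = y" "y \<boxtimes>\<^bsub>T\<^esub> \<one>\<^bsub>T\<^esub> = y" "LUnit T y = Ide T y" "RUnit T y = Ide T y" if "y \<in> ?S" for y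
    using that by (simp_all add: tobj_strict)
  show "(y \<boxtimes>\<^bsub>T\<^esub> z) \<boxtimes>\<^bsub>T\<^esub> w = y \<boxtimes>\<^bsub>T\<^esub> (z \<boxtimes>\<^bsub>T\<^esub> w)" "Assoc T y z w = Ide T (y \<boxtimes>\<^bsub>T\<^esub> (z \<boxtimes>\<^bsub>T\<^esub> w))"
    if "y \<in> ?S" "z \<in> ?S" "w \<in> ?S" for y z w
    using that by (simp_all add: tobj_strict)
  show "f \<otimes>\<^bsub>T\<^esub> g \<in> hom T (y \<boxtimes>\<^bsub>T\<^esub> z) (y' \<boxtimes>\<^bsub>T\<^esub> z')" if "f \<in> hom T y y'" "g \<in> hom T z z'" for f g y y' z z'
    using that by (auto simp: hom_transfer_cat transfer_cat_tens transfer_arr_tens)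
  show "M \<boxtimes>\<^bsub>D\<^esub> N \<in> ?K" if "M \<in> ?K" "N \<in> ?K" for M N using that by simp
  show "f \<otimes>\<^bsub>D\<^esub> g \<in> hom D (M \<boxtimes>\<^bsub>D\<^esub> N) (M' \<boxtimes>\<^bsub>D\<^esub> N')"
    if "f \<in> hom D M M'" "g \<in> hom D N N'" "M \<in> ?K" "M' \<in> ?K" "N \<in> ?K" "N' \<in> ?K" for f g M M' N N'
    using that by (auto simp: hom_bimod_cat intro: tens_und_BA)
  show "Ide D M \<otimes>\<^bsub>D\<^esub> Ide D N = Ide D (M \<boxtimes>\<^bsub>D\<^esub> N)" if "M \<in> ?K" "N \<in> ?K" for M N
    using that by (simp add: tens_und_ide)
  show "(f' \<cdot>\<^bsub>D\<^esub> f) \<otimes>\<^bsub>D\<^esub> (g' \<cdot>\<^bsub>D\<^esub> g) = (f' \<otimes>\<^bsub>D\<^esub> g') \<cdot>\<^bsub>D\<^esub> (f \<otimes>\<^bsub>D\<^esub> g)"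
    if "f \<in> hom D M M'" "f' \<in> hom D M' M''" "g \<in> hom D N N'" "g' \<in> hom D N' N''"
    for f f' g g' M M' M'' N N' N''
    using that by (auto simp: hom_bimod_cat tens_und_comp BA_comp)
  show "free y \<in> ?K" if "y \<in> ?S" for y using that by simp
  show "bij_betw free_arr (hom T y z) (hom D (free y) (free z))" if "y \<in> ?S" "z \<in> ?S" for y z
    using that by (rule bij_free_arr)
  show "free_arr (Ide T y) = Ide D (free y)" if "y \<in> ?S" for y using that by (simp add: ext_ide)
  show "free_arr (g \<cdot>\<^bsub>T\<^esub> f) = free_arr g \<cdot>\<^bsub>D\<^esub> free_arr f" if fg: "f \<in> hom T y z" "g \<in> hom T z w" for f g y z w
  proof -
    obtain f' g' where f: "f = (y, f', z)" "transfer_arr y f' z" and g: "g = (z, g', w)" "transfer_arr z g' w"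
      using fg by (auto simp: hom_transfer_cat)
    show ?thesis using transfer_arrD[OF f(2)] transfer_arrD[OF g(2)]
      by (simp add: f(1) g(1) transfer_cat_comp[OF f(2) g(2)] ext_comp[of f' "fst z"])
  qed
  show "J y z \<in> hom D (free (y \<boxtimes>\<^bsub>T\<^esub> z)) (free y \<boxtimes>\<^bsub>D\<^esub> free z)" if "y \<in> ?S" "z \<in> ?S" for y z
    using that by (simp add: hom_bimod_cat J_def)
  show "\<exists>k \<in> hom D (free y \<boxtimes>\<^bsub>D\<^esub> free z) (free (y \<boxtimes>\<^bsub>T\<^esub> z)).
      k \<cdot>\<^bsub>D\<^esub> J y z = Ide D (free (y \<boxtimes>\<^bsub>T\<^esub> z)) \<and> J y z \<cdot>\<^bsub>D\<^esub> k = Ide D (free y \<boxtimes>\<^bsub>D\<^esub> free z)"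
    if yz: "y \<in> ?S" "z \<in> ?S" for y z
  proof -
    obtain k where "(bt (free y) (free z), k, free (tobj y z)) \<in> BA"
      "k \<cdot> J_und y z = Ide C (A \<boxtimes> (fst y \<boxtimes> fst z))" "J_und y z \<cdot> k = Ide C (Cod C (q (free y) (free z)))"
      using yz by (rule J_inverse)
    then show ?thesis
      by (intro bexI[of _ "(bt (free y) (free z), k, free (tobj y z))"]) (simp_all add: J_def hom_bimod_cat)
  qed
  show "J y' z' \<cdot>\<^bsub>D\<^esub> free_arr (f \<otimes>\<^bsub>T\<^esub> g) = (free_arr f \<otimes>\<^bsub>D\<^esub> free_arr g) \<cdot>\<^bsub>D\<^esub> J y z"
    if "f \<in> hom T y y'" "g \<in> hom T z z'" "y \<in> ?S" "y' \<in> ?S" "z \<in> ?S" "z' \<in> ?S" for f g y y' z z'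
    using that by (auto simp: hom_transfer_cat transfer_cat_tens J_def J_natural)
  show "Assoc D (free y) (free z) (free w) \<in> hom D ((free y \<boxtimes>\<^bsub>D\<^esub> free z) \<boxtimes>\<^bsub>D\<^esub> free w) (free y \<boxtimes>\<^bsub>D\<^esub> (free z \<boxtimes>\<^bsub>D\<^esub> free w))"
    "Assoc D (free y) (free z) (free w) \<cdot>\<^bsub>D\<^esub> (J y z \<triangleright>\<^bsub>D\<^esub> free w) \<cdot>\<^bsub>D\<^esub> J (y \<boxtimes>\<^bsub>T\<^esub> z) w =
      (free y \<triangleleft>\<^bsub>D\<^esub> J z w) \<cdot>\<^bsub>D\<^esub> J y (z \<boxtimes>\<^bsub>T\<^esub> w)"
    if "y \<in> ?S" "z \<in> ?S" "w \<in> ?S" for y z w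
    using that by - (rule free_assoc[OF that]; simp add: hom_bimod_cat J_def tobj_strict)+
  show "LUnit D (free y) \<in> hom D (\<one>\<^bsub>D\<^esub> \<boxtimes>\<^bsub>D\<^esub> free y) (free y)" "LUnit D (free y) \<cdot>\<^bsub>D\<^esub> J \<one>\<^bsub>T\<^esub> y = Ide D (free y)"
    "RUnit D (free y) \<in> hom D (free y \<boxtimes>\<^bsub>D\<^esub> \<one>\<^bsub>D\<^esub>) (free y)" "RUnit D (free y) \<cdot>\<^bsub>D\<^esub> J y \<one>\<^bsub>T\<^esub> = Ide D (free y)"
    if "y \<in> ?S" for y
    using that by - (rule free_unitors[OF that]; simp add: hom_bimod_cat J_def tobj_strict)+
qed

end

theorem theorem5p2:
  fixes C :: "('o, 'a) tensor_cat"
    and Q :: "'a \<Rightarrow> 'a \<Rightarrow> 'a"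
    and A X :: 'o
    and m \<eta> \<psi> \<delta> \<epsilon> :: 'a
  assumes "strict_monoidal_category C"
    and "has_coequalizers C Q"
    and "algebra C A m \<eta>"
    and "left_coflat C A"
    and "cowreath C A m \<eta> X \<psi> \<delta> \<epsilon>"
    and "left_coflat C X"
  shows "frobenius_coalgebra (transfer_cat C A m \<eta>) (X, \<psi>)
           (transfer_comult C X \<psi> \<delta>) (transfer_counit C A X \<psi> \<epsilon>)
     \<longleftrightarrow>
         frobenius_coalgebra (bimod_cat C Q A m \<eta>) (coring_obj C A m X \<psi>)
           (coring_comult C Q A m X \<psi> \<delta>) (coring_counit C A m X \<psi> \<epsilon>)"
proof -
  interpret coflat_algebra C A m \<eta> Q
    using assms by (simp add: coflat_algebra_def algebra_in_category_def
        algebra_in_category_axioms_def coflat_algebra_axioms_def)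
  interpret E: monoidal_embedding T D coflat_objs free_bimods free free_arr J
    by (rule embedding)
  let ?x = "(X, \<psi>)" and ?d = "transfer_comult C X \<psi> \<delta>" and ?e = "transfer_counit C A X \<psi> \<epsilon>"
  have c: "coalgebra T ?x ?d ?e" using assms(5) by (simp add: cowreath_def)
  then have x: "?x \<in> TO" and d: "?d \<in> hom T ?x (tobj ?x ?x)" and e: "?e \<in> hom T ?x tunit"
    by (simp_all add: coalgebra_def)
  \<comment> \<open>Coflatness of X puts the cowreath into the domain of the embedding.\<close>
  have S: "?x \<in> coflat_objs" using x assms(6) unfolding coflat_objs_def by simp
  have \<delta>: "transfer_arr ?x \<delta> (tobj ?x ?x)" using d by (auto simp: hom_transfer_cat transfer_comult_def)
  have "transfer_arr ?x \<epsilon> tunit" using e by (auto simp: hom_transfer_cat transfer_counit_def)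
  note [simp] = transfer_arrD(3-5)[OF this, simplified] transfer_arrD(3-5)[OF \<delta>, simplified] J_und_simps[OF S S, simplified] TO_simps[OF x, simplified]
  have F: "free ?x = coring_obj C A m X \<psi>" by (simp add: free_def)
  have "act ?x = ract (coring_obj C A m X \<psi>)" by (simp flip: F)
  \<comment> \<open>\<open>bal ?x ?x\<close> is the right action on AX tensored with X, so the
    comparison arrow is the identification built into the coring comultiplication. The image of the
    coalgebra is thus equal to the given coring, not merely isomorphic to it.\<close>
  then have "J_und ?x ?x = coring_ident C Q A m X \<psi>"
    by (simp add: J_und_def coring_ident_def bal_def F)
  moreover have "ext (X \<boxtimes>\<^bsub>C\<^esub> X) \<delta> = (m \<triangleright>\<^bsub>C\<^esub> (X \<boxtimes>\<^bsub>C\<^esub> X)) \<cdot>\<^bsub>C\<^esub> (A \<triangleleft>\<^bsub>C\<^esub> \<delta>)"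
    by (simp add: ext_def)
  ultimately have "E.F_comult ?x ?d = coring_comult C Q A m X \<psi> \<delta>"
    by (simp add: E.F_comult_def J_def transfer_comult_def coring_comult_def F)
  moreover have "free_arr ?e = coring_counit C A m X \<psi> \<epsilon>"
  proof -
    have "ext \<one>\<^bsub>C\<^esub> \<epsilon> = m \<cdot>\<^bsub>C\<^esub> (A \<triangleleft>\<^bsub>C\<^esub> \<epsilon>)" by (simp add: ext_def)
    then show ?thesis by (simp add: transfer_counit_def coring_counit_def free_tunit F)
  qed
  ultimately show ?thesis using E.frobenius_iff[OF S d[folded transfer_cat_simps] e[folded transfer_cat_simps] c]
    by (simp add: F)
qed

end
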